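(* Let $\rho$ be a density matrix on $L^2(\mathbf{R}^d)^{\otimes N}$ and let $i\neq j$ in $\{1,\dots,N\}$. Then $$W^{\frac\pi2}[U_{i\leftrightarrow j}\rho](q_+,p_+;q_-,p_-)=W^{\frac\pi2}[\rho]\big(q_+,p_+;\widehat{q_-,p_-}^{\hbar}\big),$$ $$W^{\frac\pi2}[V_{i\leftrightarrow j}\rho](q_+,p_+;q_-,p_-)=W^{\frac\pi2}[\rho]\big(q_+,p_+;\widehat{-q_-,-p_-}^{\hbar}\big),$$ that is, the Wigner function of $U_{i\leftrightarrow j}\rho$ is obtained from that of $\rho$ by the semiclassical symplectic Fourier transform (with parameter $\hbar$) in the variables $(q_-,p_-)$, and the Wigner function of $V_{i\leftrightarrow j}\rho$ is the same transform evaluated at $(-q_-,-p_-)$.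
   Context: Fix $\hbar>0$ and integers $d\ge1$, $N\ge 2$. A density matrix is a positive trace-one operator $\rho$ on $L^2(\mathbf{R}^d)^{\otimes N}=L^2(\mathbf{R}^{dN})$, with integral kernel $\rho(X;Y)$, $X=(x_1,\dots,x_N)$, $Y=(y_1,\dots,y_N)$, $x_l,y_l\in\mathbf{R}^d$. $U_{i\leftrightarrow j}\rho$ is the operator whose kernel is $\rho(X;Y)$ with $y_i$ and $y_j$ exchanged, and $V_{i\leftrightarrow j}\rho$ is the operator whose kernel is $\rho(X;Y)$ with $x_i$ and $x_j$ exchanged. The Wigner function of $\rho$ (and likewise of $U_{i\leftrightarrow j}\rho$, $V_{i\leftrightarrow j}\rho$) is its Weyl symbol divided by $(2\pi\hbar)^{dN}$: $$W[\rho](X,\Xi)=\frac1{(2\pi)^{dN}}\int_{\mathbf{R}^{dN}}\rho\big(X+\hbar\tfrac\delta2;X-\hbar\tfrac\delta2\big)e^{-i\Xi\cdot\delta}\,d\delta ,\qquad (X,\Xi)\in\mathbf{R}^{2dN}.$$ Put $a_\pm=\frac{a_i\pm a_j}{\sqrt2}$ for position variables $a=x$ or $q$ and momentum variables $a=\xi$ or $p$. Omitting the dependence on the variables with indices different from $i,j$ (which are left unchanged throughout), define $$W^{\frac\pi2}[\rho](x_+,\xi_+;x_-,\xi_-)=W[\rho](x_i,x_j;\xi_i,\xi_j).$$ The semiclassical symplectic Fourier transform of a function $f$ on $\mathbf{R}^d\times\mathbf{R}^d$ is denoted $$f\big(\widehat{q,p}^{\hbar}\big)=\frac1{(2\pi\hbar)^d}\int_{\mathbf{R}^d\times\mathbf{R}^d}f(x,\xi)\,e^{i\frac{q\cdot\xi-p\cdot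 x}{\hbar}}\,dx\,d\xi .$$ In the claim it is applied to the last pair of variables $(x_-,\xi_-)$ of $W^{\frac\pi2}[\rho](x_+,\xi_+;x_-,\xi_-)$, with the others fixed.
   Formalization: The semiclassical symplectic Fourier transform is taken with parameter ħ/2 instead of ħ (with ħ the identities fail, e.g. for a Gaussian state); it is understood in the Fourier–Plancherel (L²) sense, with equality almost everywhere. *)

theory Defs
  imports "HOL-Analysis.Analysis"
begin

section \<open>Operators on L2 and their kernels\<close>

text \<open>Elements of L2 are represented by Borel functions; equality in L2 is equality
  almost everywhere.\<close>

definition square_integrable :: "('a::euclidean_space \<Rightarrow> complex) \<Rightarrow> bool" where
  "square_integrable f \<longleftrightarrow>
     f \<in> borel_measurable lborel \<and> integrable lborel (\<lambda>x. (cmod (f x))\<^sup>2)"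

definition L2_inner :: "('a::euclidean_space \<Rightarrow> complex) \<Rightarrow> ('a \<Rightarrow> complex) \<Rightarrow> complex" where
  "L2_inner f g = (LINT x|lborel. cnj (f x) * g x)"

type_synonym 'a L2_operator = "('a \<Rightarrow> complex) \<Rightarrow> ('a \<Rightarrow> complex)"

definition bounded_L2_operator :: "'a::euclidean_space L2_operator \<Rightarrow> bool" where
  "bounded_L2_operator T \<longleftrightarrow>
     (\<forall>f. square_integrable f \<longrightarrow> square_integrable (T f)) \<and>
     (\<forall>f g. square_integrable f \<longrightarrow> square_integrable g \<longrightarrow> (AE x in lborel. f x = g x) \<longrightarrow>
        (AE x in lborel. T f x = T g x)) \<and>
     (\<forall>f g a b. square_integrable f \<longrightarrow> square_integrable g \<longrightarrow>
        (AE x in lborel. T (\<lambda>y. a * f y + b * g y) x = a * T f x + b * T g x)) \<and>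
     (\<exists>C. \<forall>f. square_integrable f \<longrightarrow>
        (LINT x|lborel. (cmod (T f x))\<^sup>2) \<le> C * (LINT x|lborel. (cmod (f x))\<^sup>2))"

definition L2_positive :: "'a::euclidean_space L2_operator \<Rightarrow> bool" where
  "L2_positive T \<longleftrightarrow> (\<forall>f. square_integrable f \<longrightarrow> L2_inner f (T f) \<in> \<real>\<^sub>\<ge>\<^sub>0)"

definition L2_orthonormal_basis :: "(nat \<Rightarrow> 'a::euclidean_space \<Rightarrow> complex) \<Rightarrow> bool" where
  "L2_orthonormal_basis e \<longleftrightarrow>
     (\<forall>k. square_integrable (e k)) \<and>
     (\<forall>k l. L2_inner (e k) (e l) = (if k = l then 1 else 0)) \<and>
     (\<forall>f. square_integrable f \<longrightarrow> (\<forall>k. L2_inner (e k) f = 0) \<longrightarrow> (AE x in lborel. f x = 0))"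

text \<open>For a positive operator the sum of the diagonal matrix elements does not depend on the
  orthonormal basis, and its convergence is what being trace class means.\<close>

definition density_matrix :: "'a::euclidean_space L2_operator \<Rightarrow> bool" where
  "density_matrix \<rho> \<longleftrightarrow>
     bounded_L2_operator \<rho> \<and> L2_positive \<rho> \<and>
     (\<exists>e. L2_orthonormal_basis e \<and> (\<lambda>k. L2_inner (e k) (\<rho> (e k))) sums 1)"

text \<open>A trace class operator is Hilbert--Schmidt, so its kernel is a square integrable function
  of both variables, unique up to a null set.\<close>

definition integral_kernel ::
    "'a::euclidean_space L2_operator \<Rightarrow> ('a \<Rightarrow> 'a \<Rightarrow> complex) \<Rightarrow> bool" where
  "integral_kernel T K \<longleftrightarrow>
     square_integrable (\<lambda>(x, y). K x y) \<and>
     (\<forall>f. square_integrable f \<longrightarrow> (AE x in lborel. T f x = (LINT y|lborel. K x y * f y)))"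


section \<open>Wigner functions\<close>

text \<open>A point \<open>X\<close> of the configuration space has the particle positions \<open>X $ l\<close> as
  components; \<open>'n\<close> indexes the particles and \<open>'d\<close> the space directions.\<close>

type_synonym ('d, 'n) config = "((real, 'd) vec, 'n) vec"

definition set_pair ::
    "'n \<Rightarrow> 'n \<Rightarrow> real ^ 'd \<Rightarrow> real ^ 'd \<Rightarrow> ('d::finite, 'n::finite) config \<Rightarrow> ('d, 'n) config" where
  "set_pair i j a b X = (\<chi> l. if l = i then a else if l = j then b else X $ l)"

definition exchange :: "'n \<Rightarrow> 'n \<Rightarrow> ('d::finite, 'n::finite) config \<Rightarrow> ('d, 'n) config" where
  "exchange i j X = set_pair i j (X $ j) (X $ i) X"

type_synonym ('d, 'n) kernel = "('d, 'n) config \<Rightarrow> ('d, 'n) config \<Rightarrow> complex"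

definition U_exchange :: "'n \<Rightarrow> 'n \<Rightarrow> ('d::finite, 'n::finite) kernel \<Rightarrow> ('d, 'n) kernel" where
  "U_exchange i j K = (\<lambda>X Y. K X (exchange i j Y))"

definition V_exchange :: "'n \<Rightarrow> 'n \<Rightarrow> ('d::finite, 'n::finite) kernel \<Rightarrow> ('d, 'n) kernel" where
  "V_exchange i j K = (\<lambda>X Y. K (exchange i j X) Y)"

definition wigner ::
    "real \<Rightarrow> ('d::finite, 'n::finite) kernel \<Rightarrow> ('d, 'n) config \<Rightarrow> ('d, 'n) config \<Rightarrow> complex" where
  "wigner h K X \<Xi> = 1 / of_real ((2 * pi) ^ (CARD('d) * CARD('n))) *
     (LINT \<delta>|lborel. K (X + (h / 2) *\<^sub>R \<delta>) (X - (h / 2) *\<^sub>R \<delta>) * exp (- \<i> * of_real (\<Xi> \<bullet> \<delta>)))"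

definition plus_part :: "'n \<Rightarrow> 'n \<Rightarrow> ('d::finite, 'n::finite) config \<Rightarrow> real ^ 'd" where
  "plus_part i j A = (A $ i + A $ j) /\<^sub>R sqrt 2"

definition minus_part :: "'n \<Rightarrow> 'n \<Rightarrow> ('d::finite, 'n::finite) config \<Rightarrow> real ^ 'd" where
  "minus_part i j A = (A $ i - A $ j) /\<^sub>R sqrt 2"

text \<open>The configuration with prescribed plus and minus parts, the particles other than \<open>i\<close> and
  \<open>j\<close> being taken from \<open>A\<close>; the entries \<open>A $ i\<close> and \<open>A $ j\<close> are ignored.\<close>

definition from_parts ::
    "'n \<Rightarrow> 'n \<Rightarrow> real ^ 'd \<Rightarrow> real ^ 'd \<Rightarrow> ('d::finite, 'n::finite) config \<Rightarrow> ('d, 'n) config" where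
  "from_parts i j a b A = set_pair i j ((a + b) /\<^sub>R sqrt 2) ((a - b) /\<^sub>R sqrt 2) A"

definition wigner_rotated ::
    "real \<Rightarrow> 'n \<Rightarrow> 'n \<Rightarrow> ('d::finite, 'n::finite) kernel \<Rightarrow> ('d, 'n) config \<Rightarrow> ('d, 'n) config \<Rightarrow>
     real ^ 'd \<Rightarrow> real ^ 'd \<Rightarrow> real ^ 'd \<Rightarrow> real ^ 'd \<Rightarrow> complex" where
  "wigner_rotated h i j K X \<Xi> xp \<xi>p xm \<xi>m =
     wigner h K (from_parts i j xp xm X) (from_parts i j \<xi>p \<xi>m \<Xi>)"

lemma from_parts_plus_minus: "from_parts i j (plus_part i j A) (minus_part i j A) A = A"
proof -
  have half: "inverse (sqrt 2) * (inverse (sqrt 2) * t) = t / 2" for t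
    by (simp add: field_simps)
  have "(((u + v) /\<^sub>R sqrt 2 + (u - v) /\<^sub>R sqrt 2) /\<^sub>R sqrt 2) = u"
       "(((u + v) /\<^sub>R sqrt 2 - (u - v) /\<^sub>R sqrt 2) /\<^sub>R sqrt 2) = v" for u v :: "real ^ 'd"
    by (simp_all add: vec_eq_iff distrib_left[symmetric] right_diff_distrib[symmetric] half)
  from this[of "A $ i" "A $ j"] show ?thesis
    unfolding from_parts_def plus_part_def minus_part_def set_pair_def
    by (subst vec_eq_iff) simp
qed

lemma wigner_rotated_plus_minus:
  "wigner_rotated h i j K X \<Xi> (plus_part i j X) (plus_part i j \<Xi>) (minus_part i j X) (minus_part i j \<Xi>)
   = wigner h K X \<Xi>"
  by (simp add: wigner_rotated_def from_parts_plus_minus)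


section \<open>The semiclassical symplectic Fourier transform\<close>

text \<open>Beware of the value of the parameter \<open>h\<close> at which the transform describes an exchange.  With
  \<open>a\<^sub>\<plusminus> = (a\<^sub>i \<plusminus> a\<^sub>j) / sqrt 2\<close>, exchanging two particles is \<open>y\<^sub>- \<mapsto> -y\<^sub>-\<close>, and the Wigner
  function of \<open>k(x, -y)\<close> at \<open>(q, p)\<close> is
  \<open>(\<pi> \<hbar>)\<^sup>-\<^sup>d \<integral> W(x, \<xi>) exp (2 i (q \<bullet> \<xi> - p \<bullet> x) / \<hbar>) dx d\<xi>\<close>,
  which is the transform with parameter \<open>\<hbar> / 2\<close>, not \<open>\<hbar>\<close>.\<close>

definition symplectic_fourier_integral ::
    "real \<Rightarrow> ((real ^ 'd) \<times> (real ^ 'd) \<Rightarrow> complex) \<Rightarrow> (real ^ 'd::finite) \<times> (real ^ 'd) \<Rightarrow> complex" where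
  "symplectic_fourier_integral h f = (\<lambda>(q, p). 1 / of_real ((2 * pi * h) ^ CARD('d)) *
     (LINT (x, \<xi>)|lborel. f (x, \<xi>) * exp (\<i> * of_real ((q \<bullet> \<xi> - p \<bullet> x) / h))))"

text \<open>The Wigner function of a density matrix is square integrable but in general not integrable
  (already for the projection on an indicator function), so that its transform is the
  Fourier--Plancherel one: the limit in L2 of the integrals over balls of growing radius.\<close>

definition has_symplectic_fourier ::
    "real \<Rightarrow> ((real ^ 'd) \<times> (real ^ 'd) \<Rightarrow> complex) \<Rightarrow> ((real ^ 'd::finite) \<times> (real ^ 'd) \<Rightarrow> complex) \<Rightarrow> bool" where
  "has_symplectic_fourier h f F \<longleftrightarrow>
     square_integrable f \<and> square_integrable F \<and>
     ((\<lambda>R. \<integral>\<^sup>+z. ennreal ((cmod (symplectic_fourier_integral h (\<lambda>w. indicator (cball 0 R) w * f w) z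
              - F z))\<^sup>2) \<partial>lborel) \<longlongrightarrow> 0) at_top"

text \<open>On integrable functions this is the integral itself.\<close>

lemma has_symplectic_fourier_integrable:
  fixes f :: "(real ^ 'd::finite) \<times> (real ^ 'd) \<Rightarrow> complex"
  assumes F: "has_symplectic_fourier h f F" and f: "integrable lborel f"
  shows "AE z in lborel. F z = symplectic_fourier_integral h f z"
proof -
  define g where "g n = symplectic_fourier_integral h (\<lambda>w. indicator (cball 0 (real n)) w * f w)" for n
  define I where "I = symplectic_fourier_integral h f"
  have fm[measurable]: "f \<in> borel_measurable borel" "F \<in> borel_measurable borel"
    using F by (auto simp: has_symplectic_fourier_def square_integrable_def)
  have fi[measurable]: "(\<lambda>w. indicator (cball 0 (real n)) w * f w) \<in> borel_measurable borel" for n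
    by (intro borel_measurable_times borel_measurable_indicator fm) simp
  have meas: "symplectic_fourier_integral h k \<in> borel_measurable borel"
    if k: "k \<in> borel_measurable borel" for k :: "(real ^ 'd) \<times> (real ^ 'd) \<Rightarrow> complex"
  proof -
    note k[measurable]
    have c: "(\<lambda>u :: ((real ^ 'd) \<times> (real ^ 'd)) \<times> ((real ^ 'd) \<times> (real ^ 'd)).
        exp (\<i> * complex_of_real ((fst (fst u) \<bullet> snd (snd u) - snd (fst u) \<bullet> fst (snd u)) * inverse h)))
        \<in> borel_measurable borel"
      by (intro borel_measurable_continuous_onI continuous_intros)
    note c[measurable]
    have "(\<lambda>u :: ((real ^ 'd) \<times> (real ^ 'd)) \<times> ((real ^ 'd) \<times> (real ^ 'd)). k (snd u) *
        exp (\<i> * complex_of_real ((fst (fst u) \<bullet> snd (snd u) - snd (fst u) \<bullet> fst (snd u)) * inverse h)))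
        \<in> borel_measurable borel"
      by (intro borel_measurable_times c measurable_compose[OF _ k] borel_measurable_continuous_onI
          continuous_intros)
    then have "(\<lambda>(z :: (real ^ 'd) \<times> (real ^ 'd), w). k w *
        exp (\<i> * complex_of_real ((fst z \<bullet> snd w - snd z \<bullet> fst w) * inverse h)))
        \<in> borel_measurable (borel \<Otimes>\<^sub>M lborel)"
      by (simp add: split_beta borel_prod cong: measurable_cong_sets)
         (simp add: borel_prod[symmetric] cong: measurable_cong_sets)
    from lborel.borel_measurable_lebesgue_integral[OF this]
    show ?thesis
      unfolding symplectic_fourier_integral_def split_beta
      by (auto simp: divide_inverse intro!: borel_measurable_times)
  qed
  have [measurable]: "g n \<in> borel_measurable borel" "I \<in> borel_measurable borel" for n
    unfolding g_def I_def by (auto intro!: meas)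
  have lim: "(\<lambda>n. g n z) \<longlonglongrightarrow> I z" for z
  proof -
    obtain q p where z: "z = (q, p)" by (cases z)
    let ?e = "\<lambda>w. exp (\<i> * complex_of_real ((q \<bullet> snd w - p \<bullet> fst w) / h))"
    have ce: "?e \<in> borel_measurable borel"
      unfolding divide_inverse by (intro borel_measurable_continuous_onI continuous_intros)
    note ce[measurable]
    have "(\<lambda>n. LINT w|lborel. indicator (cball 0 (real n)) w * f w * ?e w)
        \<longlonglongrightarrow> (LINT w|lborel. f w * ?e w)"
    proof (rule integral_dominated_convergence[where w = "\<lambda>w. norm (f w)"])
      show "AE w in lborel. (\<lambda>n. indicator (cball 0 (real n)) w * f w * ?e w) \<longlonglongrightarrow> f w * ?e w"
      proof (intro AE_I2 tendsto_eventually)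
        fix w :: "(real ^ 'd) \<times> (real ^ 'd)"
        obtain m where "norm w \<le> real m" using real_arch_simple by blast
        then show "\<forall>\<^sub>F n in sequentially. indicator (cball 0 (real n)) w * f w * ?e w = f w * ?e w"
          by (intro eventually_sequentiallyI[of m]) (auto simp: indicator_def)
      qed
      show "AE w in lborel. norm (indicator (cball 0 (real n)) w * f w * ?e w) \<le> norm (f w)" for n
        by (auto simp: norm_mult indicator_def)
    next
      show "(\<lambda>w. f w * ?e w) \<in> borel_measurable lborel"
        using borel_measurable_times[OF fm(1) ce] by (simp only: measurable_lborel2)
      show "(\<lambda>w. indicator (cball 0 (real n)) w * f w * ?e w) \<in> borel_measurable lborel" for n
        using borel_measurable_times[OF fi[of n] ce] by (simp only: measurable_lborel2)
      show "integrable lborel (\<lambda>w. norm (f w))" using f by simp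
    qed
    from tendsto_mult_left[OF this, of "1 / of_real ((2 * pi * h) ^ CARD('d))"]
    show ?thesis
      unfolding g_def I_def symplectic_fourier_integral_def z split_beta by (simp only: prod.collapse prod.sel)
  qed
  have "(\<integral>\<^sup>+z. ennreal ((cmod (I z - F z))\<^sup>2) \<partial>lborel)
      = (\<integral>\<^sup>+z. liminf (\<lambda>n. ennreal ((cmod (g n z - F z))\<^sup>2)) \<partial>lborel)"
  proof (intro nn_integral_cong)
    fix z
    have "(\<lambda>n. ennreal ((cmod (g n z - F z))\<^sup>2)) \<longlonglongrightarrow> ennreal ((cmod (I z - F z))\<^sup>2)"
      by (intro tendsto_intros lim)
    from lim_imp_Liminf[OF sequentially_bot this]
    show "ennreal ((cmod (I z - F z))\<^sup>2) = liminf (\<lambda>n. ennreal ((cmod (g n z - F z))\<^sup>2))" by simp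
  qed
  also have "\<dots> \<le> liminf (\<lambda>n. \<integral>\<^sup>+z. ennreal ((cmod (g n z - F z))\<^sup>2) \<partial>lborel)"
    by (intro nn_integral_liminf) simp
  also have "\<dots> = 0"
  proof (rule lim_imp_Liminf)
    show "(\<lambda>n. \<integral>\<^sup>+z. ennreal ((cmod (g n z - F z))\<^sup>2) \<partial>lborel) \<longlonglongrightarrow> 0"
      unfolding g_def
      by (rule filterlim_compose[OF F[unfolded has_symplectic_fourier_def, THEN conjunct2, THEN conjunct2]
            filterlim_real_sequentially])
  qed simp
  finally have "AE z in lborel. ennreal ((cmod (I z - F z))\<^sup>2) = 0"
    by (subst (asm) le_zero_eq) (subst (asm) nn_integral_0_iff_AE, auto)
  then show ?thesis
    by (simp add: I_def) (auto elim!: eventually_mono)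
qed

end

theory Submission
  imports Defs "HOL-Probability.Characteristic_Functions"
begin

text \<open>In the minus variables the Wigner function is the Fourier transform in \<open>v\<close> of
  \<open>G(x, v) = k(x + h v / 2, x - h v / 2)\<close>, where \<open>k\<close> is the kernel with the other variables
  integrated out. Exchanging the particles on the right replaces \<open>k(a, b)\<close> by \<open>k(a, -b)\<close>, that is
  \<open>G(x, v)\<close> by \<open>G(h v / 2, 2 x / h)\<close>: up to scaling the two variables of \<open>G\<close> are swapped. So the
  symplectic transform, which undoes the Fourier transform in \<open>v\<close> and performs one in \<open>x\<close>, maps
  one Wigner function to the other. For the truncations to balls this holds up to an error whose
  norm is computed exactly from Plancherel's theorem on almost every line; it is the mass of the
  Wigner function outside the ball.

  The integrals exist because a density matrix is \<open>\<Sum>\<^sub>m |b\<^sub>m\<rangle>\<langle>b\<^sub>m|\<close> with \<open>\<Sum>\<^sub>m \<parallel>b\<^sub>m\<parallel>\<^sup>2 < \<infinity>\<close> (a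
  Cholesky factorization of its matrix in an orthonormal basis), so that its kernel is dominated by
  \<open>B(X) B(Y)\<close> with the square integrable function \<open>B = (\<Sum>\<^sub>m |b\<^sub>m|\<^sup>2)\<^bsup>1/2\<^esup>\<close>.\<close>

section \<open>Lebesgue integration and square integrable functions\<close>

text \<open>The obstacle is pointwise: a square integrable kernel is determined only up to a null
  set and need not be integrable on the lines
  \<open>(X + h \<delta> / 2, X - h \<delta> / 2)\<close>, so a Wigner integral at a given point may
  have no meaning. The bound \<open>B X * B Y\<close> cures this: a version of the kernel obeying it
  everywhere is integrable on every line, and \<open>G\<close> in each of its two variables, so both
  Fourier transforms are honest integrals. Null sets are paid for only at the end, by the quantifier
  over almost all \<open>(X, qp)\<close>; momenta enter through phases alone and remain arbitrary.
  The Cholesky factor takes the place of an operator square root because it is triangular: each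
  \<open>\<rho> (e l)\<close> becomes a finite combination of the \<open>b m\<close>, and no
  operator series has to be summed. The parameter \<open>h / 2\<close> is forced by the swap: its
  scalings \<open>h / 2\<close> and \<open>2 / h\<close> turn the inverse transform in
  \<open>v\<close> and the transform in \<open>x\<close> into the single phase
  \<open>2 (q \<bullet> \<xi> - p \<bullet> x) / h\<close>.\<close>

lemma borel_measurable_comp_continuous:
  assumes "f \<in> borel_measurable borel" "continuous_on UNIV g"
  shows "(\<lambda>x. f (g x)) \<in> borel_measurable borel"
  using measurable_compose[OF borel_measurable_continuous_onI[OF assms(2)] assms(1)] .

lemma borel_measurable_integral_snd:
  fixes f :: "'a::euclidean_space \<times> 'b::euclidean_space \<Rightarrow> complex"
  assumes "f \<in> borel_measurable borel"
  shows "(\<lambda>x. LINT y|lborel. f (x, y)) \<in> borel_measurable borel"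
proof (rule lborel.borel_measurable_lebesgue_integral)
  show "(\<lambda>(x, y). f (x, y)) \<in> borel_measurable (borel \<Otimes>\<^sub>M lborel)"
    using assms by (simp add: borel_prod cong: measurable_cong_sets)
      (simp add: borel_prod[symmetric] cong: measurable_cong_sets)
qed

lemma borel_measurable_nn_integral_snd:
  fixes f :: "'a::euclidean_space \<times> 'b::euclidean_space \<Rightarrow> ennreal"
  assumes "f \<in> borel_measurable borel"
  shows "(\<lambda>x. \<integral>\<^sup>+y. f (x, y) \<partial>lborel) \<in> borel_measurable borel"
proof (rule lborel.borel_measurable_nn_integral)
  show "(\<lambda>(x, y). f (x, y)) \<in> borel_measurable (borel \<Otimes>\<^sub>M lborel)"
    using assms by (simp add: borel_prod cong: measurable_cong_sets)
      (simp add: borel_prod[symmetric] cong: measurable_cong_sets)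
qed

lemma nn_integral_lborel_pair:
  fixes f :: "'a::euclidean_space \<times> 'b::euclidean_space \<Rightarrow> ennreal"
  assumes "f \<in> borel_measurable borel"
  shows "(\<integral>\<^sup>+z. f z \<partial>lborel) = (\<integral>\<^sup>+x. \<integral>\<^sup>+y. f (x, y) \<partial>lborel \<partial>lborel)"
    and "(\<integral>\<^sup>+z. f z \<partial>lborel) = (\<integral>\<^sup>+y. \<integral>\<^sup>+x. f (x, y) \<partial>lborel \<partial>lborel)"
proof -
  have m: "f \<in> borel_measurable (lborel \<Otimes>\<^sub>M lborel)"
    using assms by (simp add: lborel_prod)
  show "(\<integral>\<^sup>+z. f z \<partial>lborel) = (\<integral>\<^sup>+x. \<integral>\<^sup>+y. f (x, y) \<partial>lborel \<partial>lborel)"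
    by (simp add: lborel.nn_integral_fst[OF m] lborel_prod)
  show "(\<integral>\<^sup>+z. f z \<partial>lborel) = (\<integral>\<^sup>+y. \<integral>\<^sup>+x. f (x, y) \<partial>lborel \<partial>lborel)"
    using lborel_pair.nn_integral_snd[OF m] by (simp add: lborel_prod)
qed

text \<open>Stated with \<open>t + c *\<^sub>R x\<close> for any nonzero \<open>c\<close>, so that
  scalings, translations and reflections are all instances.\<close>

lemma
  fixes t :: "'a::euclidean_space" and g :: "'a \<Rightarrow> 'b::{banach, second_countable_topology}"
  assumes c: "c \<noteq> (0::real)"
  shows nn_integral_lborel_affine: "f \<in> borel_measurable borel \<Longrightarrow>
      (\<integral>\<^sup>+x. f x \<partial>lborel) = ennreal (\<bar>c\<bar> ^ DIM('a)) * (\<integral>\<^sup>+x. f (t + c *\<^sub>R x) \<partial>lborel)"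
    and integrable_lborel_affine:
      "integrable lborel g \<Longrightarrow> integrable lborel (\<lambda>x. g (t + c *\<^sub>R x))"
    and integral_lborel_affine: "g \<in> borel_measurable borel \<Longrightarrow>
      (LINT x|lborel. g x) = (\<bar>c\<bar> ^ DIM('a)) *\<^sub>R (LINT x|lborel. g (t + c *\<^sub>R x))"
proof -
  have m[measurable]: "(\<lambda>x. t + c *\<^sub>R x) \<in> borel_measurable borel"
    by (intro borel_measurable_continuous_onI continuous_intros)
  show A: "(\<integral>\<^sup>+x. f x \<partial>lborel) = ennreal (\<bar>c\<bar> ^ DIM('a)) * (\<integral>\<^sup>+x. f (t + c *\<^sub>R x) \<partial>lborel)"
    if [measurable]: "f \<in> borel_measurable borel" for f
  proof -
    have "(\<integral>\<^sup>+x. f x \<partial>lborel)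
        = (\<integral>\<^sup>+x. f x \<partial>density (distr lborel borel (\<lambda>x. t + c *\<^sub>R x)) (\<lambda>_. ennreal (\<bar>c\<bar> ^ DIM('a))))"
      by (subst lborel_affine[OF c, of t]) (simp only: ennreal_power abs_ge_zero)
    also have "\<dots> = (\<integral>\<^sup>+x. ennreal (\<bar>c\<bar> ^ DIM('a)) * f x \<partial>distr lborel borel (\<lambda>x. t + c *\<^sub>R x))"
      by (rule nn_integral_density) auto
    also have "\<dots> = (\<integral>\<^sup>+x. ennreal (\<bar>c\<bar> ^ DIM('a)) * f (t + c *\<^sub>R x) \<partial>lborel)"
      by (rule nn_integral_distr) auto
    also have "\<dots> = ennreal (\<bar>c\<bar> ^ DIM('a)) * (\<integral>\<^sup>+x. f (t + c *\<^sub>R x) \<partial>lborel)"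
      by (rule nn_integral_cmult) simp
    finally show ?thesis .
  qed
  show "integrable lborel (\<lambda>x. g (t + c *\<^sub>R x))" if "integrable lborel g"
  proof -
    have [measurable]: "g \<in> borel_measurable borel"
      using borel_measurable_integrable[OF that] by simp
    have "(\<integral>\<^sup>+x. norm (g x) \<partial>lborel) < \<infinity>"
      using that by (simp add: integrable_iff_bounded)
    then have "ennreal (\<bar>c\<bar> ^ DIM('a)) * (\<integral>\<^sup>+x. norm (g (t + c *\<^sub>R x)) \<partial>lborel) < \<infinity>"
      using A[of "\<lambda>x. ennreal (norm (g x))"] by simp
    moreover have "0 < ennreal (\<bar>c\<bar> ^ DIM('a))"
      using c by (simp only: ennreal_less_zero_iff) simp
    ultimately have "(\<integral>\<^sup>+x. norm (g (t + c *\<^sub>R x)) \<partial>lborel) < \<infinity>"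
      unfolding ennreal_mult_less_top infinity_ennreal_def by force
    moreover have "(\<lambda>x. g (t + c *\<^sub>R x)) \<in> borel_measurable borel"
      by measurable
    ultimately show ?thesis by (simp add: integrable_iff_bounded)
  qed
  show "(LINT x|lborel. g x) = (\<bar>c\<bar> ^ DIM('a)) *\<^sub>R (LINT x|lborel. g (t + c *\<^sub>R x))"
    if [measurable]: "g \<in> borel_measurable borel"
  proof -
    have "(LINT x|lborel. g x)
        = (LINT x|density (distr lborel borel (\<lambda>x. t + c *\<^sub>R x)) (\<lambda>_. ennreal (\<bar>c\<bar> ^ DIM('a))). g x)"
      by (subst lborel_affine[OF c, of t]) (simp only: ennreal_power abs_ge_zero)
    also have "\<dots> = (LINT x|distr lborel borel (\<lambda>x. t + c *\<^sub>R x). (\<bar>c\<bar> ^ DIM('a)) *\<^sub>R g x)"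
      by (rule integral_density) auto
    also have "\<dots> = (LINT x|lborel. (\<bar>c\<bar> ^ DIM('a)) *\<^sub>R g (t + c *\<^sub>R x))"
      by (rule integral_distr) auto
    finally show ?thesis
      by (simp only: integral_scaleR_right)
  qed
qed

lemma nn_integral_lborel_translate:
  fixes c :: "'a::euclidean_space"
  assumes "f \<in> borel_measurable borel"
  shows "(\<integral>\<^sup>+x. f (c + x) \<partial>lborel) = (\<integral>\<^sup>+x. f x \<partial>lborel)"
  using nn_integral_lborel_affine[of 1 f c] assms by simp

lemma
  fixes f :: "'a::euclidean_space \<times> 'b::euclidean_space \<Rightarrow> 'c::{banach, second_countable_topology}"
  assumes f: "integrable lborel f"
  shows integral_lborel_pair: "(LINT p|lborel. f p) = (LINT x|lborel. LINT y|lborel. f (x, y))"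
    and integral_lborel_pair': "(LINT p|lborel. f p) = (LINT y|lborel. LINT x|lborel. f (x, y))"
    and AE_integrable_lborel_fst: "AE x in lborel. integrable lborel (\<lambda>y. f (x, y))"
proof -
  have I: "integrable (lborel \<Otimes>\<^sub>M lborel) f"
    using f by (simp add: lborel_prod)
  then have J: "integrable (lborel \<Otimes>\<^sub>M lborel) (\<lambda>(x, y). f (x, y))" by simp
  show "(LINT p|lborel. f p) = (LINT x|lborel. LINT y|lborel. f (x, y))"
    using lborel_pair.integral_fst'[OF I] by (simp add: lborel_prod)
  show "(LINT p|lborel. f p) = (LINT y|lborel. LINT x|lborel. f (x, y))"
    using lborel_pair.integral_snd[OF J] by (simp add: lborel_prod)
  show "AE x in lborel. integrable lborel (\<lambda>y. f (x, y))"
    using lborel_pair.AE_integrable_fst'[OF I] .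
qed

lemma
  fixes f :: "'a::euclidean_space \<Rightarrow> complex" and g :: "'b::euclidean_space \<Rightarrow> complex"
  assumes f: "integrable lborel f" and g: "integrable lborel g"
  shows integrable_lborel_times: "integrable lborel (\<lambda>p. f (fst p) * g (snd p))"
    and integral_lborel_times:
      "(LINT p|lborel. f (fst p) * g (snd p)) = (LINT x|lborel. f x) * (LINT y|lborel. g y)"
proof -
  have m: "f \<in> borel_measurable borel" "g \<in> borel_measurable borel"
    using borel_measurable_integrable[OF f] borel_measurable_integrable[OF g] by simp_all
  have M: "(\<lambda>p. f (fst p) * g (snd p)) \<in> borel_measurable borel"
    by (intro borel_measurable_times borel_measurable_comp_continuous[OF m(1)]
        borel_measurable_comp_continuous[OF m(2)] continuous_intros)
  have "(\<integral>\<^sup>+p. ennreal (norm (f (fst p) * g (snd p))) \<partial>lborel)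
      = (\<integral>\<^sup>+x. \<integral>\<^sup>+y. ennreal (norm (f x)) * ennreal (norm (g y)) \<partial>lborel \<partial>lborel)"
    using nn_integral_lborel_pair(1)[OF measurable_compose[OF measurable_compose[OF M borel_measurable_norm] measurable_ennreal]]
    by (simp add: norm_mult ennreal_mult)
  also have "\<dots> = (\<integral>\<^sup>+x. ennreal (norm (f x)) \<partial>lborel) * (\<integral>\<^sup>+y. ennreal (norm (g y)) \<partial>lborel)"
    using m by (simp add: nn_integral_cmult nn_integral_multc)
  also have "\<dots> < \<infinity>"
    using f g by (simp add: integrable_iff_bounded ennreal_mult_less_top)
  finally show I: "integrable lborel (\<lambda>p. f (fst p) * g (snd p))"
    using M by (simp add: integrable_iff_bounded)
  show "(LINT p|lborel. f (fst p) * g (snd p)) = (LINT x|lborel. f x) * (LINT y|lborel. g y)"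
    by (subst integral_lborel_pair[OF I]) simp
qed

lemma product_le_mean_squares: "(a::real) * b \<le> (a\<^sup>2 + b\<^sup>2) / 2"
  using sum_squares_bound[of a b] by simp

lemma square_integrable_iff_nn_integral:
  "square_integrable f \<longleftrightarrow> f \<in> borel_measurable borel \<and> (\<integral>\<^sup>+x. ennreal ((cmod (f x))\<^sup>2) \<partial>lborel) < \<infinity>"
  unfolding square_integrable_def by (auto simp: integrable_iff_bounded)

lemma nn_integral_square_integrable:
  assumes "square_integrable f"
  shows "(\<integral>\<^sup>+x. ennreal ((cmod (f x))\<^sup>2) \<partial>lborel) = ennreal (LINT x|lborel. (cmod (f x))\<^sup>2)"
  using assms by (intro nn_integral_eq_integral) (auto simp: square_integrable_def)

lemma cmod_add_squared_le: "(cmod (a + b))\<^sup>2 \<le> 2 * (cmod a)\<^sup>2 + 2 * (cmod b)\<^sup>2"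
proof -
  have "(cmod (a + b))\<^sup>2 \<le> (cmod a + cmod b)\<^sup>2"
    by (intro power_mono norm_triangle_ineq) auto
  also have "\<dots> \<le> 2 * (cmod a)\<^sup>2 + 2 * (cmod b)\<^sup>2"
    using sum_squares_bound[of "cmod a" "cmod b"] by (simp add: power2_sum)
  finally show ?thesis .
qed

lemma square_integrable_add:
  assumes "square_integrable f" "square_integrable g"
  shows "square_integrable (\<lambda>x. f x + g x)"
  unfolding square_integrable_def
proof
  have [measurable]: "f \<in> borel_measurable borel" "g \<in> borel_measurable borel"
    using assms by (auto simp: square_integrable_def)
  show "(\<lambda>x. f x + g x) \<in> borel_measurable lborel" by simp
  have "integrable lborel (\<lambda>x. 2 * (cmod (f x))\<^sup>2 + 2 * (cmod (g x))\<^sup>2)"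
    using assms by (auto simp: square_integrable_def)
  then show "integrable lborel (\<lambda>x. (cmod (f x + g x))\<^sup>2)"
    by (rule Bochner_Integration.integrable_bound) (auto simp: cmod_add_squared_le)
qed

lemma square_integrable_cmult:
  "square_integrable f \<Longrightarrow> square_integrable (\<lambda>x. a * f x)"
  by (auto simp: square_integrable_def norm_mult power_mult_distrib)

lemma square_integrable_cnj:
  assumes "square_integrable f"
  shows "square_integrable (\<lambda>x. cnj (f x))"
proof -
  have "cnj \<in> borel_measurable borel"
    by (intro borel_measurable_continuous_onI continuous_intros)
  moreover have "f \<in> borel_measurable borel"
    using assms by (simp add: square_integrable_def)
  ultimately have "(\<lambda>x. cnj (f x)) \<in> borel_measurable borel"
    by (rule measurable_compose[rotated])
  then show ?thesis
    using assms by (simp add: square_integrable_def)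
qed

lemma square_integrable_zero: "square_integrable (\<lambda>x. 0)"
  by (simp add: square_integrable_def)

lemma square_integrable_diff:
  assumes "square_integrable f" "square_integrable g"
  shows "square_integrable (\<lambda>x. f x - g x)"
  using square_integrable_add[OF assms(1) square_integrable_cmult[OF assms(2), of "-1"]] by simp

lemma square_integrable_sum:
  "(\<And>k. k \<in> A \<Longrightarrow> square_integrable (f k)) \<Longrightarrow> square_integrable (\<lambda>x. \<Sum>k\<in>A. f k x)"
proof (induction A rule: infinite_finite_induct)
  case (insert k A)
  then have "square_integrable (\<lambda>x. f k x + (\<Sum>k\<in>A. f k x))"
    by (intro square_integrable_add) auto
  then show ?case using insert by simp
qed (simp_all add: square_integrable_zero)

lemma integrable_mult_square_integrable:
  assumes "square_integrable f" "square_integrable g"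
  shows "integrable lborel (\<lambda>x. f x * g x)"
proof -
  have [measurable]: "f \<in> borel_measurable borel" "g \<in> borel_measurable borel"
    using assms by (auto simp: square_integrable_def)
  have "integrable lborel (\<lambda>x. ((cmod (f x))\<^sup>2 + (cmod (g x))\<^sup>2) / 2)"
    using assms by (auto simp: square_integrable_def)
  then show ?thesis
  proof (rule Bochner_Integration.integrable_bound)
    show "AE x in lborel. norm (f x * g x) \<le> norm (((cmod (f x))\<^sup>2 + (cmod (g x))\<^sup>2) / 2)"
    proof (rule AE_I2)
      fix x
      show "norm (f x * g x) \<le> norm (((cmod (f x))\<^sup>2 + (cmod (g x))\<^sup>2) / 2)"
        using product_le_mean_squares[of "cmod (f x)" "cmod (g x)"]
        unfolding norm_mult real_norm_def by linarith
    qed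
  qed simp
qed

lemma integrable_cnj_mult_square_integrable:
  assumes "square_integrable f" "square_integrable g"
  shows "integrable lborel (\<lambda>x. cnj (f x) * g x)"
  using integrable_mult_square_integrable[OF square_integrable_cnj] assms by blast

section \<open>The Plancherel theorem\<close>

text \<open>Unnormalized, with the sign of the Wigner phase: Plancherel's identity then carries the
  factor \<open>(2 * pi) ^ DIM('a)\<close>. For a non-integrable function the value is the default
  0, so Plancherel's theorem asks for integrability as well as square integrability.\<close>

definition fourier :: "('a::euclidean_space \<Rightarrow> complex) \<Rightarrow> 'a \<Rightarrow> complex" where
  "fourier g \<xi> = (LINT x|lborel. g x * exp (- \<i> * of_real (\<xi> \<bullet> x)))"

lemma norm_exp_ii_times[simp]: "norm (exp (- \<i> * complex_of_real t)) = 1" "norm (exp (\<i> * complex_of_real t)) = 1"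
  using norm_exp_i_times[of "- t"] by simp_all

lemma borel_measurable_exp_inner[measurable]:
  "(\<lambda>x. exp (- \<i> * complex_of_real (\<xi> \<bullet> x))) \<in> borel_measurable borel"
  "(\<lambda>x. exp (\<i> * complex_of_real (\<xi> \<bullet> x))) \<in> borel_measurable borel"
  by (intro borel_measurable_continuous_onI continuous_intros)+

lemma integrable_mult_exp_inner:
  fixes g :: "'a::euclidean_space \<Rightarrow> complex"
  assumes "integrable lborel g"
  shows "integrable lborel (\<lambda>x. g x * exp (- \<i> * complex_of_real (\<xi> \<bullet> x)))"
    and "integrable lborel (\<lambda>x. g x * exp (\<i> * complex_of_real (\<xi> \<bullet> x)))"
proof -
  have [measurable]: "g \<in> borel_measurable borel"
    using borel_measurable_integrable[OF assms] by simp
  show "integrable lborel (\<lambda>x. g x * exp (- \<i> * complex_of_real (\<xi> \<bullet> x)))"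
    by (rule Bochner_Integration.integrable_bound[OF assms]) (auto simp: norm_mult)
  show "integrable lborel (\<lambda>x. g x * exp (\<i> * complex_of_real (\<xi> \<bullet> x)))"
    by (rule Bochner_Integration.integrable_bound[OF assms]) (auto simp: norm_mult)
qed

lemma borel_measurable_fourier_kernel:
  fixes g :: "'a::euclidean_space \<Rightarrow> complex"
  assumes "g \<in> borel_measurable borel"
  shows "(\<lambda>z::'a \<times> 'a. g (snd z) * exp (- \<i> * complex_of_real (fst z \<bullet> snd z))) \<in> borel_measurable borel"
proof (rule borel_measurable_times)
  show "(\<lambda>z::'a \<times> 'a. g (snd z)) \<in> borel_measurable borel"
    by (rule borel_measurable_comp_continuous[OF assms]) (intro continuous_intros)
  show "(\<lambda>z::'a \<times> 'a. exp (- \<i> * complex_of_real (fst z \<bullet> snd z))) \<in> borel_measurable borel"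
    by (intro borel_measurable_continuous_onI continuous_intros)
qed

lemma borel_measurable_fourier[measurable]:
  assumes "g \<in> borel_measurable borel"
  shows "fourier g \<in> borel_measurable borel"
  using borel_measurable_integral_snd[OF borel_measurable_fourier_kernel[OF assms]]
  unfolding fourier_def[abs_def] by simp

lemma cnj_fourier:
  "cnj (fourier g \<xi>) = (LINT x|lborel. cnj (g x) * exp (\<i> * of_real (\<xi> \<bullet> x)))"
  unfolding fourier_def by (subst Bochner_Integration.integral_cnj[symmetric]) (simp add: exp_cnj)

section \<open>Gaussians and their Fourier transforms\<close>

lemma gaussian_fourier_real:
  "(LINT t|lborel. complex_of_real (exp (- (t\<^sup>2) / 2)) * exp (- \<i> * of_real (s * t)))
    = of_real (sqrt (2 * pi) * exp (- (s\<^sup>2) / 2))"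
  (is "?I = _")
proof -
  \<comment> \<open>The characteristic function of the standard normal law at \<open>- s\<close> is
    the wanted transform, up to the constant of the normal density.\<close>
  have "complex_of_real (exp (- ((-s)\<^sup>2) / 2)) = char std_normal_distribution (- s)"
    by (simp add: char_std_normal_distribution)
  also have "\<dots> = (LINT t|lborel. of_real (1 / sqrt (2 * pi)) * (of_real (exp (- (t\<^sup>2) / 2)) * exp (- \<i> * of_real (s * t))))"
    unfolding char_def
    by (subst integral_density)
       (auto intro!: Bochner_Integration.integral_cong simp: std_normal_density_def scaleR_conv_of_real)
  also have "\<dots> = of_real (1 / sqrt (2 * pi)) * ?I" by (rule integral_mult_right_zero)
  finally have "complex_of_real (exp (- (s\<^sup>2) / 2)) = of_real (1 / sqrt (2 * pi)) * ?I" by simp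
  then have "of_real (sqrt (2 * pi)) * complex_of_real (exp (- (s\<^sup>2) / 2))
      = of_real (sqrt (2 * pi)) * of_real (1 / sqrt (2 * pi)) * ?I" by (simp add: mult.assoc)
  also have "of_real (sqrt (2 * pi)) * complex_of_real (1 / sqrt (2 * pi)) = 1"
    by (subst of_real_mult[symmetric]) simp
  finally show ?thesis by simp
qed

lemma gaussian_integrable_real: "integrable lborel (\<lambda>t::real. exp (- (t\<^sup>2) / 2))"
proof -
  have "integrable lborel (\<lambda>t. sqrt (2 * pi) * std_normal_density t)"
    by (intro integrable_mult_right integrable_normal_density) simp
  then show ?thesis by (simp add: std_normal_density_def)
qed

lemma exp_gaussian_eq_prod:
  fixes x :: "'a::euclidean_space"
  shows "exp (- (norm x)\<^sup>2 / 2) = (\<Prod>b\<in>Basis. exp (- ((x \<bullet> b)\<^sup>2) / 2))"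
  unfolding power2_norm_eq_inner euclidean_inner[of x x]
  by (simp add: exp_sum[symmetric] sum_negf sum_divide_distrib[symmetric] power2_eq_square)

text \<open>\<open>lborel\<close> is the image of a product of one-dimensional Lebesgue measures
  under the map that assembles a vector from its coordinates, so both claims are Fubini for finite
  products. This reduces the Gaussian in \<open>DIM('a)\<close> variables to the real line.\<close>

lemma integral_lborel_prod:
  fixes f :: "'a::euclidean_space \<Rightarrow> real \<Rightarrow> complex"
  assumes f: "\<And>b. b \<in> Basis \<Longrightarrow> integrable lborel (f b)"
  shows "(LINT x|lborel. (\<Prod>b\<in>Basis. f b (x \<bullet> b))) = (\<Prod>b\<in>Basis. LINT t|lborel. f b t)"
    and "integrable lborel (\<lambda>x. \<Prod>b\<in>Basis. f b (x \<bullet> b))"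
proof -
  interpret product_sigma_finite "\<lambda>_::'a. lborel :: real measure" ..
  have m: "f b \<in> borel_measurable borel" if "b \<in> Basis" for b
    using borel_measurable_integrable[OF f[OF that]] by simp
  have M: "(\<lambda>x. \<Prod>b\<in>Basis. f b (x \<bullet> b)) \<in> borel_measurable borel"
    by (rule borel_measurable_prod, rule borel_measurable_comp_continuous[OF m]) (auto intro: continuous_intros)
  have T: "(\<lambda>f. \<Sum>b\<in>Basis. f b *\<^sub>R b) \<in> measurable (\<Pi>\<^sub>M b\<in>(Basis::'a set). lborel) borel"
    by simp
  have "(LINT x|lborel. (\<Prod>b\<in>Basis. f b (x \<bullet> b)))
      = (LINT y|(\<Pi>\<^sub>M b\<in>(Basis::'a set). lborel). (\<Prod>b\<in>Basis. f b ((\<Sum>b\<in>Basis. y b *\<^sub>R b) \<bullet> b)))"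
    by (subst lborel_eq, rule integral_distr[OF T M])
  also have "\<dots> = (LINT y|(\<Pi>\<^sub>M b\<in>(Basis::'a set). lborel). (\<Prod>b\<in>Basis. f b (y b)))"
    by (intro Bochner_Integration.integral_cong prod.cong) auto
  also have "\<dots> = (\<Prod>b\<in>Basis. LINT t|lborel. f b t)"
    by (rule product_integral_prod[OF _ f]) simp
  finally show "(LINT x|lborel. (\<Prod>b\<in>Basis. f b (x \<bullet> b))) = (\<Prod>b\<in>Basis. LINT t|lborel. f b t)" .
  have "(\<integral>\<^sup>+x. ennreal (norm (\<Prod>b\<in>Basis. f b (x \<bullet> b))) \<partial>lborel)
      = (\<integral>\<^sup>+x. (\<Prod>b\<in>Basis. ennreal (norm (f b (x \<bullet> b)))) \<partial>lborel)"
    by (simp add: prod_norm[symmetric] prod_ennreal)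
  also have "\<dots> = (\<Prod>b\<in>Basis. \<integral>\<^sup>+t. ennreal (norm (f b t)) \<partial>lborel)"
    by (rule nn_integral_lborel_prod) (use m in auto)
  also have "\<dots> < \<infinity>"
  proof -
    have "(\<Prod>b\<in>A. \<integral>\<^sup>+t. ennreal (norm (f b t)) \<partial>lborel) < \<infinity>" if "A \<subseteq> Basis" "finite A" for A
      using that(2,1)
    proof (induction A rule: finite_induct)
      case (insert b A)
      then have "(\<integral>\<^sup>+t. ennreal (norm (f b t)) \<partial>lborel) < \<infinity>"
        using f[of b] by (simp add: integrable_iff_bounded)
      with insert show ?case by (simp add: ennreal_mult_less_top)
    qed simp
    then show ?thesis by simp
  qed
  finally show "integrable lborel (\<lambda>x. \<Prod>b\<in>Basis. f b (x \<bullet> b))"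
    using M by (simp add: integrable_iff_bounded)
qed

lemma integrable_gaussian:
  "integrable lborel (\<lambda>x::'a::euclidean_space. complex_of_real (exp (- (norm x)\<^sup>2 / 2)))"
  unfolding exp_gaussian_eq_prod of_real_prod
  by (rule integral_lborel_prod(2)) (use gaussian_integrable_real in \<open>simp add: integrable_of_real\<close>)

lemma fourier_gaussian:
  fixes \<xi> :: "'a::euclidean_space"
  shows "fourier (\<lambda>x. of_real (exp (- (norm x)\<^sup>2 / 2))) \<xi>
    = of_real (sqrt (2 * pi) ^ DIM('a) * exp (- (norm \<xi>)\<^sup>2 / 2))"
proof -
  have "of_real (exp (- (norm x)\<^sup>2 / 2)) * exp (- \<i> * of_real (\<xi> \<bullet> x))
     = (\<Prod>b\<in>Basis. complex_of_real (exp (- ((x \<bullet> b)\<^sup>2) / 2)) * exp (- \<i> * of_real ((\<xi> \<bullet> b) * (x \<bullet> b))))" for x :: 'a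
    unfolding exp_gaussian_eq_prod of_real_prod euclidean_inner[of \<xi> x] of_real_sum sum_distrib_left
    by (subst exp_sum) (simp_all add: prod.distrib)
  then have "fourier (\<lambda>x. of_real (exp (- (norm x)\<^sup>2 / 2))) \<xi>
    = (LINT x|lborel. (\<Prod>b\<in>Basis. complex_of_real (exp (- ((x \<bullet> b)\<^sup>2) / 2)) * exp (- \<i> * of_real ((\<xi> \<bullet> b) * (x \<bullet> b)))))"
    by (simp add: fourier_def)
  also have "\<dots> = (\<Prod>b\<in>Basis. of_real (sqrt (2 * pi) * exp (- ((\<xi> \<bullet> b)\<^sup>2) / 2)))"
    unfolding gaussian_fourier_real[symmetric]
    by (rule integral_lborel_prod(1)[where f = "\<lambda>b t. complex_of_real (exp (- (t\<^sup>2) / 2)) * exp (- \<i> * of_real ((\<xi> \<bullet> b) * t))"])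
       (use integrable_mult_exp_inner(1)[where g = "\<lambda>t. complex_of_real (exp (- (t\<^sup>2) / 2))"] gaussian_integrable_real
         in \<open>simp add: integrable_of_real\<close>)
  also have "\<dots> = of_real (sqrt (2 * pi) ^ DIM('a) * exp (- (norm \<xi>)\<^sup>2 / 2))"
    unfolding exp_gaussian_eq_prod of_real_prod[symmetric] by (simp add: prod.distrib)
  finally show ?thesis .
qed

section \<open>Continuity of translations in L1 and of the autocorrelation at 0\<close>

lemma L1_translation_approx:
  fixes f g :: "'a::euclidean_space \<Rightarrow> complex"
  assumes f: "integrable lborel f" and g: "integrable lborel g"
  shows "(LINT x|lborel. cmod (f (t + x) - f x))
    \<le> (LINT x|lborel. cmod (g (t + x) - g x)) + 2 * (LINT x|lborel. cmod (f x - g x))"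
proof -
  have tr: "integrable lborel (\<lambda>x. f (t + x))" "integrable lborel (\<lambda>x. g (t + x))"
    using integrable_lborel_affine[of 1 f t] integrable_lborel_affine[of 1 g t] f g by simp_all
  have fg: "integrable lborel (\<lambda>x. cmod (f x - g x))"
    using f g by simp
  have eq: "(LINT x|lborel. cmod (f (t + x) - g (t + x))) = (LINT x|lborel. cmod (f x - g x))"
    using integral_lborel_affine[of 1 "\<lambda>x. cmod (f x - g x)" t] borel_measurable_integrable[OF fg] by simp
  have "(LINT x|lborel. cmod (f (t + x) - f x))
      \<le> (LINT x|lborel. cmod (g (t + x) - g x) + (cmod (f (t + x) - g (t + x)) + cmod (f x - g x)))"
  proof (rule integral_mono)
    fix x
    have "f (t + x) - f x = (g (t + x) - g x) + ((f (t + x) - g (t + x)) - (f x - g x))" by simp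
    also have "cmod \<dots> \<le> cmod (g (t + x) - g x) + cmod ((f (t + x) - g (t + x)) - (f x - g x))"
      by (rule norm_triangle_ineq)
    also have "cmod ((f (t + x) - g (t + x)) - (f x - g x)) \<le> cmod (f (t + x) - g (t + x)) + cmod (f x - g x)"
      by (rule norm_triangle_ineq4)
    finally show "cmod (f (t + x) - f x) \<le>
        cmod (g (t + x) - g x) + (cmod (f (t + x) - g (t + x)) + cmod (f x - g x))" by simp
  qed (use f g tr in auto)
  also have "\<dots> = (LINT x|lborel. cmod (g (t + x) - g x)) + 2 * (LINT x|lborel. cmod (f x - g x))"
    using f g tr eq by simp
  finally show ?thesis .
qed

text \<open>Continuity of translation survives L1 limits: replacing \<open>g\<close> by
  \<open>f\<close> costs their L1 distance twice, once for the translates and once for the functions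
  themselves.\<close>

lemma L1_translation_limit:
  fixes g :: "'a::euclidean_space \<Rightarrow> complex"
  assumes g: "integrable lborel g"
    and approx: "\<And>\<epsilon>. \<epsilon> > 0 \<Longrightarrow> \<exists>f. integrable lborel f \<and> (LINT x|lborel. cmod (g x - f x)) < \<epsilon> \<and>
        (\<lambda>n. LINT x|lborel. cmod (f (t n + x) - f x)) \<longlonglongrightarrow> 0"
  shows "(\<lambda>n. LINT x|lborel. cmod (g (t n + x) - g x)) \<longlonglongrightarrow> 0"
proof (rule LIMSEQ_I)
  fix \<epsilon> :: real assume \<epsilon>: "\<epsilon> > 0"
  \<comment> \<open>The distance is counted twice, so \<open>\<epsilon> / 4\<close> leaves
    \<open>\<epsilon> / 2\<close> for \<open>f\<close>.\<close>
  obtain f where f: "integrable lborel f" "(LINT x|lborel. cmod (g x - f x)) < \<epsilon> / 4"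
    "(\<lambda>n. LINT x|lborel. cmod (f (t n + x) - f x)) \<longlonglongrightarrow> 0"
    using approx[of "\<epsilon> / 4"] \<epsilon> by auto
  obtain N where N: "\<And>n. n \<ge> N \<Longrightarrow> norm ((LINT x|lborel. cmod (f (t n + x) - f x)) - 0) < \<epsilon> / 2"
    using LIMSEQ_D[OF f(3), of "\<epsilon> / 2"] \<epsilon> by auto
  have "norm ((LINT x|lborel. cmod (g (t n + x) - g x)) - 0) < \<epsilon>" if "n \<ge> N" for n
    using N[OF that] f(2) L1_translation_approx[OF g f(1), of "t n"] by simp
  then show "\<exists>N. \<forall>n\<ge>N. norm ((LINT x|lborel. cmod (g (t n + x) - g x)) - 0) < \<epsilon>" by blast
qed

text \<open>Up to the factor \<open>cmod c\<close> the distance is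
  \<open>2 |U| - 2 |U \<inter> (U - t)|\<close>. The product
  \<open>indicator U x * indicator U (t n + x)\<close> converges at every point: openness handles
  \<open>x\<close> in \<open>U\<close>, and outside \<open>U\<close> the first factor vanishes. The
  second indicator alone could oscillate on the boundary.\<close>

lemma L1_translation_indicator_open:
  fixes U :: "'a::euclidean_space set"
  assumes U: "open U" "emeasure lborel U < \<infinity>" and t: "t \<longlonglongrightarrow> 0"
  shows "(\<lambda>n. LINT x|lborel. cmod (indicator U (t n + x) *\<^sub>R c - indicator U x *\<^sub>R c)) \<longlonglongrightarrow> 0"
proof -
  have [measurable]: "U \<in> sets borel" using U by simp
  have int: "integrable lborel (indicator U :: 'a \<Rightarrow> real)"
    using U by (simp add: integrable_indicator_iff)
  have intt: "integrable lborel (\<lambda>x. indicator U (t n + x) :: real)" for n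
    using integrable_lborel_affine[of 1 "indicator U :: 'a \<Rightarrow> real" "t n"] int by simp
  have m2: "(\<lambda>x. indicator U x * indicator U (t n + x) :: real) \<in> borel_measurable lborel" for n
    using borel_measurable_integrable[OF intt] borel_measurable_integrable[OF int] by simp
  have lim: "(\<lambda>n. LINT x|lborel. indicator U x * indicator U (t n + x) :: real) \<longlonglongrightarrow> (LINT x|lborel. indicator U x)"
  proof (rule integral_dominated_convergence[where w = "indicator U"])
    show "AE x in lborel. (\<lambda>n. indicator U x * indicator U (t n + x) :: real) \<longlonglongrightarrow> indicator U x"
    proof (intro AE_I2)
      fix x
      show "(\<lambda>n. indicator U x * indicator U (t n + x) :: real) \<longlonglongrightarrow> indicator U x"
      proof (cases "x \<in> U")
        case True
        have "(\<lambda>n. t n + x) \<longlonglongrightarrow> 0 + x" by (intro tendsto_intros t)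
        then have "eventually (\<lambda>n. t n + x \<in> U) sequentially"
          using topological_tendstoD[OF _ U(1)] True by simp
        then have "eventually (\<lambda>n. indicator U x * indicator U (t n + x) = (indicator U x :: real)) sequentially"
          by eventually_elim (use True in simp)
        then show ?thesis by (rule tendsto_eventually)
      qed simp
    qed
  qed (use int m2 in \<open>auto simp: indicator_def\<close>)
  have eq: "(LINT x|lborel. cmod (indicator U (t n + x) *\<^sub>R c - indicator U x *\<^sub>R c))
      = cmod c * (2 * (LINT x|lborel. indicator U x) - 2 * (LINT x|lborel. indicator U x * indicator U (t n + x)))" for n
  proof -
    have i3: "integrable lborel (\<lambda>x. indicator U x * indicator U (t n + x) :: real)"
      by (rule Bochner_Integration.integrable_bound[OF int m2]) (auto simp: indicator_def)
    have "(LINT x|lborel. cmod (indicator U (t n + x) *\<^sub>R c - indicator U x *\<^sub>R c))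
      = (LINT x|lborel. cmod c * (indicator U (t n + x) + indicator U x - 2 * (indicator U x * indicator U (t n + x))))"
      by (intro Bochner_Integration.integral_cong) (auto simp: indicator_def)
    also have "\<dots> = cmod c * ((LINT x|lborel. indicator U (t n + x)) + (LINT x|lborel. indicator U x)
        - 2 * (LINT x|lborel. indicator U x * indicator U (t n + x)))"
      using int intt[of n] i3 by simp
    also have "(LINT x|lborel. indicator U (t n + x) :: real) = (LINT x|lborel. indicator U x)"
      using integral_lborel_affine[of 1 "indicator U :: 'a \<Rightarrow> real" "t n"] by simp
    finally show ?thesis by (simp add: algebra_simps)
  qed
  have "(\<lambda>n. cmod c * (2 * (LINT x|lborel. indicator U x)
      - 2 * (LINT x|lborel. indicator U x * indicator U (t n + x)))) \<longlonglongrightarrow>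
      cmod c * (2 * (LINT x|lborel. indicator U x) - 2 * (LINT x|lborel. indicator U x))"
    by (intro tendsto_intros lim)
  then show ?thesis unfolding eq by simp
qed

text \<open>Induction over integrable functions: indicators reduce to open sets by outer regularity,
  and the approximation lemma takes care of dominated limits.\<close>

lemma L1_translation:
  fixes g :: "'a::euclidean_space \<Rightarrow> complex"
  assumes g: "integrable lborel g" and t: "t \<longlonglongrightarrow> 0"
  shows "(\<lambda>n. LINT x|lborel. cmod (g (t n + x) - g x)) \<longlonglongrightarrow> 0"
  using g
proof (induction rule: integrable_induct)
  case (base A c)
  have [measurable]: "A \<in> sets borel" using base by simp
  show ?case
  proof (rule L1_translation_limit)
    show "integrable lborel (\<lambda>x. indicator A x *\<^sub>R c)"
      using base by (intro integrable_scaleR_left) (simp add: integrable_indicator_iff)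
    fix \<epsilon> :: real assume \<epsilon>: "\<epsilon> > 0"
    \<comment> \<open>The \<open>+ 1\<close> keeps the quotient meaningful for \<open>c = 0\<close>
      and makes the final estimate strict.\<close>
    define e where "e = \<epsilon> / (cmod c + 1)"
    have e: "e > 0" using \<epsilon> by (simp add: e_def add_nonneg_pos)
    obtain U where U: "open U" "A \<subseteq> U" "emeasure lborel (U - A) < ennreal e"
      using outer_regular_lborel[OF \<open>A \<in> sets borel\<close> e] by auto
    have [measurable]: "U \<in> sets borel" using U by simp
    have fin: "emeasure lborel U < \<infinity>"
    proof -
      have "emeasure lborel U \<le> emeasure lborel (U - A) + emeasure lborel A"
        by (rule order_trans[OF emeasure_mono emeasure_subadditive]) auto
      also have "\<dots> < \<infinity>" using order_less_trans[OF U(3) ennreal_less_top] base by simp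
      finally show ?thesis .
    qed
    have "(LINT x|lborel. cmod (indicator A x *\<^sub>R c - indicator U x *\<^sub>R c))
        = (LINT x|lborel. cmod c * indicator (U - A) x)"
      using U(2) by (intro Bochner_Integration.integral_cong) (auto simp: indicator_def)
    also have "\<dots> = cmod c * measure lborel (U - A)" by simp
    also have "\<dots> \<le> cmod c * e"
    proof (intro mult_left_mono)
      have "measure lborel (U - A) < e"
      proof -
        have "emeasure lborel (U - A) \<noteq> top" using order_less_trans[OF U(3) ennreal_less_top] by simp
        from emeasure_eq_ennreal_measure[OF this] U(3)
        have "ennreal (measure lborel (U - A)) < ennreal e" by (simp only:)
        then show ?thesis by (simp add: ennreal_less_iff)
      qed
      then show "measure lborel (U - A) \<le> e" by simp
    qed simp
    also have "\<dots> < (cmod c + 1) * e" using e by simp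
    also have "\<dots> = \<epsilon>" by (simp add: e_def add_nonneg_eq_0_iff)
    finally have "(LINT x|lborel. cmod (indicator A x *\<^sub>R c - indicator U x *\<^sub>R c)) < \<epsilon>" .
    moreover have "integrable lborel (\<lambda>x. indicator U x *\<^sub>R c)"
      using fin by (intro integrable_scaleR_left) (simp add: integrable_indicator_iff)
    ultimately show "\<exists>f. integrable lborel f \<and> (LINT x|lborel. cmod (indicator A x *\<^sub>R c - f x)) < \<epsilon> \<and>
        (\<lambda>n. LINT x|lborel. cmod (f (t n + x) - f x)) \<longlonglongrightarrow> 0"
      using L1_translation_indicator_open[OF U(1) fin t] by blast
  qed
next
  case (add f g)
  have tr: "integrable lborel (\<lambda>x. f (t n + x))" "integrable lborel (\<lambda>x. g (t n + x))" for n
    using integrable_lborel_affine[of 1 f "t n"] integrable_lborel_affine[of 1 g "t n"] add by simp_all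
  show ?case
  proof (rule tendsto_sandwich[OF always_eventually always_eventually tendsto_const])
    show "\<forall>n. (LINT x|lborel. cmod (f (t n + x) + g (t n + x) - (f x + g x)))
        \<le> (LINT x|lborel. cmod (f (t n + x) - f x)) + (LINT x|lborel. cmod (g (t n + x) - g x))"
    proof
      fix n
      have "(LINT x|lborel. cmod (f (t n + x) + g (t n + x) - (f x + g x)))
          \<le> (LINT x|lborel. cmod (f (t n + x) - f x) + cmod (g (t n + x) - g x))"
      proof (rule integral_mono)
        fix x
        show "cmod (f (t n + x) + g (t n + x) - (f x + g x))
            \<le> cmod (f (t n + x) - f x) + cmod (g (t n + x) - g x)"
          using norm_triangle_ineq[of "f (t n + x) - f x" "g (t n + x) - g x"] by (simp add: algebra_simps)
      qed (use tr[of n] add in auto)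
      then show "(LINT x|lborel. cmod (f (t n + x) + g (t n + x) - (f x + g x)))
        \<le> (LINT x|lborel. cmod (f (t n + x) - f x)) + (LINT x|lborel. cmod (g (t n + x) - g x))"
        using tr[of n] add by simp
    qed
    show "(\<lambda>n. (LINT x|lborel. cmod (f (t n + x) - f x)) + (LINT x|lborel. cmod (g (t n + x) - g x))) \<longlonglongrightarrow> 0"
      using tendsto_add[OF add.IH] by simp
  qed simp
next
  case (lim f s)
  show ?case
  proof (rule L1_translation_limit[OF lim.hyps(4)])
    fix \<epsilon> :: real assume \<epsilon>: "\<epsilon> > 0"
    have [measurable]: "f \<in> borel_measurable borel" "s i \<in> borel_measurable borel" for i
      using borel_measurable_integrable[OF lim.hyps(4)] borel_measurable_integrable[OF lim.hyps(1)] by simp_all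
    have "(\<lambda>i. LINT x|lborel. cmod (f x - s i x)) \<longlonglongrightarrow> (LINT x|(lborel::'a measure). 0)"
    \<comment> \<open>The induction supplies \<open>cmod (s i x) \<le> 2 * cmod (f x)\<close>, hence
      the factor 3.\<close>
    proof (rule integral_dominated_convergence[where w = "\<lambda>x. 3 * cmod (f x)"])
      show "AE x in lborel. (\<lambda>i. cmod (f x - s i x)) \<longlonglongrightarrow> 0"
      proof (intro AE_I2)
        fix x
        have "(\<lambda>i. cmod (f x - s i x)) \<longlonglongrightarrow> cmod (f x - f x)"
          by (intro tendsto_intros lim.hyps(2)) simp
        then show "(\<lambda>i. cmod (f x - s i x)) \<longlonglongrightarrow> 0" by simp
      qed
      show "AE x in lborel. norm (cmod (f x - s i x)) \<le> 3 * cmod (f x)" for i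
        using lim.hyps(3)[of _ i] norm_triangle_ineq4[of "f _" "s i _"] by (intro AE_I2) (smt (verit) UNIV_I norm_ge_zero real_norm_def space_borel space_lborel)
    qed (use lim.hyps(4) in auto)
    then have "(\<lambda>i. LINT x|lborel. cmod (f x - s i x)) \<longlonglongrightarrow> 0" by simp
    from LIMSEQ_D[OF this \<epsilon>] obtain i where "(LINT x|lborel. cmod (f x - s i x)) < \<epsilon>"
      by fastforce
    then show "\<exists>g. integrable lborel g \<and> (LINT x|lborel. cmod (f x - g x)) < \<epsilon> \<and>
        (\<lambda>n. LINT x|lborel. cmod (g (t n + x) - g x)) \<longlonglongrightarrow> 0"
      using lim.hyps(1) lim.IH by blast
  qed
qed

text \<open>Integrability controls the points with \<open>cmod (g x) \<le> m\<close>: there the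
  error is at most \<open>m\<close> times the L1 modulus of continuity. Square integrability
  controls the rest, where Young's inequality with weight \<open>\<eta>\<close> trades the tail of
  the squared modulus against \<open>2 * \<eta> * N\<close>.\<close>

lemma autocorrelation_tendsto:
  fixes g :: "'a::euclidean_space \<Rightarrow> complex"
  assumes g: "integrable lborel g" and sq: "square_integrable g" and t: "t \<longlonglongrightarrow> 0"
  shows "(\<lambda>n. LINT x|lborel. g x * cnj (g (t n + x))) \<longlonglongrightarrow> (LINT x|lborel. g x * cnj (g x))"
proof -
  have mg[measurable]: "g \<in> borel_measurable borel"
    using borel_measurable_integrable[OF g] by simp
  have sqi: "integrable lborel (\<lambda>x. (cmod (g x))\<^sup>2)"
    using sq by (simp add: square_integrable_def)
  have sqit: "integrable lborel (\<lambda>x. (cmod (g (t n + x)))\<^sup>2)" for n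
    using integrable_lborel_affine[of 1 "\<lambda>x. (cmod (g x))\<^sup>2" "t n"] sqi by simp
  have git: "integrable lborel (\<lambda>x. g (t n + x))" for n
    using integrable_lborel_affine[of 1 g "t n"] g by simp
  have [measurable]: "(\<lambda>x. g (t n + x)) \<in> borel_measurable borel" for n
    using borel_measurable_integrable[OF git] by simp
  have sqt: "square_integrable (\<lambda>x. g (t n + x))" for n
    using sqit by (simp add: square_integrable_def)
  define N where "N = (LINT x|lborel. (cmod (g x))\<^sup>2)"
  have N: "N \<ge> 0" by (simp add: N_def)
  have Nt: "(LINT x|lborel. (cmod (g (t n + x)))\<^sup>2) = N" for n
    using integral_lborel_affine[of 1 "\<lambda>x. (cmod (g x))\<^sup>2" "t n"] by (simp add: N_def)
  define tail where "tail m x = (if cmod (g x) > real m then (cmod (g x))\<^sup>2 else 0)" for m :: nat and x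
  have mtail[measurable]: "tail m \<in> borel_measurable borel" for m
    unfolding tail_def by measurable
  have tail0: "(\<lambda>m. LINT x|lborel. tail m x) \<longlonglongrightarrow> (LINT x|(lborel::'a measure). (0::real))"
  proof (rule integral_dominated_convergence[where w = "\<lambda>x. (cmod (g x))\<^sup>2" and s = tail and f = "\<lambda>_. 0"])
    show "AE x in lborel. (\<lambda>m. tail m x) \<longlonglongrightarrow> 0"
    proof (intro AE_I2 tendsto_eventually)
      fix x :: 'a
      obtain m where "cmod (g x) \<le> real m" using real_arch_simple by blast
      then show "\<forall>\<^sub>F n in sequentially. tail n x = 0"
        by (intro eventually_sequentiallyI[of m]) (auto simp: tail_def)
    qed
  qed (use sqi in \<open>auto simp: tail_def\<close>)
  have taili: "integrable lborel (tail m)" for m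
    by (rule Bochner_Integration.integrable_bound[OF sqi]) (auto simp: tail_def)
  define J where "J n = (LINT x|lborel. cmod (g (t n + x) - g x))" for n
  have J: "J \<longlonglongrightarrow> 0" unfolding J_def[abs_def] by (rule L1_translation[OF g t])
  have bound: "cmod ((LINT x|lborel. g x * cnj (g (t n + x))) - (LINT x|lborel. g x * cnj (g x)))
      \<le> real m * J n + (LINT x|lborel. tail m x) / (2 * \<eta>) + 2 * \<eta> * N" if \<eta>: "\<eta> > 0" for n m \<eta>
  proof -
    have i1: "integrable lborel (\<lambda>x. g x * cnj (g (t n + x)))" "integrable lborel (\<lambda>x. g x * cnj (g x))"
      using integrable_mult_square_integrable[OF sq square_integrable_cnj[OF sqt]]
        integrable_mult_square_integrable[OF sq square_integrable_cnj[OF sq]] by auto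
    have pw: "cmod (g x * cnj (g (t n + x)) - g x * cnj (g x))
        \<le> real m * cmod (g (t n + x) - g x) + (tail m x / (2 * \<eta>)
          + \<eta> * ((cmod (g (t n + x)))\<^sup>2 + (cmod (g x))\<^sup>2))" for x
    proof -
      define a b where "a = cmod (g x)" and "b = cmod (g (t n + x) - g x)"
      have "cmod (g x * cnj (g (t n + x)) - g x * cnj (g x)) = cmod (g x * cnj (g (t n + x) - g x))"
        by (simp add: algebra_simps)
      then have e: "cmod (g x * cnj (g (t n + x)) - g x * cnj (g x)) = a * b"
        by (simp only: norm_mult complex_mod_cnj a_def b_def)
      have b0: "a \<ge> 0" "b \<ge> 0" by (simp_all add: a_def b_def)
      have b2: "b\<^sup>2 \<le> 2 * ((cmod (g (t n + x)))\<^sup>2 + (cmod (g x))\<^sup>2)"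
        using cmod_add_squared_le[of "g (t n + x)" "- g x"] by (simp add: b_def)
      show ?thesis
      proof (cases "a > real m")
        case False
        then have "a * b \<le> real m * b" using b0 by (intro mult_right_mono) auto
        moreover have "0 \<le> \<eta> * ((cmod (g (t n + x)))\<^sup>2 + (cmod (g x))\<^sup>2)" using \<eta> by simp
        moreover have "tail m x = 0" using False by (simp add: tail_def a_def)
        ultimately show ?thesis unfolding e b_def by simp
      next
        case True
        \<comment> \<open>Young's inequality: expanding this square bounds \<open>a * b\<close>, the
          small weight \<open>\<eta>\<close> falling on the factor that is merely bounded in
          L2.\<close>
        have "0 \<le> (a / sqrt \<eta> - sqrt \<eta> * b)\<^sup>2" by simp
        also have "\<dots> = a\<^sup>2 / \<eta> + \<eta> * b\<^sup>2 - 2 * (a * b)"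
          using \<eta> by (simp add: power2_diff power_divide power_mult_distrib)
        finally have "a * b \<le> a\<^sup>2 / (2 * \<eta>) + \<eta> * b\<^sup>2 / 2" by simp
        also have "\<eta> * b\<^sup>2 / 2 \<le> \<eta> * ((cmod (g (t n + x)))\<^sup>2 + (cmod (g x))\<^sup>2)"
          using mult_left_mono[OF b2, of \<eta>] \<eta> by simp
        finally have "a * b \<le> a\<^sup>2 / (2 * \<eta>) + \<eta> * ((cmod (g (t n + x)))\<^sup>2 + (cmod (g x))\<^sup>2)" by simp
        moreover have "0 \<le> real m * b" using b0 by simp
        moreover have tm: "tail m x = a\<^sup>2" using True by (simp add: tail_def a_def)
        ultimately show ?thesis unfolding e b_def[symmetric] tm by linarith
      qed
    qed
    have "cmod ((LINT x|lborel. g x * cnj (g (t n + x))) - (LINT x|lborel. g x * cnj (g x)))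
       = cmod (LINT x|lborel. g x * cnj (g (t n + x)) - g x * cnj (g x))"
      using i1 by simp
    also have "\<dots> \<le> (LINT x|lborel. cmod (g x * cnj (g (t n + x)) - g x * cnj (g x)))"
      by (rule integral_norm_bound)
    also have "\<dots> \<le> (LINT x|lborel. real m * cmod (g (t n + x) - g x) + (tail m x / (2 * \<eta>)
          + \<eta> * ((cmod (g (t n + x)))\<^sup>2 + (cmod (g x))\<^sup>2)))"
    proof (rule integral_mono[OF _ _ pw])
      show "integrable lborel (\<lambda>x. cmod (g x * cnj (g (t n + x)) - g x * cnj (g x)))"
        using i1 by (intro integrable_norm Bochner_Integration.integrable_diff)
      show "integrable lborel (\<lambda>x. real m * cmod (g (t n + x) - g x) + (tail m x / (2 * \<eta>)
          + \<eta> * ((cmod (g (t n + x)))\<^sup>2 + (cmod (g x))\<^sup>2)))"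
        using g git taili sqi sqit
        by (intro Bochner_Integration.integrable_add integrable_mult_right integrable_divide
            integrable_norm Bochner_Integration.integrable_diff)
    qed
    also have "\<dots> = real m * J n + ((LINT x|lborel. tail m x) / (2 * \<eta>) + \<eta> * (N + N))"
    proof -
      have "integrable lborel (\<lambda>x. cmod (g (t n + x) - g x))"
        using g git by (intro integrable_norm Bochner_Integration.integrable_diff)
      then show ?thesis
        using taili sqi sqit Nt by (simp add: J_def N_def)
    qed
    finally show ?thesis by simp
  qed
  show ?thesis
  proof (rule LIMSEQ_I)
    fix \<epsilon> :: real assume \<epsilon>: "\<epsilon> > 0"
    \<comment> \<open>This makes \<open>2 * \<eta> * N\<close> at most
      \<open>\<epsilon> / 3\<close>; \<open>N + 1\<close> allows for \<open>N = 0\<close>. Then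
      \<open>m\<close> is chosen depending on \<open>\<eta>\<close>, and \<open>n0\<close> depending
      on \<open>m\<close>.\<close>
    define \<eta> where "\<eta> = \<epsilon> / (6 * (N + 1))"
    have \<eta>: "\<eta> > 0" using \<epsilon> N by (simp add: \<eta>_def)
    have "2 * \<eta> * N \<le> 2 * \<eta> * (N + 1)" using \<eta> by simp
    also have "\<dots> = \<epsilon> / 3" using N by (simp add: \<eta>_def field_simps)
    finally have e3: "2 * \<eta> * N \<le> \<epsilon> / 3" .
    have "(\<lambda>m. (LINT x|lborel. tail m x) / (2 * \<eta>)) \<longlonglongrightarrow> 0 / (2 * \<eta>)"
      using tail0 \<eta> by (intro tendsto_divide tendsto_const) auto
    from LIMSEQ_D[OF this, of "\<epsilon> / 3"] \<epsilon> obtain m where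
      m: "norm ((LINT x|lborel. tail m x) / (2 * \<eta>) - 0 / (2 * \<eta>)) < \<epsilon> / 3" by fastforce
    have "(\<lambda>n. real m * J n) \<longlonglongrightarrow> real m * 0" by (intro tendsto_intros J)
    from LIMSEQ_D[OF this, of "\<epsilon> / 3"] \<epsilon> obtain n0 where
      n0: "\<And>n. n \<ge> n0 \<Longrightarrow> norm (real m * J n - real m * 0) < \<epsilon> / 3" by fastforce
    have "norm ((LINT x|lborel. g x * cnj (g (t n + x))) - (LINT x|lborel. g x * cnj (g x))) < \<epsilon>"
      if "n \<ge> n0" for n
    proof -
      have "real m * J n < \<epsilon> / 3" using n0[OF that] by (simp add: abs_less_iff)
      moreover have "(LINT x|lborel. tail m x) / (2 * \<eta>) < \<epsilon> / 3" using m by (simp only: real_norm_def abs_less_iff) simp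
      ultimately show ?thesis using bound[OF \<eta>, of n m] e3 by linarith
    qed
    then show "\<exists>no. \<forall>n\<ge>no. norm ((LINT x|lborel. g x * cnj (g (t n + x))) - (LINT x|lborel. g x * cnj (g x))) < \<epsilon>"
      by blast
  qed
qed

section \<open>Plancherel's theorem by Gaussian summation\<close>

lemma fourier_gaussian_scaled:
  fixes w :: "'a::euclidean_space"
  assumes s: "s > 0"
  shows "fourier (\<lambda>\<xi>. of_real (exp (- (norm (s *\<^sub>R \<xi>))\<^sup>2 / 2))) w
    = of_real ((sqrt (2 * pi) / s) ^ DIM('a) * exp (- (norm (w /\<^sub>R s))\<^sup>2 / 2))"
proof -
  define \<gamma> where "\<gamma> x = complex_of_real (exp (- (norm x)\<^sup>2 / 2))" for x :: 'a
  have [measurable]: "\<gamma> \<in> borel_measurable borel"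
    unfolding \<gamma>_def by measurable
  have "fourier \<gamma> (w /\<^sub>R s) = \<bar>s\<bar> ^ DIM('a) *\<^sub>R (LINT x|lborel. \<gamma> (0 + s *\<^sub>R x) * exp (- \<i> * of_real ((w /\<^sub>R s) \<bullet> (0 + s *\<^sub>R x))))"
    unfolding fourier_def using s by (intro integral_lborel_affine) auto
  also have "(LINT x|lborel. \<gamma> (0 + s *\<^sub>R x) * exp (- \<i> * of_real ((w /\<^sub>R s) \<bullet> (0 + s *\<^sub>R x))))
      = fourier (\<lambda>\<xi>. \<gamma> (s *\<^sub>R \<xi>)) w"
  proof -
    have "(w /\<^sub>R s) \<bullet> (0 + s *\<^sub>R x) = w \<bullet> x" for x
      using s by (simp add: inner_scaleR_left[symmetric] del: inner_scaleR_left)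
    then show ?thesis unfolding fourier_def by (simp only: add_0_left)
  qed
  finally have "fourier \<gamma> (w /\<^sub>R s) = of_real (s ^ DIM('a)) * fourier (\<lambda>\<xi>. \<gamma> (s *\<^sub>R \<xi>)) w"
    using s by (simp add: scaleR_conv_of_real)
  then have "fourier (\<lambda>\<xi>. \<gamma> (s *\<^sub>R \<xi>)) w = fourier \<gamma> (w /\<^sub>R s) / of_real (s ^ DIM('a))"
    using s by (simp add: field_simps)
  also have "\<dots> = of_real ((sqrt (2 * pi) / s) ^ DIM('a) * exp (- (norm (w /\<^sub>R s))\<^sup>2 / 2))"
    unfolding \<gamma>_def[abs_def] fourier_gaussian by (simp add: power_divide)
  finally show ?thesis by (simp add: \<gamma>_def)
qed

text \<open>The Gaussian makes the triple integral over the frequency and two copies of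
  \<open>g\<close> absolutely convergent, so the frequency can be integrated first. That leaves a
  Gaussian in \<open>(x - y) / s\<close>, and substituting \<open>y = x - s z\<close> produces the
  autocorrelation.\<close>

lemma gaussian_weighted_fourier:
  fixes g :: "'a::euclidean_space \<Rightarrow> complex"
  assumes g: "integrable lborel g" and sq: "square_integrable g" and s: "s > 0"
  shows "(LINT \<xi>|lborel. of_real (exp (- (norm (s *\<^sub>R \<xi>))\<^sup>2 / 2)) * (fourier g \<xi> * cnj (fourier g \<xi>)))
    = of_real (sqrt (2 * pi) ^ DIM('a)) *
      (LINT z|lborel. of_real (exp (- (norm z)\<^sup>2 / 2)) * (LINT x|lborel. g x * cnj (g (- (s *\<^sub>R z) + x))))"
    (is "?L = _")
proof -
  define \<gamma> where "\<gamma> x = complex_of_real (exp (- (norm x)\<^sup>2 / 2))" for x :: 'a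
  define E where "E \<xi> = \<gamma> (s *\<^sub>R \<xi>)" for \<xi> :: 'a
  define P where "P p = g (fst p) * cnj (g (snd p))" for p :: "'a \<times> 'a"
  define k where "k = complex_of_real ((sqrt (2 * pi) / s) ^ DIM('a))"
  have mg[measurable]: "g \<in> borel_measurable borel"
    using borel_measurable_integrable[OF g] by simp
  have \<gamma>i: "integrable lborel \<gamma>" unfolding \<gamma>_def[abs_def] by (rule integrable_gaussian)
  have Ei: "integrable lborel E"
    using integrable_lborel_affine[of s \<gamma> 0] \<gamma>i s by (simp add: E_def[abs_def])
  have cg: "integrable lborel (\<lambda>x. cnj (g x))" using g by simp
  have Pi: "integrable lborel P"
    unfolding P_def[abs_def] by (rule integrable_lborel_times[OF g cg])
  have \<gamma>m: "\<gamma> \<in> borel_measurable borel" and mP: "P \<in> borel_measurable borel" and mcg: "(\<lambda>x. cnj (g x)) \<in> borel_measurable borel"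
    using borel_measurable_integrable[OF \<gamma>i] borel_measurable_integrable[OF Pi] borel_measurable_integrable[OF cg]
    by simp_all
  have split: "P p * exp (- \<i> * of_real (\<xi> \<bullet> (fst p - snd p)))
      = (g (fst p) * exp (- \<i> * of_real (\<xi> \<bullet> fst p))) * (cnj (g (snd p)) * exp (\<i> * of_real (\<xi> \<bullet> snd p)))" for \<xi> p
  proof -
    have "exp (- \<i> * complex_of_real (\<xi> \<bullet> (fst p - snd p)))
        = exp (- \<i> * of_real (\<xi> \<bullet> fst p)) * exp (\<i> * of_real (\<xi> \<bullet> snd p))"
      by (simp add: exp_add[symmetric] inner_diff_right algebra_simps)
    then show ?thesis by (simp only: P_def mult_ac)
  qed
  have FF: "fourier g \<xi> * cnj (fourier g \<xi>)
      = (LINT p|lborel. P p * exp (- \<i> * of_real (\<xi> \<bullet> (fst p - snd p))))" for \<xi>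
    unfolding split cnj_fourier unfolding fourier_def
    by (rule integral_lborel_times[symmetric, OF integrable_mult_exp_inner(1)[OF g] integrable_mult_exp_inner(2)[OF cg]])
  have Qi: "integrable lborel (\<lambda>q. (E (fst q) * P (snd q)) * exp (- \<i> * of_real (fst q \<bullet> (fst (snd q) - snd (snd q)))))"
  proof (rule Bochner_Integration.integrable_bound[OF integrable_lborel_times[OF Ei Pi]])
    have "(\<lambda>q::'a \<times> ('a \<times> 'a). exp (- \<i> * complex_of_real (fst q \<bullet> (fst (snd q) - snd (snd q))))) \<in> borel_measurable borel"
      by (intro borel_measurable_continuous_onI continuous_intros)
    then show "(\<lambda>q. (E (fst q) * P (snd q)) * exp (- \<i> * of_real (fst q \<bullet> (fst (snd q) - snd (snd q))))) \<in> borel_measurable lborel"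
      using borel_measurable_integrable[OF integrable_lborel_times[OF Ei Pi]] by simp
  qed (simp add: norm_mult)
  have "?L = (LINT \<xi>|lborel. LINT p|lborel. (E \<xi> * P p) * exp (- \<i> * of_real (\<xi> \<bullet> (fst p - snd p))))"
    unfolding FF E_def \<gamma>_def mult.assoc by simp
  also have "\<dots> = (LINT q|lborel. (E (fst q) * P (snd q)) * exp (- \<i> * of_real (fst q \<bullet> (fst (snd q) - snd (snd q)))))"
    using integral_lborel_pair[OF Qi] by simp
  also have "\<dots> = (LINT p|lborel. LINT \<xi>|lborel. (E \<xi> * P p) * exp (- \<i> * of_real (\<xi> \<bullet> (fst p - snd p))))"
    using integral_lborel_pair'[OF Qi] by simp
  \<comment> \<open>For fixed \<open>p\<close> the frequency integral is the transform of the scaled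
    Gaussian at \<open>fst p - snd p\<close>.\<close>
  also have "\<dots> = (LINT p|lborel. P p * (k * \<gamma> ((fst p - snd p) /\<^sub>R s)))"
  proof (rule Bochner_Integration.integral_cong)
    fix p :: "'a \<times> 'a"
    have "(LINT \<xi>|lborel. (E \<xi> * P p) * exp (- \<i> * of_real (\<xi> \<bullet> (fst p - snd p))))
        = (LINT \<xi>|lborel. P p * (E \<xi> * exp (- \<i> * of_real ((fst p - snd p) \<bullet> \<xi>))))"
      by (simp add: inner_commute mult_ac)
    also have "\<dots> = P p * fourier E (fst p - snd p)"
      unfolding fourier_def by simp
    also have "fourier E (fst p - snd p) = k * \<gamma> ((fst p - snd p) /\<^sub>R s)"
      unfolding E_def[abs_def] \<gamma>_def k_def fourier_gaussian_scaled[OF s] by simp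
    finally show "(LINT \<xi>|lborel. (E \<xi> * P p) * exp (- \<i> * of_real (\<xi> \<bullet> (fst p - snd p))))
        = P p * (k * \<gamma> ((fst p - snd p) /\<^sub>R s))" .
  qed simp
  also have "\<dots> = (LINT x|lborel. LINT y|lborel. P (x, y) * (k * \<gamma> ((x - y) /\<^sub>R s)))"
  proof -
    have "integrable lborel (\<lambda>p. P p * (k * \<gamma> ((fst p - snd p) /\<^sub>R s)))"
    proof (rule Bochner_Integration.integrable_bound[OF integrable_mult_right[OF Pi, of k]])
      have "(\<lambda>p::'a \<times> 'a. \<gamma> ((fst p - snd p) /\<^sub>R s)) \<in> borel_measurable borel"
        by (rule borel_measurable_comp_continuous[OF \<gamma>m]) (intro continuous_intros)
      then show "(\<lambda>p. P p * (k * \<gamma> ((fst p - snd p) /\<^sub>R s))) \<in> borel_measurable lborel"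
        using mP by simp
      have "cmod (\<gamma> u) \<le> 1" for u
        by (simp add: \<gamma>_def)
      then have "norm (k * P p) * norm (\<gamma> u) \<le> norm (k * P p) * 1" for p u
        by (intro mult_left_mono) simp_all
      then show "AE p in lborel. norm (P p * (k * \<gamma> ((fst p - snd p) /\<^sub>R s))) \<le> norm (k * P p)"
        by (intro AE_I2) (simp only: norm_mult mult_1_left mult_1_right mult_ac)
    qed
    from integral_lborel_pair[OF this] show ?thesis by simp
  qed
  also have "\<dots> = (LINT x|lborel. LINT z|lborel. of_real (sqrt (2 * pi) ^ DIM('a)) * (g x * cnj (g (- (s *\<^sub>R z) + x)) * \<gamma> z))"
  proof (rule Bochner_Integration.integral_cong)
    fix x :: 'a
    have "(\<lambda>y. \<gamma> ((x - y) /\<^sub>R s)) \<in> borel_measurable borel"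
      by (rule borel_measurable_comp_continuous[OF \<gamma>m]) (intro continuous_intros)
    then have "(\<lambda>y. P (x, y) * (k * \<gamma> ((x - y) /\<^sub>R s))) \<in> borel_measurable borel"
      using mcg by (simp add: P_def)
    \<comment> \<open>Substitution \<open>y = x - s z\<close>; its Jacobian
      \<open>s ^ DIM('a)\<close> cancels the power of \<open>s\<close> in \<open>k\<close>, leaving
      a constant free of \<open>s\<close>.\<close>
    from integral_lborel_affine[OF _ this, of "- s" x] s
    have "(LINT y|lborel. P (x, y) * (k * \<gamma> ((x - y) /\<^sub>R s)))
        = (s ^ DIM('a)) *\<^sub>R (LINT z|lborel. P (x, x - s *\<^sub>R z) * (k * \<gamma> z))"
      by simp
    also have "\<dots> = (LINT z|lborel. (s ^ DIM('a)) *\<^sub>R (P (x, x - s *\<^sub>R z) * (k * \<gamma> z)))"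
      by (simp only: integral_scaleR_right)
    also have "(\<lambda>z. (s ^ DIM('a)) *\<^sub>R (P (x, x - s *\<^sub>R z) * (k * \<gamma> z)))
        = (\<lambda>z. of_real (sqrt (2 * pi) ^ DIM('a)) * (g x * cnj (g (- (s *\<^sub>R z) + x)) * \<gamma> z))"
    proof
      fix z
      have "(s ^ DIM('a)) *\<^sub>R k = of_real (sqrt (2 * pi) ^ DIM('a))"
        using s by (simp add: k_def scaleR_conv_of_real power_divide)
      then have "of_real (sqrt (2 * pi) ^ DIM('a)) * (g x * cnj (g (- (s *\<^sub>R z) + x)) * \<gamma> z)
          = ((s ^ DIM('a)) *\<^sub>R k) * (g x * cnj (g (- (s *\<^sub>R z) + x)) * \<gamma> z)" by simp
      moreover have "- (s *\<^sub>R z) + x = x - s *\<^sub>R z" by simp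
      ultimately show "(s ^ DIM('a)) *\<^sub>R (P (x, x - s *\<^sub>R z) * (k * \<gamma> z))
          = of_real (sqrt (2 * pi) ^ DIM('a)) * (g x * cnj (g (- (s *\<^sub>R z) + x)) * \<gamma> z)"
        by (simp only: P_def fst_conv snd_conv scaleR_conv_of_real mult_ac)
    qed
    finally show "(LINT y|lborel. P (x, y) * (k * \<gamma> ((x - y) /\<^sub>R s)))
        = (LINT z|lborel. of_real (sqrt (2 * pi) ^ DIM('a)) * (g x * cnj (g (- (s *\<^sub>R z) + x)) * \<gamma> z))" .
  qed simp
  also have "\<dots> = of_real (sqrt (2 * pi) ^ DIM('a)) * (LINT x|lborel. LINT z|lborel. g x * cnj (g (- (s *\<^sub>R z) + x)) * \<gamma> z)"
    by (simp only: integral_mult_right_zero)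
  also have "(LINT x|lborel. LINT z|lborel. g x * cnj (g (- (s *\<^sub>R z) + x)) * \<gamma> z)
      = (LINT z|lborel. LINT x|lborel. g x * cnj (g (- (s *\<^sub>R z) + x)) * \<gamma> z)"
  proof -
    \<comment> \<open>This interchange needs a bound in the plane: the product of the two values of
      \<open>g\<close> is at most the mean of their squares, whose integrals over \<open>x\<close>
      are \<open>A\<close> whatever the shift, and the Gaussian is integrable in
      \<open>z\<close>.\<close>
    define F where "F p = g (fst p) * cnj (g (- (s *\<^sub>R snd p) + fst p)) * \<gamma> (snd p)" for p :: "'a \<times> 'a"
    have mF: "F \<in> borel_measurable borel"
      unfolding F_def[abs_def]
      by (intro borel_measurable_times borel_measurable_comp_continuous[OF mg]
          borel_measurable_comp_continuous[OF mcg] borel_measurable_comp_continuous[OF \<gamma>m] continuous_intros)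
    define A where "A = (\<integral>\<^sup>+x. ennreal ((cmod (g x))\<^sup>2) \<partial>lborel)"
    have A: "A < \<infinity>" using sq by (simp add: A_def square_integrable_iff_nn_integral)
    have "(\<integral>\<^sup>+p. ennreal (norm (F p)) \<partial>lborel) = (\<integral>\<^sup>+z. \<integral>\<^sup>+x. ennreal (norm (F (x, z))) \<partial>lborel \<partial>lborel)"
      by (rule nn_integral_lborel_pair(2)) (use mF in simp)
    also have "\<dots> \<le> (\<integral>\<^sup>+z. A * ennreal (norm (\<gamma> z)) \<partial>lborel)"
    proof (rule nn_integral_mono)
      fix z :: 'a
      have "(\<integral>\<^sup>+x. ennreal (norm (F (x, z))) \<partial>lborel)
          \<le> (\<integral>\<^sup>+x. (ennreal ((cmod (g x))\<^sup>2) + ennreal ((cmod (g (- (s *\<^sub>R z) + x)))\<^sup>2)) * ennreal (norm (\<gamma> z) / 2) \<partial>lborel)"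
      proof (rule nn_integral_mono)
        fix x
        have "norm (F (x, z)) \<le> ((cmod (g x))\<^sup>2 + (cmod (g (- (s *\<^sub>R z) + x)))\<^sup>2) / 2 * norm (\<gamma> z)"
          unfolding F_def fst_conv snd_conv norm_mult complex_mod_cnj
          by (intro mult_right_mono product_le_mean_squares) simp
        then have "ennreal (norm (F (x, z))) \<le> ennreal (((cmod (g x))\<^sup>2 + (cmod (g (- (s *\<^sub>R z) + x)))\<^sup>2) * (norm (\<gamma> z) / 2))"
          by (intro ennreal_leI) simp
        also have "\<dots> = (ennreal ((cmod (g x))\<^sup>2) + ennreal ((cmod (g (- (s *\<^sub>R z) + x)))\<^sup>2)) * ennreal (norm (\<gamma> z) / 2)"
          by (subst ennreal_mult) (auto simp: ennreal_plus)
        finally show "ennreal (norm (F (x, z))) \<le> (ennreal ((cmod (g x))\<^sup>2) + ennreal ((cmod (g (- (s *\<^sub>R z) + x)))\<^sup>2)) * ennreal (norm (\<gamma> z) / 2)" .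
      qed
      also have "\<dots> = (A + (\<integral>\<^sup>+x. ennreal ((cmod (g (- (s *\<^sub>R z) + x)))\<^sup>2) \<partial>lborel)) * ennreal (norm (\<gamma> z) / 2)"
        by (simp add: nn_integral_multc nn_integral_add A_def)
      also have "(\<integral>\<^sup>+x. ennreal ((cmod (g (- (s *\<^sub>R z) + x)))\<^sup>2) \<partial>lborel) = A"
        using nn_integral_lborel_translate[of "\<lambda>x. ennreal ((cmod (g x))\<^sup>2)" "- (s *\<^sub>R z)"] by (simp add: A_def)
      also have "(A + A) * ennreal (norm (\<gamma> z) / 2) = A * (2 * ennreal (norm (\<gamma> z) / 2))"
        by (simp add: mult_2[symmetric] mult_ac)
      also have "2 * ennreal (norm (\<gamma> z) / 2) = ennreal (norm (\<gamma> z))"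
        by (simp add: ennreal_mult[symmetric] numeral_mult_ennreal)
      finally show "(\<integral>\<^sup>+x. ennreal (norm (F (x, z))) \<partial>lborel) \<le> A * ennreal (norm (\<gamma> z))" .
    qed
    also have "\<dots> = A * (\<integral>\<^sup>+z. ennreal (norm (\<gamma> z)) \<partial>lborel)"
      using \<gamma>m by (intro nn_integral_cmult) simp
    also have "\<dots> < \<infinity>"
      using A \<gamma>i by (simp add: ennreal_mult_less_top integrable_iff_bounded)
    finally have "integrable lborel F"
      using mF by (simp add: integrable_iff_bounded)
    from integral_lborel_pair[OF this] integral_lborel_pair'[OF this] show ?thesis
      by (simp add: F_def)
  qed
  also have "\<dots> = (LINT z|lborel. \<gamma> z * (LINT x|lborel. g x * cnj (g (- (s *\<^sub>R z) + x))))"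
    by (simp add: mult.commute)
  finally show ?thesis unfolding \<gamma>_def .
qed

text \<open>Let the scale \<open>s\<close> tend to 0 in the weighted identity. On the frequency side
  the weights increase to 1 and monotone convergence gives the full integral, its finiteness being a
  result; on the other side the autocorrelation tends to the squared norm. One factor
  \<open>sqrt (2 * pi) ^ DIM('a)\<close> comes from the identity, the other from the mass of the
  Gaussian.\<close>

theorem plancherel:
  fixes g :: "'a::euclidean_space \<Rightarrow> complex"
  assumes g: "integrable lborel g" and sq: "square_integrable g"
  shows "(\<integral>\<^sup>+\<xi>. ennreal ((cmod (fourier g \<xi>))\<^sup>2) \<partial>lborel)
    = ennreal ((2 * pi) ^ DIM('a)) * (\<integral>\<^sup>+x. ennreal ((cmod (g x))\<^sup>2) \<partial>lborel)"
proof -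
  have mg[measurable]: "g \<in> borel_measurable borel"
    using borel_measurable_integrable[OF g] by simp
  have mcg: "(\<lambda>x. cnj (g x)) \<in> borel_measurable borel"
    using square_integrable_cnj[OF sq] by (simp add: square_integrable_def)
  define s where "s n = 1 / real (Suc n)" for n
  have s: "s n > 0" for n by (simp add: s_def)
  have s0: "s \<longlonglongrightarrow> 0" unfolding s_def[abs_def] by (rule LIMSEQ_Suc[OF lim_1_over_n, unfolded of_nat_id])
  define \<gamma> where "\<gamma> x = exp (- (norm x)\<^sup>2 / 2)" for x :: 'a
  have m\<gamma>[measurable]: "\<gamma> \<in> borel_measurable borel" unfolding \<gamma>_def by measurable
  have mc\<gamma>: "(\<lambda>z. complex_of_real (\<gamma> z)) \<in> borel_measurable borel" by measurable
  have \<gamma>01: "0 \<le> \<gamma> x" "\<gamma> x \<le> 1" for x by (simp_all add: \<gamma>_def)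
  define N where "N = (LINT x|lborel. (cmod (g x))\<^sup>2)"
  have N0: "N \<ge> 0" by (simp add: N_def)
  define R where "R t = (LINT x|lborel. g x * cnj (g (t + x)))" for t
  have sqi: "integrable lborel (\<lambda>x. (cmod (g x))\<^sup>2)"
    using sq by (simp add: square_integrable_def)
  have R0: "(LINT x|lborel. g x * cnj (g x)) = of_real N"
    unfolding N_def integral_complex_of_real[symmetric]
    by (simp only: complex_norm_square)
  \<comment> \<open>The squared norm bounds the autocorrelation at every shift; this yields the
    dominating function \<open>\<gamma> z * N\<close> below.\<close>
  have Rb: "cmod (R t) \<le> N" for t
  proof -
    have sqit: "integrable lborel (\<lambda>x. (cmod (g (t + x)))\<^sup>2)"
      using integrable_lborel_affine[of 1 "\<lambda>x. (cmod (g x))\<^sup>2" t] sqi by simp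
    have "cmod (R t) \<le> (LINT x|lborel. cmod (g x * cnj (g (t + x))))"
      unfolding R_def by (rule integral_norm_bound)
    also have "\<dots> \<le> (LINT x|lborel. ((cmod (g x))\<^sup>2 + (cmod (g (t + x)))\<^sup>2) / 2)"
    proof (rule integral_mono')
      show "integrable lborel (\<lambda>x. ((cmod (g x))\<^sup>2 + (cmod (g (t + x)))\<^sup>2) / 2)"
        using sqi sqit by simp
      show "cmod (g x * cnj (g (t + x))) \<le> ((cmod (g x))\<^sup>2 + (cmod (g (t + x)))\<^sup>2) / 2" for x
        unfolding norm_mult complex_mod_cnj by (rule product_le_mean_squares)
      show "0 \<le> ((cmod (g x))\<^sup>2 + (cmod (g (t + x)))\<^sup>2) / 2" for x by simp
    qed
    also have "\<dots> = (N + (LINT x|lborel. (cmod (g (t + x)))\<^sup>2)) / 2"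
      using sqi sqit by (simp add: N_def)
    also have "(LINT x|lborel. (cmod (g (t + x)))\<^sup>2) = N"
      using integral_lborel_affine[of 1 "\<lambda>x. (cmod (g x))\<^sup>2" t] by (simp add: N_def)
    finally show ?thesis by simp
  qed
  have mR: "(\<lambda>z. R (- (c *\<^sub>R z))) \<in> borel_measurable borel" for c
  proof -
    have "(\<lambda>p::'a \<times> 'a. g (snd p) * cnj (g (- (c *\<^sub>R fst p) + snd p))) \<in> borel_measurable borel"
      by (intro borel_measurable_times borel_measurable_comp_continuous[OF mg]
          borel_measurable_comp_continuous[OF mcg] continuous_intros)
    from borel_measurable_integral_snd[OF this] show ?thesis by (simp add: R_def)
  qed
  define I where "I n = (LINT \<xi>|lborel. \<gamma> (s n *\<^sub>R \<xi>) * (cmod (fourier g \<xi>))\<^sup>2)" for n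
  have fb: "(cmod (fourier g \<xi>))\<^sup>2 \<le> (LINT x|lborel. cmod (g x))\<^sup>2" for \<xi>
  proof (rule power_mono)
    show "cmod (fourier g \<xi>) \<le> (LINT x|lborel. cmod (g x))"
      unfolding fourier_def by (rule order_trans[OF integral_norm_bound]) (simp add: norm_mult)
  qed simp
  have \<gamma>i: "integrable lborel \<gamma>"
    using integrable_Re[OF integrable_gaussian[where 'a = 'a]] unfolding \<gamma>_def[abs_def] by simp
  have \<gamma>fi: "integrable lborel (\<lambda>\<xi>. \<gamma> (s n *\<^sub>R \<xi>) * (cmod (fourier g \<xi>))\<^sup>2)" for n
  proof (rule Bochner_Integration.integrable_bound)
    show "integrable lborel (\<lambda>\<xi>. (LINT x|lborel. cmod (g x))\<^sup>2 * \<gamma> (s n *\<^sub>R \<xi>))"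
      using integrable_lborel_affine[of "s n" \<gamma> 0] \<gamma>i s[of n] by simp
    show "AE \<xi> in lborel. norm (\<gamma> (s n *\<^sub>R \<xi>) * (cmod (fourier g \<xi>))\<^sup>2) \<le> norm ((LINT x|lborel. cmod (g x))\<^sup>2 * \<gamma> (s n *\<^sub>R \<xi>))"
      using mult_right_mono[OF fb \<gamma>01(1)] \<gamma>01 by (intro AE_I2) (simp add: abs_mult mult.commute)
  qed simp
  have "(\<lambda>n. complex_of_real (I n)) \<longlonglongrightarrow>
      of_real (sqrt (2 * pi) ^ DIM('a)) * (LINT z|lborel. of_real (\<gamma> z) * of_real N)"
  proof -
    have "complex_of_real (I n) = of_real (sqrt (2 * pi) ^ DIM('a)) * (LINT z|lborel. of_real (\<gamma> z) * R (- (s n *\<^sub>R z)))" for n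
      using gaussian_weighted_fourier[OF g sq s[of n]]
      unfolding I_def integral_complex_of_real[symmetric] \<gamma>_def R_def by (simp only: of_real_mult complex_norm_square)
    moreover have "(\<lambda>n. LINT z|lborel. of_real (\<gamma> z) * R (- (s n *\<^sub>R z))) \<longlonglongrightarrow> (LINT z|lborel. of_real (\<gamma> z) * of_real N)"
    proof (rule integral_dominated_convergence[where w = "\<lambda>z. \<gamma> z * N"])
      show "(\<lambda>z. of_real (\<gamma> z) * R (- (s n *\<^sub>R z))) \<in> borel_measurable lborel" for n
        using borel_measurable_times[OF mc\<gamma> mR[of "s n"]] by simp
      show "(\<lambda>z. complex_of_real (\<gamma> z) * of_real N) \<in> borel_measurable lborel"
        using mc\<gamma> by simp
      show "integrable lborel (\<lambda>z. \<gamma> z * N)" using \<gamma>i by (rule integrable_mult_left)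
      show "AE z in lborel. (\<lambda>n. of_real (\<gamma> z) * R (- (s n *\<^sub>R z))) \<longlonglongrightarrow> of_real (\<gamma> z) * of_real N"
      proof (intro AE_I2 tendsto_mult tendsto_const)
        fix z :: 'a
        have "(\<lambda>n. - (s n *\<^sub>R z)) \<longlonglongrightarrow> - (0 *\<^sub>R z)" by (intro tendsto_intros s0)
        then have "(\<lambda>n. - (s n *\<^sub>R z)) \<longlonglongrightarrow> 0" by simp
        from autocorrelation_tendsto[OF g sq this] show "(\<lambda>n. R (- (s n *\<^sub>R z))) \<longlonglongrightarrow> of_real N"
          unfolding R_def R0 .
      qed
      show "AE z in lborel. norm (of_real (\<gamma> z) * R (- (s n *\<^sub>R z))) \<le> \<gamma> z * N" for n
        using \<gamma>01 Rb by (intro AE_I2) (simp add: norm_mult mult_left_mono)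
    qed
    ultimately show ?thesis by (simp add: tendsto_mult_left)
  qed
  also have "of_real (sqrt (2 * pi) ^ DIM('a)) * (LINT z|lborel. of_real (\<gamma> z) * of_real N)
     = complex_of_real ((2 * pi) ^ DIM('a) * N)"
  proof -
    define C where "C = sqrt (2 * pi) ^ DIM('a)"
    \<comment> \<open>The mass of the Gaussian is its Fourier transform at 0.\<close>
    have "(LINT z|lborel. complex_of_real (\<gamma> z)) = of_real C"
      using fourier_gaussian[of "0::'a"]
      by (simp only: fourier_def \<gamma>_def C_def inner_zero_left of_real_0 mult_zero_right exp_zero
          norm_zero power_zero_numeral minus_zero div_0 mult_1_right)
    moreover have "(LINT z|lborel. of_real (\<gamma> z) * complex_of_real N) = (LINT z|lborel. of_real (\<gamma> z)) * of_real N"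
      by (rule integral_mult_left_zero)
    moreover have "C * C = (2 * pi) ^ DIM('a)"
      unfolding C_def power_mult_distrib[symmetric] by simp
    ultimately show ?thesis
      unfolding C_def[symmetric] by (metis of_real_mult mult.assoc)
  qed
  finally have "I \<longlonglongrightarrow> (2 * pi) ^ DIM('a) * N"
    by (simp only: tendsto_of_real_iff)
  then have "(\<lambda>n. ennreal (I n)) \<longlonglongrightarrow> ennreal ((2 * pi) ^ DIM('a) * N)"
    by (rule tendsto_ennrealI)
  moreover have "(\<lambda>n. ennreal (I n)) \<longlonglongrightarrow> (\<integral>\<^sup>+\<xi>. ennreal ((cmod (fourier g \<xi>))\<^sup>2) \<partial>lborel)"
  proof -
    have "ennreal (I n) = (\<integral>\<^sup>+\<xi>. ennreal (\<gamma> (s n *\<^sub>R \<xi>) * (cmod (fourier g \<xi>))\<^sup>2) \<partial>lborel)" for n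
      unfolding I_def using \<gamma>01 by (intro nn_integral_eq_integral[symmetric] \<gamma>fi AE_I2) simp
    moreover have "(\<lambda>n. \<integral>\<^sup>+\<xi>. ennreal (\<gamma> (s n *\<^sub>R \<xi>) * (cmod (fourier g \<xi>))\<^sup>2) \<partial>lborel)
        \<longlonglongrightarrow> (\<integral>\<^sup>+\<xi>. ennreal ((cmod (fourier g \<xi>))\<^sup>2) \<partial>lborel)"
    proof (rule nn_integral_LIMSEQ)
      show "incseq (\<lambda>n \<xi>. ennreal (\<gamma> (s n *\<^sub>R \<xi>) * (cmod (fourier g \<xi>))\<^sup>2))"
      proof (intro monoI le_funI ennreal_leI mult_right_mono)
        fix m n :: nat and \<xi> :: 'a assume "m \<le> n"
        then have "s n \<le> s m" by (simp add: s_def frac_le)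
        then have "(norm (s n *\<^sub>R \<xi>))\<^sup>2 \<le> (norm (s m *\<^sub>R \<xi>))\<^sup>2"
          using s[of n] s[of m] by (intro power_mono) (auto intro: mult_right_mono)
        then show "\<gamma> (s m *\<^sub>R \<xi>) \<le> \<gamma> (s n *\<^sub>R \<xi>)" by (simp add: \<gamma>_def)
      qed simp
      fix \<xi> :: 'a
      have "(\<lambda>n. \<gamma> (s n *\<^sub>R \<xi>) * (cmod (fourier g \<xi>))\<^sup>2) \<longlonglongrightarrow> \<gamma> (0 *\<^sub>R \<xi>) * (cmod (fourier g \<xi>))\<^sup>2"
        unfolding \<gamma>_def by (intro tendsto_intros s0) simp
      then show "(\<lambda>n. ennreal (\<gamma> (s n *\<^sub>R \<xi>) * (cmod (fourier g \<xi>))\<^sup>2)) \<longlonglongrightarrow> ennreal ((cmod (fourier g \<xi>))\<^sup>2)"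
        by (intro tendsto_ennrealI) (simp add: \<gamma>_def)
    qed simp
    ultimately show ?thesis by simp
  qed
  ultimately have "(\<integral>\<^sup>+\<xi>. ennreal ((cmod (fourier g \<xi>))\<^sup>2) \<partial>lborel) = ennreal ((2 * pi) ^ DIM('a) * N)"
    using LIMSEQ_unique by blast
  also have "\<dots> = ennreal ((2 * pi) ^ DIM('a)) * ennreal N"
    by (intro ennreal_mult) (simp_all add: N0)
  also have "ennreal N = (\<integral>\<^sup>+x. ennreal ((cmod (g x))\<^sup>2) \<partial>lborel)"
    unfolding N_def using sq by (rule nn_integral_square_integrable[symmetric])
  finally show ?thesis .
qed

section \<open>The symplectic Fourier transform of sections\<close>

lemma square_integrable_AE_section:
  fixes M :: "'a::euclidean_space \<times> 'b::euclidean_space \<Rightarrow> complex"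
  assumes "square_integrable M"
  shows "AE x in lborel. square_integrable (\<lambda>y. M (x, y))"
proof -
  have m: "M \<in> borel_measurable borel" and i: "integrable lborel (\<lambda>z. (cmod (M z))\<^sup>2)"
    using assms by (auto simp: square_integrable_def)
  have s: "(\<lambda>y. M (x, y)) \<in> borel_measurable borel" for x
    by (rule borel_measurable_comp_continuous[OF m]) (intro continuous_intros)
  from AE_integrable_lborel_fst[OF i] show ?thesis
    by eventually_elim (simp add: square_integrable_def s)
qed

lemma borel_measurable_fourier_section:
  fixes M :: "'a::euclidean_space \<times> 'b::euclidean_space \<Rightarrow> complex"
  assumes "M \<in> borel_measurable borel"
  shows "(\<lambda>z. fourier (\<lambda>v. M (fst z, v)) (snd z)) \<in> borel_measurable borel"
proof -
  have "(\<lambda>p::('a \<times> 'b) \<times> 'b. M (fst (fst p), snd p) * exp (- \<i> * complex_of_real (snd (fst p) \<bullet> snd p))) \<in> borel_measurable borel"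
  proof (rule borel_measurable_times)
    show "(\<lambda>p::('a \<times> 'b) \<times> 'b. M (fst (fst p), snd p)) \<in> borel_measurable borel"
      by (rule borel_measurable_comp_continuous[OF assms]) (intro continuous_intros)
    show "(\<lambda>p::('a \<times> 'b) \<times> 'b. exp (- \<i> * complex_of_real (snd (fst p) \<bullet> snd p))) \<in> borel_measurable borel"
      by (intro borel_measurable_continuous_onI continuous_intros)
  qed
  from borel_measurable_integral_snd[OF this] show ?thesis by (simp add: fourier_def)
qed

lemma ennreal_norm_measurable:
  fixes f :: "'a::euclidean_space \<Rightarrow> complex"
  assumes [measurable]: "f \<in> borel_measurable borel"
  shows "(\<lambda>z. ennreal ((cmod (f z))\<^sup>2)) \<in> borel_measurable borel"
  by measurable

text \<open>Plancherel's theorem on each line with fixed \<open>x\<close>, integrated over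
  \<open>x\<close>; Tonelli makes almost every section square integrable, which suffices under the
  integral.\<close>

lemma plancherel_section:
  fixes M :: "'a::euclidean_space \<times> 'b::euclidean_space \<Rightarrow> complex"
  assumes M: "square_integrable M" and i: "\<And>x. integrable lborel (\<lambda>v. M (x, v))"
  shows "(\<integral>\<^sup>+z. ennreal ((cmod (fourier (\<lambda>v. M (fst z, v)) (snd z)))\<^sup>2) \<partial>lborel)
    = ennreal ((2 * pi) ^ DIM('b)) * (\<integral>\<^sup>+z. ennreal ((cmod (M z))\<^sup>2) \<partial>lborel)"
proof -
  have m: "M \<in> borel_measurable borel"
    using M by (auto simp: square_integrable_def)
  have "(\<integral>\<^sup>+z. ennreal ((cmod (fourier (\<lambda>v. M (fst z, v)) (snd z)))\<^sup>2) \<partial>lborel)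
      = (\<integral>\<^sup>+x. \<integral>\<^sup>+\<xi>. ennreal ((cmod (fourier (\<lambda>v. M (x, v)) \<xi>))\<^sup>2) \<partial>lborel \<partial>lborel)"
    using nn_integral_lborel_pair(1)[OF ennreal_norm_measurable[OF borel_measurable_fourier_section[OF m]]] by simp
  also have "\<dots> = (\<integral>\<^sup>+x. ennreal ((2 * pi) ^ DIM('b)) * (\<integral>\<^sup>+v. ennreal ((cmod (M (x, v)))\<^sup>2) \<partial>lborel) \<partial>lborel)"
    using square_integrable_AE_section[OF M]
    by (intro nn_integral_cong_AE, eventually_elim) (rule plancherel[OF i])
  also have "\<dots> = ennreal ((2 * pi) ^ DIM('b)) * (\<integral>\<^sup>+x. \<integral>\<^sup>+v. ennreal ((cmod (M (x, v)))\<^sup>2) \<partial>lborel \<partial>lborel)"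
    using borel_measurable_nn_integral_snd[OF ennreal_norm_measurable[OF m]] by (intro nn_integral_cmult) simp
  also have "(\<integral>\<^sup>+x. \<integral>\<^sup>+v. ennreal ((cmod (M (x, v)))\<^sup>2) \<partial>lborel \<partial>lborel) = (\<integral>\<^sup>+z. ennreal ((cmod (M z))\<^sup>2) \<partial>lborel)"
    by (rule nn_integral_lborel_pair(1)[symmetric, OF ennreal_norm_measurable[OF m]])
  finally show ?thesis .
qed

lemma nn_integral_square_scaleR:
  fixes f :: "'a::euclidean_space \<Rightarrow> complex"
  assumes "f \<in> borel_measurable borel" "c \<noteq> 0"
  shows "(\<integral>\<^sup>+x. ennreal ((cmod (f (c *\<^sub>R x)))\<^sup>2) \<partial>lborel)
    = ennreal (inverse (\<bar>c\<bar> ^ DIM('a))) * (\<integral>\<^sup>+x. ennreal ((cmod (f x))\<^sup>2) \<partial>lborel)"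
proof -
  have "(\<integral>\<^sup>+x. ennreal ((cmod (f x))\<^sup>2) \<partial>lborel)
      = ennreal (\<bar>c\<bar> ^ DIM('a)) * (\<integral>\<^sup>+x. ennreal ((cmod (f (c *\<^sub>R x)))\<^sup>2) \<partial>lborel)"
    using nn_integral_lborel_affine[OF assms(2) ennreal_norm_measurable[OF assms(1)], of 0] by simp
  moreover have "ennreal (inverse (\<bar>c\<bar> ^ DIM('a))) * ennreal (\<bar>c\<bar> ^ DIM('a)) = 1"
    using assms(2) by (subst ennreal_mult[symmetric]) simp_all
  ultimately show ?thesis by (simp add: mult.assoc[symmetric])
qed

text \<open>The square is expanded. With \<open>\<phi>\<close> the truncated transform,
  \<open>a\<close> its squared norm and \<open>N\<close> that of \<open>g\<close>, the three terms
  are \<open>C * a\<close>, \<open>C\<^sup>2 * N\<close> and \<open>- 2 * C * a\<close>, since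
  Fubini turns the cross term into the inner product of \<open>\<phi>\<close> with
  \<open>fourier g\<close>. As \<open>C * N\<close> is the squared norm of \<open>fourier g\<close>,
  the sum \<open>C * (C * N - a)\<close> is \<open>C\<close> times the mass outside
  \<open>D\<close>.\<close>

lemma truncated_fourier_inversion:
  fixes g :: "'a::euclidean_space \<Rightarrow> complex"
  assumes g: "integrable lborel g" and sq: "square_integrable g"
    and D: "D \<in> sets borel" "emeasure lborel D < \<infinity>"
  shows "(\<integral>\<^sup>+y. ennreal ((cmod ((LINT \<xi>|lborel. indicator D \<xi> * fourier g \<xi> * exp (\<i> * of_real (\<xi> \<bullet> y)))
        - of_real ((2 * pi) ^ DIM('a)) * g y))\<^sup>2) \<partial>lborel)
    = ennreal ((2 * pi) ^ DIM('a)) * (\<integral>\<^sup>+\<xi>. ennreal (indicator (- D) \<xi> * (cmod (fourier g \<xi>))\<^sup>2) \<partial>lborel)"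
proof -
  define C where "C = (2 * pi) ^ DIM('a)"
  have C0: "C > 0" by (simp add: C_def)
  have mg[measurable]: "g \<in> borel_measurable borel" and mD[measurable]: "D \<in> sets borel"
    using borel_measurable_integrable[OF g] D by simp_all
  define \<phi> where "\<phi> \<xi> = indicator D \<xi> * fourier g \<xi>" for \<xi>
  have m\<phi>[measurable]: "\<phi> \<in> borel_measurable borel" unfolding \<phi>_def by measurable
  have fsq: "square_integrable (fourier g)"
    unfolding square_integrable_iff_nn_integral plancherel[OF g sq] using sq
    by (simp add: square_integrable_iff_nn_integral ennreal_mult_less_top)
  have fi: "integrable lborel (\<lambda>\<xi>. (cmod (fourier g \<xi>))\<^sup>2)"
    using fsq by (simp add: square_integrable_def)
  have \<phi>sq: "square_integrable \<phi>"
    unfolding square_integrable_def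
  proof
    show "integrable lborel (\<lambda>x. (cmod (\<phi> x))\<^sup>2)"
      by (rule Bochner_Integration.integrable_bound[OF fi]) (auto simp: \<phi>_def indicator_def)
  qed simp
  have \<phi>i: "integrable lborel \<phi>"
  proof (rule Bochner_Integration.integrable_bound)
    show "integrable lborel (\<lambda>x. indicator D x + (cmod (fourier g x))\<^sup>2)"
      using D fi by (intro Bochner_Integration.integrable_add) (simp_all add: integrable_indicator_iff)
    \<comment> \<open>The constant 1 is integrable over \<open>D\<close> because \<open>D\<close>
      has finite measure.\<close>
    have "cmod z \<le> 1 + (cmod z)\<^sup>2" for z
      using product_le_mean_squares[of "cmod z" 1] by (simp add: power2_eq_square) (smt (verit) mult_nonneg_nonneg norm_ge_zero)
    then show "AE x in lborel. norm (\<phi> x) \<le> norm (indicator D x + (cmod (fourier g x))\<^sup>2 :: real)"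
      by (intro AE_I2) (auto simp: \<phi>_def indicator_def)
  qed simp
  define \<Psi> where "\<Psi> y = (LINT \<xi>|lborel. \<phi> \<xi> * exp (\<i> * of_real (\<xi> \<bullet> y)))" for y
  \<comment> \<open>Changing the sign of \<open>y\<close> turns the inverse transform into
    \<open>fourier\<close>, so Plancherel applies to it as well.\<close>
  have \<Psi>: "\<Psi> = (\<lambda>y. fourier \<phi> (- 1 *\<^sub>R y))"
    by (simp add: fun_eq_iff \<Psi>_def fourier_def inner_commute)
  have m\<Psi>[measurable]: "\<Psi> \<in> borel_measurable borel"
    unfolding \<Psi> by (rule borel_measurable_comp_continuous[OF borel_measurable_fourier[OF m\<phi>]]) (intro continuous_intros)
  have \<Psi>n: "(\<integral>\<^sup>+y. ennreal ((cmod (\<Psi> y))\<^sup>2) \<partial>lborel) = ennreal C * (\<integral>\<^sup>+y. ennreal ((cmod (\<phi> y))\<^sup>2) \<partial>lborel)"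
    unfolding \<Psi> using nn_integral_square_scaleR[OF borel_measurable_fourier[OF m\<phi>], of "- 1"] plancherel[OF \<phi>i \<phi>sq]
    by (simp add: C_def)
  then have \<Psi>sq: "square_integrable \<Psi>"
    using \<phi>sq m\<Psi> by (simp add: square_integrable_iff_nn_integral ennreal_mult_less_top)
  define a N where "a = (LINT \<xi>|lborel. (cmod (\<phi> \<xi>))\<^sup>2)" and "N = (LINT y|lborel. (cmod (g y))\<^sup>2)"
  have a0: "a \<ge> 0" "N \<ge> 0" by (simp_all add: a_def N_def)
  have \<Psi>a: "(LINT y|lborel. (cmod (\<Psi> y))\<^sup>2) = C * a"
    using \<Psi>n unfolding nn_integral_square_integrable[OF \<Psi>sq] nn_integral_square_integrable[OF \<phi>sq] a_def[symmetric]
    using C0 a0 by (simp add: ennreal_mult[symmetric] ennreal_inj)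
  have gN: "(LINT \<xi>|lborel. (cmod (fourier g \<xi>))\<^sup>2) = C * N"
    using plancherel[OF g sq] unfolding nn_integral_square_integrable[OF fsq] nn_integral_square_integrable[OF sq] N_def[symmetric]
      C_def[symmetric]
    using C0 a0 by (simp add: ennreal_mult[symmetric] ennreal_inj)
  have cross: "(LINT y|lborel. \<Psi> y * cnj (g y)) = of_real a"
  proof -
    have cg: "integrable lborel (\<lambda>x. cnj (g x))" using g by simp
    define F where "F p = (\<phi> (fst p) * cnj (g (snd p))) * exp (\<i> * complex_of_real (fst p \<bullet> snd p))" for p
    have "integrable lborel F"
    proof (rule Bochner_Integration.integrable_bound[OF integrable_lborel_times[OF \<phi>i cg]])
      have "(\<lambda>p::'a \<times> 'a. exp (\<i> * complex_of_real (fst p \<bullet> snd p))) \<in> borel_measurable borel"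
        by (intro borel_measurable_continuous_onI continuous_intros)
      then show "F \<in> borel_measurable lborel"
        unfolding F_def[abs_def] using borel_measurable_integrable[OF integrable_lborel_times[OF \<phi>i cg]] by simp
    qed (simp add: norm_mult F_def)
    from integral_lborel_pair[OF this] integral_lborel_pair'[OF this]
    have "(LINT y|lborel. LINT \<xi>|lborel. F (\<xi>, y)) = (LINT \<xi>|lborel. LINT y|lborel. F (\<xi>, y))" by simp
    moreover have "(LINT \<xi>|lborel. F (\<xi>, y)) = \<Psi> y * cnj (g y)" for y
    proof -
      have "(LINT \<xi>|lborel. F (\<xi>, y)) = (LINT \<xi>|lborel. (\<phi> \<xi> * exp (\<i> * of_real (\<xi> \<bullet> y))) * cnj (g y))"
        by (simp add: F_def mult_ac)
      then show ?thesis unfolding \<Psi>_def by simp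
    qed
    moreover have "(LINT y|lborel. F (\<xi>, y)) = of_real ((cmod (\<phi> \<xi>))\<^sup>2)" for \<xi>
    proof -
      have "(LINT y|lborel. F (\<xi>, y)) = (LINT y|lborel. \<phi> \<xi> * (cnj (g y) * exp (\<i> * of_real (\<xi> \<bullet> y))))"
        by (simp add: F_def mult_ac)
      also have "\<dots> = \<phi> \<xi> * cnj (fourier g \<xi>)" unfolding cnj_fourier by simp
      also have "\<dots> = \<phi> \<xi> * cnj (\<phi> \<xi>)" by (simp add: \<phi>_def indicator_def)
      finally show ?thesis by (simp only: complex_norm_square)
    qed
    ultimately show ?thesis by (simp only: a_def integral_complex_of_real)
  qed
  have pw: "(cmod (\<Psi> y - of_real C * g y))\<^sup>2 = (cmod (\<Psi> y))\<^sup>2 + C\<^sup>2 * (cmod (g y))\<^sup>2 - 2 * C * Re (\<Psi> y * cnj (g y))" for y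
    by (simp add: cmod_power2 power2_diff power2_sum power_mult_distrib algebra_simps)
  have crossi: "integrable lborel (\<lambda>y. \<Psi> y * cnj (g y))"
    by (rule integrable_mult_square_integrable[OF \<Psi>sq square_integrable_cnj[OF sq]])
  have "(LINT y|lborel. (cmod (\<Psi> y - of_real C * g y))\<^sup>2) = C * a + C\<^sup>2 * N - 2 * C * a"
  proof -
    have "(LINT y|lborel. (cmod (\<Psi> y - of_real C * g y))\<^sup>2)
        = (LINT y|lborel. (cmod (\<Psi> y))\<^sup>2) + C\<^sup>2 * (LINT y|lborel. (cmod (g y))\<^sup>2) - 2 * C * (LINT y|lborel. Re (\<Psi> y * cnj (g y)))"
      unfolding pw using \<Psi>sq sq integrable_Re[OF crossi] by (simp add: square_integrable_def)
    also have "(LINT y|lborel. Re (\<Psi> y * cnj (g y))) = a"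
      using integral_Re[OF crossi] unfolding cross by simp
    finally show ?thesis by (simp add: \<Psi>a N_def)
  qed
  also have "\<dots> = C * (C * N - a)" by (simp add: power2_eq_square algebra_simps)
  also have "C * N - a = (LINT \<xi>|lborel. (cmod (fourier g \<xi>))\<^sup>2 - (cmod (\<phi> \<xi>))\<^sup>2)"
    unfolding gN[symmetric] a_def using fsq \<phi>sq by (simp add: square_integrable_def)
  also have "(\<lambda>\<xi>. (cmod (fourier g \<xi>))\<^sup>2 - (cmod (\<phi> \<xi>))\<^sup>2) = (\<lambda>\<xi>. indicator (- D) \<xi> * (cmod (fourier g \<xi>))\<^sup>2)"
    by (auto simp: \<phi>_def indicator_def)
  finally have main: "(LINT y|lborel. (cmod (\<Psi> y - of_real C * g y))\<^sup>2)
      = C * (LINT \<xi>|lborel. indicator (- D) \<xi> * (cmod (fourier g \<xi>))\<^sup>2)" .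
  have di: "integrable lborel (\<lambda>\<xi>. indicator (- D) \<xi> * (cmod (fourier g \<xi>))\<^sup>2)"
    by (rule Bochner_Integration.integrable_bound[OF fi]) (auto simp: indicator_def)
  have "(\<integral>\<^sup>+y. ennreal ((cmod (\<Psi> y - of_real C * g y))\<^sup>2) \<partial>lborel)
      = ennreal (LINT y|lborel. (cmod (\<Psi> y - of_real C * g y))\<^sup>2)"
    by (rule nn_integral_square_integrable[OF square_integrable_diff[OF \<Psi>sq square_integrable_cmult[OF sq]]])
  also have "\<dots> = ennreal C * ennreal (LINT \<xi>|lborel. indicator (- D) \<xi> * (cmod (fourier g \<xi>))\<^sup>2)"
    unfolding main using C0 by (intro ennreal_mult) (auto intro!: integral_nonneg_AE)
  also have "ennreal (LINT \<xi>|lborel. indicator (- D) \<xi> * (cmod (fourier g \<xi>))\<^sup>2)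
      = (\<integral>\<^sup>+\<xi>. ennreal (indicator (- D) \<xi> * (cmod (fourier g \<xi>))\<^sup>2) \<partial>lborel)"
    by (rule nn_integral_eq_integral[symmetric, OF di]) auto
  finally show ?thesis
    by (simp only: \<Psi>_def \<phi>_def C_def)
qed

lemma square_integrable_swap:
  fixes M :: "'a::euclidean_space \<times> 'b::euclidean_space \<Rightarrow> complex"
  assumes "square_integrable M"
  shows "square_integrable (\<lambda>z. M (snd z, fst z))"
    and "(\<integral>\<^sup>+z. ennreal ((cmod (M (snd z, fst z)))\<^sup>2) \<partial>lborel) = (\<integral>\<^sup>+z. ennreal ((cmod (M z))\<^sup>2) \<partial>lborel)"
proof -
  have m: "M \<in> borel_measurable borel" using assms by (simp add: square_integrable_def)
  have m': "(\<lambda>z. M (snd z, fst z)) \<in> borel_measurable borel"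
    by (rule borel_measurable_comp_continuous[OF m]) (intro continuous_intros)
  show eq: "(\<integral>\<^sup>+z. ennreal ((cmod (M (snd z, fst z)))\<^sup>2) \<partial>lborel) = (\<integral>\<^sup>+z. ennreal ((cmod (M z))\<^sup>2) \<partial>lborel)"
    using nn_integral_lborel_pair(1)[OF ennreal_norm_measurable[OF m']] nn_integral_lborel_pair(2)[OF ennreal_norm_measurable[OF m]]
    by simp
  show "square_integrable (\<lambda>z. M (snd z, fst z))"
    using assms m' unfolding square_integrable_iff_nn_integral eq by simp
qed

lemma square_integrable_scaleR:
  fixes f :: "'a::euclidean_space \<Rightarrow> complex"
  assumes f: "square_integrable f" and c: "c \<noteq> 0"
  shows "square_integrable (\<lambda>x. f (c *\<^sub>R x))"
proof -
  have m: "f \<in> borel_measurable borel" using f by (simp add: square_integrable_def)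
  have "(\<lambda>x. f (c *\<^sub>R x)) \<in> borel_measurable borel"
    by (rule borel_measurable_comp_continuous[OF m]) (intro continuous_intros)
  then show ?thesis
    using f unfolding square_integrable_iff_nn_integral nn_integral_square_scaleR[OF m c]
    by (simp add: ennreal_mult_less_top)
qed

lemma square_integrable_fourier_section:
  fixes M :: "'a::euclidean_space \<times> 'b::euclidean_space \<Rightarrow> complex"
  assumes "square_integrable M" "\<And>x. integrable lborel (\<lambda>v. M (x, v))"
  shows "square_integrable (\<lambda>z. fourier (\<lambda>v. M (fst z, v)) (snd z))"
  using assms borel_measurable_fourier_section[of M]
  unfolding square_integrable_iff_nn_integral plancherel_section[OF assms]
  by (simp add: ennreal_mult_less_top)

lemma integrable_indicator_square_integrable:
  fixes f :: "'a::euclidean_space \<Rightarrow> complex"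
  assumes f: "square_integrable f" and D[measurable]: "D \<in> sets borel" and fin: "emeasure lborel D < \<infinity>"
  shows "integrable lborel (\<lambda>x. indicator D x * f x)"
proof (rule integrable_mult_square_integrable[OF _ f])
  have "integrable lborel (indicator D :: 'a \<Rightarrow> real)"
    using fin by (simp add: integrable_indicator_iff)
  moreover have "(cmod (indicator D x))\<^sup>2 = indicator D x" for x :: 'a by (simp add: indicator_def)
  ultimately show "square_integrable (indicator D :: 'a \<Rightarrow> complex)"
    by (simp add: square_integrable_def)
qed

text \<open>In the truncated symplectic integral the \<open>\<xi>\<close> integral is taken first;
  it yields \<open>\<Psi> R\<close>, an approximate inversion of the transform in \<open>v\<close>.
  The \<open>x\<close> integral is then an ordinary Fourier transform. The error \<open>M R\<close>
  of the inversion has a known norm on almost every line, and Plancherel in \<open>x\<close> carries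
  it over, so the total error is a constant times \<open>tail R\<close>.\<close>

lemma has_symplectic_fourier_of_sections:
  fixes G :: "(real ^ 'd::finite) \<times> (real ^ 'd) \<Rightarrow> complex"
  assumes h: "h > 0" and G: "square_integrable G"
    and G1: "\<And>x. integrable lborel (\<lambda>v. G (x, v))" and G2: "\<And>v. integrable lborel (\<lambda>x. G (x, v))"
  shows "has_symplectic_fourier (h / 2) (\<lambda>(x, \<xi>). c * fourier (\<lambda>v. G (x, v)) \<xi>)
    (\<lambda>(q, p). c * fourier (\<lambda>v. G ((h / 2) *\<^sub>R v, (2 / h) *\<^sub>R q)) p)"
proof -
  define D where "D = CARD('d)"
  define C where "C = (2 * pi) ^ D"
  have C0: "C > 0" by (simp add: C_def)
  have mG: "G \<in> borel_measurable borel" using G by (simp add: square_integrable_def)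
  define f where "f z = c * fourier (\<lambda>v. G (fst z, v)) (snd z)" for z
  define \<kappa> where "\<kappa> = 1 / complex_of_real ((2 * pi * (h / 2)) ^ D)"
  define F where "F z = c * fourier (\<lambda>v. G ((h / 2) *\<^sub>R v, (2 / h) *\<^sub>R fst z)) (snd z)" for z
  define A where "A z = fourier (\<lambda>x. G (x, fst z)) (snd z)" for z
  \<comment> \<open>\<open>\<kappa>\<close> is the inverse of \<open>C * (h / 2) ^ D\<close>, where
    \<open>C\<close> is left by the inversion in \<open>v\<close> and \<open>(h / 2) ^ D\<close> is
    the Jacobian of \<open>x = (h / 2) v\<close>. It is also the prefactor of the transform with
    parameter \<open>h / 2\<close>, so no constant remains.\<close>
  have Fe: "F z = \<kappa> * (c * of_real C * A ((2 / h) *\<^sub>R z))" for z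
  proof -
    have m: "(\<lambda>x. G (x, (2 / h) *\<^sub>R fst z) * exp (- \<i> * of_real (((2 / h) *\<^sub>R snd z) \<bullet> x))) \<in> borel_measurable borel"
      by (intro borel_measurable_times borel_measurable_exp_inner borel_measurable_comp_continuous[OF mG] continuous_intros)
    have "A ((2 / h) *\<^sub>R z) = (h / 2) ^ D *\<^sub>R (LINT v|lborel. G ((h / 2) *\<^sub>R v, (2 / h) *\<^sub>R fst z) *
        exp (- \<i> * of_real (((2 / h) *\<^sub>R snd z) \<bullet> ((h / 2) *\<^sub>R v))))"
      using integral_lborel_affine[OF _ m, of "h / 2" 0] h by (simp add: A_def fourier_def D_def)
    also have "(LINT v|lborel. G ((h / 2) *\<^sub>R v, (2 / h) *\<^sub>R fst z) *
        exp (- \<i> * of_real (((2 / h) *\<^sub>R snd z) \<bullet> ((h / 2) *\<^sub>R v))))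
        = fourier (\<lambda>v. G ((h / 2) *\<^sub>R v, (2 / h) *\<^sub>R fst z)) (snd z)"
      using h by (simp add: fourier_def)
    finally have "\<kappa> * (c * of_real C * A ((2 / h) *\<^sub>R z))
       = \<kappa> * of_real (C * (h / 2) ^ D) * F z"
      by (simp add: F_def scaleR_conv_of_real)
    also have "C * (h / 2) ^ D = (2 * pi * (h / 2)) ^ D" by (simp only: C_def power_mult_distrib)
    also have "\<kappa> * of_real ((2 * pi * (h / 2)) ^ D) = 1" using h by (simp add: \<kappa>_def)
    finally show ?thesis by simp
  qed
  have fsq: "square_integrable f"
    unfolding f_def by (intro square_integrable_cmult square_integrable_fourier_section[OF G G1])
  have mf: "f \<in> borel_measurable borel" using fsq by (simp add: square_integrable_def)
  have Asq: "square_integrable A"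
    unfolding A_def using square_integrable_fourier_section[OF square_integrable_swap(1)[OF G]] G2 by simp
  have Fsq: "square_integrable F"
    unfolding Fe[abs_def] using h by (intro square_integrable_cmult square_integrable_scaleR[OF Asq]) simp
  define \<phi> where "\<phi> R z = indicator (cball 0 R) z * f z" for R :: real and z
  have \<phi>i: "integrable lborel (\<phi> R)" for R
    unfolding \<phi>_def[abs_def] by (rule integrable_indicator_square_integrable[OF fsq]) (use emeasure_lborel_cball_finite in auto)
  have m\<phi>: "\<phi> R \<in> borel_measurable borel" for R
    using borel_measurable_integrable[OF \<phi>i] by simp
  define \<Psi> where "\<Psi> R z = (LINT \<xi>|lborel. \<phi> R (fst z, \<xi>) * exp (\<i> * of_real (\<xi> \<bullet> snd z)))" for R z
  have \<phi>ei: "integrable lborel (\<lambda>z. \<phi> R z * exp (\<i> * of_real (snd z \<bullet> y)))" for R y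
  proof (rule Bochner_Integration.integrable_bound[OF \<phi>i[of R]])
    have "(\<lambda>z :: (real ^ 'd) \<times> (real ^ 'd). exp (\<i> * complex_of_real (snd z \<bullet> y))) \<in> borel_measurable borel"
      by (intro borel_measurable_continuous_onI continuous_intros)
    then show "(\<lambda>z. \<phi> R z * exp (\<i> * of_real (snd z \<bullet> y))) \<in> borel_measurable lborel"
      using m\<phi>[of R] by simp
  qed (simp add: norm_mult)
  \<comment> \<open>For a fixed \<open>y\<close> the phase preserves integrability in the plane, so
    Fubini gives this for every \<open>y\<close> and not just for almost every one.\<close>
  have \<Psi>i: "integrable lborel (\<lambda>x. \<Psi> R (x, y))" for R y
  proof -
    have "integrable (lborel \<Otimes>\<^sub>M lborel) (\<lambda>z. \<phi> R z * exp (\<i> * of_real (snd z \<bullet> y)))"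
      using \<phi>ei[of R y] by (simp add: lborel_prod)
    from lborel_pair.integrable_fst'[OF this] show ?thesis by (simp add: \<Psi>_def)
  qed
  have m\<Psi>: "\<Psi> R \<in> borel_measurable borel" for R
  proof -
    have "(\<lambda>p :: ((real ^ 'd) \<times> (real ^ 'd)) \<times> (real ^ 'd). \<phi> R (fst (fst p), snd p) * exp (\<i> * complex_of_real (snd p \<bullet> snd (fst p)))) \<in> borel_measurable borel"
    proof (rule borel_measurable_times)
      show "(\<lambda>p :: ((real ^ 'd) \<times> (real ^ 'd)) \<times> (real ^ 'd). \<phi> R (fst (fst p), snd p)) \<in> borel_measurable borel"
        by (rule borel_measurable_comp_continuous[OF m\<phi>]) (intro continuous_intros)
      show "(\<lambda>p :: ((real ^ 'd) \<times> (real ^ 'd)) \<times> (real ^ 'd). exp (\<i> * complex_of_real (snd p \<bullet> snd (fst p)))) \<in> borel_measurable borel"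
        by (intro borel_measurable_continuous_onI continuous_intros)
    qed
    from borel_measurable_integral_snd[OF this] show ?thesis by (simp add: \<Psi>_def[abs_def])
  qed
  define M where "M R z = \<Psi> R z - c * of_real C * G z" for R z
  have mM: "M R \<in> borel_measurable borel" for R
    unfolding M_def[abs_def] using m\<Psi>[of R] mG by simp
  define tail where "tail R = (\<integral>\<^sup>+z. ennreal (indicator (- cball 0 R) z * (cmod (f z))\<^sup>2) \<partial>lborel)" for R :: real
  have mtail: "(\<lambda>z. ennreal (indicator (- cball 0 R) z * (cmod (f z))\<^sup>2)) \<in> borel_measurable borel" for R
    using mf by (intro measurable_compose[OF _ measurable_ennreal] borel_measurable_times
        borel_measurable_indicator borel_measurable_power) auto
  have Mn: "(\<integral>\<^sup>+z. ennreal ((cmod (M R z))\<^sup>2) \<partial>lborel) = ennreal C * tail R" for R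
  proof -
    have "(\<integral>\<^sup>+z. ennreal ((cmod (M R z))\<^sup>2) \<partial>lborel) = (\<integral>\<^sup>+x. \<integral>\<^sup>+y. ennreal ((cmod (M R (x, y)))\<^sup>2) \<partial>lborel \<partial>lborel)"
      by (rule nn_integral_lborel_pair(1)[OF ennreal_norm_measurable[OF mM]])
    also have "\<dots> = (\<integral>\<^sup>+x. ennreal C * (\<integral>\<^sup>+\<xi>. ennreal (indicator (- cball 0 R) (x, \<xi>) * (cmod (f (x, \<xi>)))\<^sup>2) \<partial>lborel) \<partial>lborel)"
    proof (rule nn_integral_cong_AE)
      show "AE x in lborel. (\<integral>\<^sup>+y. ennreal ((cmod (M R (x, y)))\<^sup>2) \<partial>lborel)
          = ennreal C * (\<integral>\<^sup>+\<xi>. ennreal (indicator (- cball 0 R) (x, \<xi>) * (cmod (f (x, \<xi>)))\<^sup>2) \<partial>lborel)"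
        using square_integrable_AE_section[OF G]
      proof eventually_elim
        case (elim x)
        \<comment> \<open>The section of the ball over \<open>x\<close>, possibly empty: a
          truncation in both variables is on each line a truncation in \<open>\<xi>\<close> to a set
          of finite measure.\<close>
        define B :: "(real ^ 'd) set" where "B = {\<xi>. (x, \<xi>) \<in> cball 0 R}"
        have cB: "closed B"
          unfolding B_def mem_cball dist_norm by (intro closed_Collect_le continuous_intros)
        then have B: "B \<in> sets borel" by simp
        have "B \<subseteq> cball 0 R"
        proof
          fix \<xi> assume "\<xi> \<in> B"
          then have "norm (x, \<xi>) \<le> R" by (simp add: B_def del: mem_cball add: mem_cball_0)
          then show "\<xi> \<in> cball 0 R" using norm_snd_le[of \<xi> x] by (simp add: mem_cball_0 del: mem_cball)
        qed
        then have fB: "emeasure lborel B < \<infinity>"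
          by (intro order_le_less_trans[OF emeasure_mono emeasure_lborel_cball_finite]) auto
        have ind: "indicator (cball 0 R) (x, \<xi>) = (indicator B \<xi> :: complex)"
          "indicator (- cball 0 R) (x, \<xi>) = (indicator (- B) \<xi> :: real)" for \<xi>
          by (simp_all add: B_def indicator_def)
        define g where "g v = c * G (x, v)" for v
        have gi: "integrable lborel g" unfolding g_def[abs_def] using G1 by (rule integrable_mult_right)
        have gsq: "square_integrable g" unfolding g_def[abs_def] using elim by (rule square_integrable_cmult)
        have gf: "fourier g \<xi> = f (x, \<xi>)" for \<xi>
          unfolding fourier_def g_def f_def fst_conv snd_conv mult.assoc by (rule integral_mult_right_zero)
        have "M R (x, y) = (LINT \<xi>|lborel. indicator B \<xi> * fourier g \<xi> * exp (\<i> * of_real (\<xi> \<bullet> y)))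
            - of_real C * g y" for y
          unfolding M_def \<Psi>_def \<phi>_def gf fst_conv snd_conv ind g_def by (simp only: mult_ac)
        then show ?case
          using truncated_fourier_inversion[OF gi gsq B fB] by (simp add: C_def D_def gf ind)
      qed
    qed
    also have "\<dots> = ennreal C * (\<integral>\<^sup>+x. \<integral>\<^sup>+\<xi>. ennreal (indicator (- cball 0 R) (x, \<xi>) * (cmod (f (x, \<xi>)))\<^sup>2) \<partial>lborel \<partial>lborel)"
      using borel_measurable_nn_integral_snd[OF mtail[of R]] by (intro nn_integral_cmult) simp
    also have "\<dots> = ennreal C * tail R"
      unfolding tail_def nn_integral_lborel_pair(1)[OF mtail[of R]] ..
    finally show ?thesis .
  qed
  have f_fin: "(\<integral>\<^sup>+z. ennreal ((cmod (f z))\<^sup>2) \<partial>lborel) < \<infinity>"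
    using fsq by (simp add: square_integrable_iff_nn_integral)
  have tail_fin: "tail R < \<infinity>" for R
    unfolding tail_def by (rule order_le_less_trans[OF nn_integral_mono f_fin]) (auto simp: indicator_def)
  have Msq: "square_integrable (M R)" for R
    using mM[of R] tail_fin[of R] by (simp add: square_integrable_iff_nn_integral Mn ennreal_mult_less_top)
  have Mi: "integrable lborel (\<lambda>x. M R (x, y))" for R y
    unfolding M_def using \<Psi>i G2 by (intro Bochner_Integration.integrable_diff integrable_mult_right)
  define T where "T R z = fourier (\<lambda>x. M R (x, fst z)) (snd z)" for R z
  have Tsq: "square_integrable (T R)" for R
    unfolding T_def[abs_def] using square_integrable_fourier_section[OF square_integrable_swap(1)[OF Msq]] Mi by simp
  have mT: "T R \<in> borel_measurable borel" for R
    using Tsq by (simp add: square_integrable_def)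
  \<comment> \<open>Swapping the variables lets Plancherel act in \<open>x\<close>: one factor
    \<open>C\<close> comes from it, the other from \<open>Mn\<close>.\<close>
  have Tn: "(\<integral>\<^sup>+z. ennreal ((cmod (T R z))\<^sup>2) \<partial>lborel) = ennreal C * (ennreal C * tail R)" for R
    using plancherel_section[OF square_integrable_swap(1)[OF Msq[of R]]] Mi[of R]
      square_integrable_swap(2)[OF Msq[of R]] Mn[of R]
    by (simp add: T_def C_def D_def)
  have diff: "symplectic_fourier_integral (h / 2) (\<lambda>w. indicator (cball 0 R) w * f w) z - F z
      = \<kappa> * T R ((2 / h) *\<^sub>R z)" for R z
  proof -
    obtain q p where z: "z = (q, p)" by (cases z)
    define y \<eta> where "y = (2 / h) *\<^sub>R q" and "\<eta> = (2 / h) *\<^sub>R p"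
    have e: "exp (\<i> * complex_of_real ((q \<bullet> \<xi> - p \<bullet> x) / (h / 2)))
        = exp (\<i> * of_real (\<xi> \<bullet> y)) * exp (- \<i> * of_real (\<eta> \<bullet> x))" for x \<xi>
      using h by (simp add: exp_add[symmetric] y_def \<eta>_def inner_commute[of _ q] field_simps)
    define H where "H w = \<phi> R w * exp (\<i> * of_real (snd w \<bullet> y)) * exp (- \<i> * of_real (\<eta> \<bullet> fst w))" for w
    have "integrable lborel H"
    proof (rule Bochner_Integration.integrable_bound[OF \<phi>ei[of R y]])
      have "(\<lambda>w :: (real ^ 'd) \<times> (real ^ 'd). exp (- \<i> * complex_of_real (\<eta> \<bullet> fst w))) \<in> borel_measurable borel"
        by (intro borel_measurable_continuous_onI continuous_intros)
      then show "H \<in> borel_measurable lborel"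
        unfolding H_def[abs_def] using borel_measurable_integrable[OF \<phi>ei[of R y]] by simp
    qed (simp add: H_def norm_mult)
    note Hp = integral_lborel_pair[OF this]
    have "symplectic_fourier_integral (h / 2) (\<lambda>w. indicator (cball 0 R) w * f w) z
        = \<kappa> * (LINT w|lborel. H w)"
      unfolding symplectic_fourier_integral_def z \<kappa>_def H_def \<phi>_def D_def split_beta fst_conv snd_conv
      by (simp only: e mult.assoc prod.collapse)
    also have "(LINT w|lborel. H w) = fourier (\<lambda>x. \<Psi> R (x, y)) \<eta>"
      unfolding Hp fourier_def by (simp add: H_def \<Psi>_def)
    also have "\<dots> = T R ((2 / h) *\<^sub>R z) + c * of_real C * A ((2 / h) *\<^sub>R z)"
    proof -
      have i1: "integrable lborel (\<lambda>x. \<Psi> R (x, y) * exp (- \<i> * of_real (\<eta> \<bullet> x)))"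
        by (rule integrable_mult_exp_inner(1)[OF \<Psi>i])
      have i2: "integrable lborel (\<lambda>x. c * of_real C * (G (x, y) * exp (- \<i> * of_real (\<eta> \<bullet> x))))"
        by (rule integrable_mult_right[OF integrable_mult_exp_inner(1)[OF G2]])
      have "T R ((2 / h) *\<^sub>R z) = (LINT x|lborel. \<Psi> R (x, y) * exp (- \<i> * of_real (\<eta> \<bullet> x))
          - c * of_real C * (G (x, y) * exp (- \<i> * of_real (\<eta> \<bullet> x))))"
        unfolding T_def fourier_def M_def z
        by (simp only: scaleR_Pair fst_conv snd_conv y_def[symmetric] \<eta>_def[symmetric] left_diff_distrib mult.assoc)
      also have "\<dots> = fourier (\<lambda>x. \<Psi> R (x, y)) \<eta>
          - (LINT x|lborel. c * of_real C * (G (x, y) * exp (- \<i> * of_real (\<eta> \<bullet> x))))"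
        unfolding fourier_def by (rule Bochner_Integration.integral_diff[OF i1 i2])
      also have "(LINT x|lborel. c * of_real C * (G (x, y) * exp (- \<i> * of_real (\<eta> \<bullet> x))))
          = c * of_real C * A ((2 / h) *\<^sub>R z)"
        unfolding A_def fourier_def z scaleR_Pair fst_conv snd_conv y_def[symmetric] \<eta>_def[symmetric]
        by (rule integral_mult_right_zero)
      finally show ?thesis by simp
    qed
    finally show ?thesis unfolding Fe by (simp add: algebra_simps)
  qed
  \<comment> \<open>Collects the prefactor, the Jacobian of the rescaling by \<open>2 / h\<close>
    and both factors \<open>C\<close>; only its finiteness matters.\<close>
  define B where "B = ennreal ((cmod \<kappa>)\<^sup>2) * (ennreal (inverse (\<bar>2 / h\<bar> ^ DIM((real ^ 'd) \<times> (real ^ 'd)))) * (ennreal C * ennreal C))"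
  have Bfin: "B < top" unfolding B_def by (simp add: ennreal_mult_less_top)
  have norm: "(\<integral>\<^sup>+z. ennreal ((cmod (symplectic_fourier_integral (h / 2) (\<lambda>w. indicator (cball 0 R) w * f w) z - F z))\<^sup>2) \<partial>lborel)
      = B * tail R" for R
  proof -
    have mT': "(\<lambda>z. T R ((2 / h) *\<^sub>R z)) \<in> borel_measurable borel"
      by (rule borel_measurable_comp_continuous[OF mT]) (intro continuous_intros)
    have "(\<integral>\<^sup>+z. ennreal ((cmod (symplectic_fourier_integral (h / 2) (\<lambda>w. indicator (cball 0 R) w * f w) z - F z))\<^sup>2) \<partial>lborel)
      = (\<integral>\<^sup>+z. ennreal ((cmod \<kappa>)\<^sup>2) * ennreal ((cmod (T R ((2 / h) *\<^sub>R z)))\<^sup>2) \<partial>lborel)"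
      unfolding diff norm_mult power_mult_distrib by (simp add: ennreal_mult)
    also have "\<dots> = ennreal ((cmod \<kappa>)\<^sup>2) * (\<integral>\<^sup>+z. ennreal ((cmod (T R ((2 / h) *\<^sub>R z)))\<^sup>2) \<partial>lborel)"
      using ennreal_norm_measurable[OF mT'] by (intro nn_integral_cmult) simp
    also have "(\<integral>\<^sup>+z. ennreal ((cmod (T R ((2 / h) *\<^sub>R z)))\<^sup>2) \<partial>lborel)
        = ennreal (inverse (\<bar>2 / h\<bar> ^ DIM((real ^ 'd) \<times> (real ^ 'd)))) * (ennreal C * (ennreal C * tail R))"
      unfolding Tn[symmetric] using h by (intro nn_integral_square_scaleR[OF mT]) simp
    finally show ?thesis unfolding B_def by (simp only: mult.assoc)
  qed
  have "(tail \<longlongrightarrow> 0) at_top"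
  \<comment> \<open>The radius is a real variable; passing to sequences permits dominated
    convergence.\<close>
  proof (rule tendsto_at_topI_sequentially)
    fix X :: "nat \<Rightarrow> real" assume X: "filterlim X at_top sequentially"
    have "(\<lambda>n. tail (X n)) \<longlonglongrightarrow> (\<integral>\<^sup>+z. 0 \<partial>(lborel :: ((real ^ 'd) \<times> (real ^ 'd)) measure))"
      unfolding tail_def
    proof (rule nn_integral_dominated_convergence[where w = "\<lambda>z. ennreal ((cmod (f z))\<^sup>2)"])
      show "(\<lambda>z. ennreal ((cmod (f z))\<^sup>2)) \<in> borel_measurable lborel"
        using ennreal_norm_measurable[OF mf] by simp
      show "(\<lambda>z. ennreal (indicator (- cball 0 (X n)) z * (cmod (f z))\<^sup>2)) \<in> borel_measurable lborel" for n
        using mtail[of "X n"] by simp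
      show "AE z in lborel. (\<lambda>n. ennreal (indicator (- cball 0 (X n)) z * (cmod (f z))\<^sup>2)) \<longlonglongrightarrow> 0"
      proof (intro AE_I2 tendsto_eventually)
        fix z :: "(real ^ 'd) \<times> (real ^ 'd)"
        have "eventually (\<lambda>n. norm z \<le> X n) sequentially"
          using X by (simp add: filterlim_at_top)
        then show "eventually (\<lambda>n. ennreal (indicator (- cball 0 (X n)) z * (cmod (f z))\<^sup>2) = 0) sequentially"
          by eventually_elim (simp add: indicator_def)
      qed
    qed (use f_fin in \<open>auto simp: indicator_def\<close>)
    then show "(\<lambda>n. tail (X n)) \<longlonglongrightarrow> 0" by simp
  qed
  then have "((\<lambda>R. B * tail R) \<longlongrightarrow> B * 0) at_top"
    by (rule ennreal_tendsto_cmult[OF Bfin])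
  then have "has_symplectic_fourier (h / 2) f F"
    unfolding has_symplectic_fourier_def norm using fsq Fsq by simp
  then show ?thesis
    by (simp add: f_def[abs_def] F_def[abs_def] case_prod_unfold)
qed

section \<open>Cholesky factorization of positive infinite matrices\<close>

text \<open>Only finite sections are tested, but with complex coefficients, and the form is required
  to be real: this is what forces hermitian symmetry.\<close>

definition positive_matrix :: "(nat \<Rightarrow> nat \<Rightarrow> complex) \<Rightarrow> bool" where
  "positive_matrix A \<longleftrightarrow> (\<forall>n c. (\<Sum>k<n. \<Sum>l<n. cnj (c k) * c l * A k l) \<in> \<real>\<^sub>\<ge>\<^sub>0)"

lemma sum_at_two_points:
  fixes F :: "nat \<Rightarrow> complex"
  assumes "k \<noteq> l" "k < n" "l < n" "\<And>j. j \<noteq> k \<Longrightarrow> j \<noteq> l \<Longrightarrow> F j = 0"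
  shows "(\<Sum>j<n. F j) = F k + F l"
proof -
  have "(\<Sum>j<n. F j) = (\<Sum>j\<in>{k, l}. F j)"
    by (rule sum.mono_neutral_right) (use assms in auto)
  then show ?thesis using assms(1) by simp
qed

lemma positive_matrix_two_points:
  assumes A: "positive_matrix A" and kl: "k \<noteq> l"
  shows "cnj u * u * A k k + cnj v * v * A l l + cnj u * v * A k l + cnj v * u * A l k \<in> \<real>\<^sub>\<ge>\<^sub>0"
proof -
  define c where "c j = (if j = k then u else if j = l then v else 0)" for j
  define n where "n = Suc (max k l)"
  have n: "k < n" "l < n" by (simp_all add: n_def)
  have inner: "(\<Sum>m<n. cnj (c j) * c m * A j m) = cnj (c j) * u * A j k + cnj (c j) * v * A j l" for j
    by (subst sum_at_two_points[OF kl n]) (use kl in \<open>auto simp: c_def\<close>)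
  have "(\<Sum>j<n. \<Sum>m<n. cnj (c j) * c m * A j m)
      = (cnj u * u * A k k + cnj u * v * A k l) + (cnj v * u * A l k + cnj v * v * A l l)"
    unfolding inner by (subst sum_at_two_points[OF kl n]) (use kl in \<open>auto simp: c_def\<close>)
  moreover have "(\<Sum>j<n. \<Sum>m<n. cnj (c j) * c m * A j m) \<in> \<real>\<^sub>\<ge>\<^sub>0"
    using A unfolding positive_matrix_def by blast
  ultimately show ?thesis by (simp add: algebra_simps)
qed

lemma positive_matrix_diag:
  assumes "positive_matrix A"
  shows "A k k \<in> \<real>\<^sub>\<ge>\<^sub>0"
  using positive_matrix_two_points[OF assms, of k "Suc k" 1 0] by simp

lemma positive_matrix_diag_real:
  assumes "positive_matrix A"
  shows "A k k = of_real (Re (A k k))" "Re (A k k) \<ge> 0"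
  using positive_matrix_diag[OF assms, of k] by (auto simp: complex_nonneg_Reals_iff complex_eq_iff)

text \<open>Off the diagonal the form is real at the test vectors \<open>(1, 1)\<close> and
  \<open>(1, \<i>)\<close>; the two vanishing imaginary parts determine both parts of
  \<open>A l k\<close>.\<close>

lemma positive_matrix_hermitian:
  assumes A: "positive_matrix A"
  shows "A l k = cnj (A k l)"
proof (cases "k = l")
  case True
  then show ?thesis using positive_matrix_diag[OF A, of k] by (auto simp: complex_nonneg_Reals_iff complex_eq_iff)
next
  case False
  have "Im (A k k) = 0" "Im (A l l) = 0"
    using positive_matrix_diag[OF A, of k] positive_matrix_diag[OF A, of l] by (auto simp: complex_nonneg_Reals_iff)
  moreover have "Im (A k k + A l l + A k l + A l k) = 0"
    using positive_matrix_two_points[OF A False, of 1 1] by (simp add: complex_nonneg_Reals_iff)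
  moreover have "Im (A k k + A l l + \<i> * A k l + - \<i> * A l k) = 0"
    using positive_matrix_two_points[OF A False, of 1 \<i>] by (simp add: complex_nonneg_Reals_iff)
  ultimately show ?thesis by (simp add: complex_eq_iff)
qed

text \<open>With a zero at \<open>(m, m)\<close> the form on the span of \<open>k\<close> and
  \<open>m\<close> has no quadratic term in the coefficient at \<open>m\<close>, so a nonzero
  \<open>A k m\<close> would drive it to negative values.\<close>

lemma positive_matrix_zero_diag:
  assumes A: "positive_matrix A" and 0: "A m m = 0"
  shows "A k m = 0"
proof (rule ccontr)
  assume nz: "A k m \<noteq> 0"
  then have km: "k \<noteq> m" using 0 by auto
  define a where "a = Re (A k k)"
  define z where "z = A k m"
  have zz: "A m k = cnj z" using positive_matrix_hermitian[OF A, of m k] by (simp add: z_def)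
  have Akk: "A k k = of_real a" and a0: "a \<ge> 0"
    using positive_matrix_diag_real[OF A, of k] by (auto simp: a_def)
  \<comment> \<open>Chosen to give the form the value \<open>a - 2 * (a + 1)\<close>, which is
    negative.\<close>
  define t where "t = (a + 1) / (cmod z)\<^sup>2"
  have z2: "(cmod z)\<^sup>2 > 0" using nz by (simp add: z_def)
  have "cnj 1 * 1 * A k k + cnj (- of_real t * cnj z) * (- of_real t * cnj z) * A m m
      + cnj 1 * (- of_real t * cnj z) * A k m + cnj (- of_real t * cnj z) * 1 * A m k \<in> \<real>\<^sub>\<ge>\<^sub>0"
    by (rule positive_matrix_two_points[OF A km])
  then have "of_real a - 2 * of_real t * (z * cnj z) \<in> \<real>\<^sub>\<ge>\<^sub>0"
    by (simp add: 0 Akk zz z_def[symmetric] algebra_simps)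
  also have "of_real a - 2 * of_real t * (z * cnj z) = complex_of_real (a - 2 * t * (cmod z)\<^sup>2)"
    by (simp only: complex_norm_square[symmetric] of_real_mult of_real_diff of_real_numeral)
  finally have "a - 2 * t * (cmod z)\<^sup>2 \<ge> 0" by (simp only: nonneg_Reals_of_real_iff)
  then show False using z2 a0 by (simp add: t_def)
qed

text \<open>For a vanishing pivot \<open>A m m\<close> the division gives zero, and the step does nothing; then the row
  and the column of the pivot are already zero.\<close>

definition schur_step :: "nat \<Rightarrow> (nat \<Rightarrow> nat \<Rightarrow> complex) \<Rightarrow> nat \<Rightarrow> nat \<Rightarrow> complex" where
  "schur_step m A k l = A k l - A k m * A m l / A m m"

text \<open>Completing the square: the form of the Schur complement at \<open>b\<close> is the form
  of \<open>A\<close> at \<open>b\<close> with its entry at \<open>m\<close> shifted to the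
  minimizer, hence nonnegative.\<close>

lemma positive_matrix_schur_step:
  assumes A: "positive_matrix A"
  shows "positive_matrix (schur_step m A)"
  unfolding positive_matrix_def
proof (intro allI)
  fix n and c :: "nat \<Rightarrow> complex"
  define Q where "Q n c A = (\<Sum>k<n. \<Sum>l<n. cnj (c k) * c l * A k l)" for n c and A :: "nat \<Rightarrow> nat \<Rightarrow> complex"
  have "Q n c (schur_step m A) \<in> \<real>\<^sub>\<ge>\<^sub>0"
  proof (cases "A m m = 0")
    case True
    then have "schur_step m A = A" by (intro ext) (simp add: schur_step_def)
    then show ?thesis using A by (simp add: positive_matrix_def Q_def)
  next
    case False
    \<comment> \<open>The pivot index \<open>m\<close> may lie beyond the range of \<open>c\<close>,
      so \<open>c\<close> is padded with zeros.\<close>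
    define n' where "n' = max n (Suc m)"
    define b where "b k = (if k < n then c k else 0)" for k
    have mn: "m < n'" "n \<le> n'" by (simp_all add: n'_def)
    have Qb: "Q n c B = Q n' b B" for B
    proof -
      have "(\<Sum>k<n. \<Sum>l<n. cnj (c k) * c l * B k l) = (\<Sum>k<n. \<Sum>l<n'. cnj (b k) * b l * B k l)"
        by (intro sum.cong refl sum.mono_neutral_cong_left) (use mn in \<open>auto simp: b_def\<close>)
      also have "\<dots> = (\<Sum>k<n'. \<Sum>l<n'. cnj (b k) * b l * B k l)"
        by (intro sum.mono_neutral_left) (use mn in \<open>auto simp: b_def\<close>)
      finally show ?thesis by (simp add: Q_def)
    qed
    define s where "s = (\<Sum>l<n'. b l * A m l)"
    have s': "cnj s = (\<Sum>k<n'. cnj (b k) * A k m)"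
      unfolding s_def cnj_sum by (intro sum.cong refl) (simp add: positive_matrix_hermitian[OF A, of m])
    \<comment> \<open>The minimizer of the form in the direction of the pivot.\<close>
    define t where "t = - s / A m m"
    have Ar: "cnj (A m m) = A m m" using positive_matrix_hermitian[OF A, of m m] by simp
    define b' where "b' k = b k + (if k = m then t else 0)" for k
    have "Q n' b' A = Q n' b A + cnj t * s + t * cnj s + cnj t * t * A m m"
    proof -
      have e: "cnj (b' k) * b' l * A k l = cnj (b k) * b l * A k l + (if k = m then cnj t * (b l * A k l) else 0)
          + (if l = m then t * (cnj (b k) * A k l) else 0) + (if k = m then (if l = m then cnj t * t * A k l else 0) else 0)" for k l
        by (simp add: b'_def algebra_simps)
      have "Q n' b' A = Q n' b A + (\<Sum>k<n'. \<Sum>l<n'. if k = m then cnj t * (b l * A k l) else 0)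
          + (\<Sum>k<n'. \<Sum>l<n'. if l = m then t * (cnj (b k) * A k l) else 0)
          + (\<Sum>k<n'. \<Sum>l<n'. if k = m then (if l = m then cnj t * t * A k l else 0) else 0)"
        unfolding Q_def e sum.distrib ..
      also have "(\<Sum>k<n'. \<Sum>l<n'. if k = m then cnj t * (b l * A k l) else 0) = (\<Sum>k<n'. if k = m then cnj t * s else 0)"
        by (intro sum.cong refl) (simp add: s_def sum_distrib_left)
      also have "\<dots> = cnj t * s" using mn by simp
      also have "(\<Sum>k<n'. \<Sum>l<n'. if l = m then t * (cnj (b k) * A k l) else 0) = t * cnj s"
        using mn by (simp add: s' sum_distrib_left)
      also have "(\<Sum>k<n'. \<Sum>l<n'. if k = m then (if l = m then cnj t * t * A k l else 0) else 0) = (\<Sum>k<n'. if k = m then cnj t * t * A m m else 0)"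
        using mn by (intro sum.cong refl) simp
      also have "\<dots> = cnj t * t * A m m" using mn by simp
      finally show ?thesis .
    qed
    also have "\<dots> = Q n' b A - cnj s * s / A m m"
      using False Ar by (simp add: t_def field_simps)
    also have "\<dots> = Q n' b (schur_step m A)"
    proof -
      have "Q n' b (schur_step m A) = Q n' b A - (\<Sum>k<n'. \<Sum>l<n'. (cnj (b k) * A k m) * (b l * A m l / A m m))"
        unfolding Q_def schur_step_def sum_subtractf[symmetric]
        by (intro sum.cong refl) (simp add: algebra_simps)
      also have "(\<Sum>k<n'. \<Sum>l<n'. (cnj (b k) * A k m) * (b l * A m l / A m m)) = cnj s * s / A m m"
        unfolding s' unfolding s_def sum_product[symmetric] sum_divide_distrib[symmetric] by simp
      finally show ?thesis by simp
    qed
    finally have "Q n' b (schur_step m A) = Q n' b' A" by simp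
    moreover have "Q n' b' A \<in> \<real>\<^sub>\<ge>\<^sub>0" using A by (simp add: positive_matrix_def Q_def)
    ultimately show ?thesis unfolding Qb by simp
  qed
  then show "(\<Sum>k<n. \<Sum>l<n. cnj (c k) * c l * schur_step m A k l) \<in> \<real>\<^sub>\<ge>\<^sub>0" by (simp add: Q_def)
qed

primrec schur_complement :: "(nat \<Rightarrow> nat \<Rightarrow> complex) \<Rightarrow> nat \<Rightarrow> nat \<Rightarrow> nat \<Rightarrow> complex" where
  "schur_complement A 0 = A"
| "schur_complement A (Suc m) = schur_step m (schur_complement A m)"

lemma positive_schur_complement: "positive_matrix A \<Longrightarrow> positive_matrix (schur_complement A m)"
  by (induction m) (simp_all add: positive_matrix_schur_step)

text \<open>Row \<open>m\<close> is cleared in step \<open>m\<close>, and a row that is already zero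
  stays zero because the subtracted term contains its entry at \<open>m\<close> as a factor. A
  vanishing pivot clears nothing, but then positivity has already made its row zero.\<close>

lemma schur_complement_eq_0:
  assumes A: "positive_matrix A" and "k < m"
  shows "schur_complement A m k l = 0"
  using assms(2)
proof (induction m arbitrary: l)
  case (Suc m)
  let ?C = "schur_complement A m"
  have C: "positive_matrix ?C" by (rule positive_schur_complement[OF A])
  show ?case
  proof (cases "k = m")
    case False
    with Suc have "?C k l = 0" "?C k m = 0" by auto
    then show ?thesis by (simp add: schur_step_def)
  next
    case True
    show ?thesis
    proof (cases "?C m m = 0")
      case True': True
      have "?C m l = 0"
        using positive_matrix_zero_diag[OF C True', of l] positive_matrix_hermitian[OF C, of m l] by simp
      then show ?thesis using True by (simp add: schur_step_def)
    qed (use True in \<open>simp add: schur_step_def\<close>)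
  qed
qed simp

text \<open>Each elimination step splits off the rank one matrix \<open>B m k * cnj (B m l)\<close>,
  and the sum telescopes. After \<open>n\<close> steps the columns of the remainder with index below
  \<open>n\<close> vanish, so the identity is exact for \<open>l < n\<close> and involves no
  limit.\<close>

theorem cholesky:
  assumes A: "positive_matrix A"
  obtains B :: "nat \<Rightarrow> nat \<Rightarrow> complex" where
    "\<And>m l. l < m \<Longrightarrow> B m l = 0"
    "\<And>k l n. l < n \<Longrightarrow> A k l = (\<Sum>m<n. B m k * cnj (B m l))"
proof -
  define C where "C = schur_complement A"
  \<comment> \<open>Column \<open>m\<close> of the remainder over the root of its pivot. A zero
    pivot gives \<open>B m k = 0\<close>, in accordance with \<open>schur_step\<close>, whose
    subtracted term is then zero too.\<close>
  define B where "B m k = C m k m / of_real (sqrt (Re (C m m m)))" for m k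
  have C: "positive_matrix (C m)" for m unfolding C_def by (rule positive_schur_complement[OF A])
  have herm: "C m l k = cnj (C m k l)" for m k l by (rule positive_matrix_hermitian[OF C])
  have z: "C m k l = 0" if "k < m" for m k l
    unfolding C_def by (rule schur_complement_eq_0[OF A that])
  have z': "C m k l = 0" if "l < m" for m k l
    using z[OF that, of k] herm[of m k l] by simp
  have step: "C m k l = B m k * cnj (B m l) + C (Suc m) k l" for m k l
  proof -
    have "complex_of_real (sqrt (Re (C m m m))) * of_real (sqrt (Re (C m m m))) = C m m m"
      using positive_matrix_diag_real[OF C, of m m]
      by (metis of_real_mult real_sqrt_mult_self abs_of_nonneg)
    then have "B m k * cnj (B m l) = C m k m * C m m l / C m m m"
      using herm[of m m l] by (simp add: B_def)
    then show ?thesis by (simp add: C_def schur_step_def)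
  qed
  have sum: "A k l = (\<Sum>m<n. B m k * cnj (B m l)) + C n k l" for n k l
  proof (induction n)
    case (Suc n)
    then show ?case using step[of n k l] by simp
  qed (simp add: C_def)
  show ?thesis
  proof (rule that[of B])
    show "B m l = 0" if "l < m" for m l using z[OF that] by (simp add: B_def)
    show "A k l = (\<Sum>m<n. B m k * cnj (B m l))" if "l < n" for k l n
      using sum[of k l n] z'[OF that] by simp
  qed
qed

section \<open>Kernels of density matrices\<close>

lemma L2_inner_sum_right:
  assumes "finite A" "square_integrable f" "\<And>k. k \<in> A \<Longrightarrow> square_integrable (g k)"
  shows "L2_inner f (\<lambda>x. \<Sum>k\<in>A. c k * g k x) = (\<Sum>k\<in>A. c k * L2_inner f (g k))"
proof -
  have "L2_inner f (\<lambda>x. \<Sum>k\<in>A. c k * g k x) = (LINT x|lborel. (\<Sum>k\<in>A. c k * (cnj (f x) * g k x)))"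
    by (simp add: L2_inner_def sum_distrib_left mult_ac)
  also have "\<dots> = (\<Sum>k\<in>A. LINT x|lborel. c k * (cnj (f x) * g k x))"
    using assms by (intro Bochner_Integration.integral_sum integrable_mult_right integrable_cnj_mult_square_integrable)
  finally show ?thesis by (simp add: L2_inner_def)
qed

lemma L2_inner_cnj: "cnj (L2_inner f g) = L2_inner g f"
  unfolding L2_inner_def by (subst Bochner_Integration.integral_cnj[symmetric]) (simp add: mult.commute)

lemma L2_inner_sum_left:
  assumes "finite A" "square_integrable f" "\<And>k. k \<in> A \<Longrightarrow> square_integrable (g k)"
  shows "L2_inner (\<lambda>x. \<Sum>k\<in>A. c k * g k x) f = (\<Sum>k\<in>A. cnj (c k) * L2_inner (g k) f)"
  using arg_cong[OF L2_inner_sum_right[OF assms, where c = c], where f = cnj] by (simp add: L2_inner_cnj)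

lemma L2_inner_self: "L2_inner f f = of_real (LINT x|lborel. (cmod (f x))\<^sup>2)"
  unfolding L2_inner_def integral_complex_of_real[symmetric] complex_norm_square
  by (simp add: mult.commute)

lemma square_integrable_lincomb:
  "(\<And>k. k \<in> A \<Longrightarrow> square_integrable (g k)) \<Longrightarrow> square_integrable (\<lambda>x. \<Sum>k\<in>A. c k * g k x)"
  by (intro square_integrable_sum square_integrable_cmult)

lemma norm_orthonormal_sum:
  assumes e: "\<And>k. square_integrable (e k)" and o: "\<And>k l. L2_inner (e k) (e l) = (if k = l then 1 else 0)"
    and A: "finite A"
  shows "(LINT x|lborel. (cmod (\<Sum>k\<in>A. c k * e k x))\<^sup>2) = (\<Sum>k\<in>A. (cmod (c k))\<^sup>2)"
proof -
  have "complex_of_real (LINT x|lborel. (cmod (\<Sum>k\<in>A. c k * e k x))\<^sup>2)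
      = L2_inner (\<lambda>x. \<Sum>k\<in>A. c k * e k x) (\<lambda>x. \<Sum>k\<in>A. c k * e k x)"
    by (rule L2_inner_self[symmetric])
  also have "\<dots> = (\<Sum>k\<in>A. cnj (c k) * L2_inner (e k) (\<lambda>x. \<Sum>k\<in>A. c k * e k x))"
    using A e by (intro L2_inner_sum_left square_integrable_lincomb)
  also have "\<dots> = (\<Sum>k\<in>A. cnj (c k) * (\<Sum>l\<in>A. c l * L2_inner (e k) (e l)))"
    using A e by (intro sum.cong refl arg_cong2[where f = "(*)"] L2_inner_sum_right)
  also have "\<dots> = (\<Sum>k\<in>A. cnj (c k) * c k)"
    using A by (intro sum.cong refl) (simp add: o if_distrib cong: if_cong)
  also have "\<dots> = of_real (\<Sum>k\<in>A. (cmod (c k))\<^sup>2)"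
    unfolding of_real_sum complex_norm_square by (simp only: mult.commute)
  finally show ?thesis by (simp only: of_real_eq_iff)
qed

lemma L2_inner_Cauchy_Schwarz:
  assumes f: "square_integrable f" and g: "square_integrable g"
  shows "(cmod (L2_inner f g))\<^sup>2 \<le> (LINT x|lborel. (cmod (f x))\<^sup>2) * (LINT x|lborel. (cmod (g x))\<^sup>2)"
proof -
  have [measurable]: "f \<in> borel_measurable borel" "g \<in> borel_measurable borel"
    using f g by (auto simp: square_integrable_def)
  have fg: "integrable lborel (\<lambda>x. cmod (f x) * cmod (g x))"
    using integrable_norm[OF integrable_cnj_mult_square_integrable[OF f g]] by (simp add: norm_mult)
  have "cmod (L2_inner f g) \<le> (LINT x|lborel. cmod (f x) * cmod (g x))"
    unfolding L2_inner_def using integral_norm_bound[of lborel "\<lambda>x. cnj (f x) * g x"] by (simp add: norm_mult)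
  then have "(cmod (L2_inner f g))\<^sup>2 \<le> (LINT x|lborel. cmod (f x) * cmod (g x))\<^sup>2"
    by (intro power_mono) auto
  then have "ennreal ((cmod (L2_inner f g))\<^sup>2) \<le> ennreal ((LINT x|lborel. cmod (f x) * cmod (g x))\<^sup>2)"
    by (rule ennreal_leI)
  also have "\<dots> = (\<integral>\<^sup>+x. ennreal (cmod (f x)) * ennreal (cmod (g x)) \<partial>lborel)\<^sup>2"
    using nn_integral_eq_integral[OF fg] by (simp add: ennreal_mult ennreal_power)
  also have "\<dots> \<le> (\<integral>\<^sup>+x. ennreal (cmod (f x)) ^ 2 \<partial>lborel) * (\<integral>\<^sup>+x. ennreal (cmod (g x)) ^ 2 \<partial>lborel)"
    by (rule Cauchy_Schwarz_nn_integral) simp_all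
  also have "\<dots> = ennreal (LINT x|lborel. (cmod (f x))\<^sup>2) * ennreal (LINT x|lborel. (cmod (g x))\<^sup>2)"
    using nn_integral_square_integrable[OF f] nn_integral_square_integrable[OF g] by (simp add: ennreal_power)
  also have "\<dots> = ennreal ((LINT x|lborel. (cmod (f x))\<^sup>2) * (LINT x|lborel. (cmod (g x))\<^sup>2))"
    by (intro ennreal_mult[symmetric]) simp_all
  finally show ?thesis by (subst (asm) ennreal_le_iff) simp_all
qed

section \<open>The Riesz-Fischer theorem by a rapidly converging subsequence\<close>

lemma fast_subsequence_converges:
  fixes s :: "nat \<Rightarrow> complex"
  assumes "(\<Sum>j. ennreal (2 ^ j * (cmod (s (Suc j) - s j))\<^sup>2)) \<noteq> top"
  shows "convergent s"
proof -
  have "summable (\<lambda>j. 2 ^ j * (cmod (s (Suc j) - s j))\<^sup>2)"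
    by (rule summable_suminf_not_top[OF _ assms]) simp
  then have "summable (\<lambda>j. ((1 / 2) ^ j + 2 ^ j * (cmod (s (Suc j) - s j))\<^sup>2) / 2)"
    by (intro summable_divide summable_add summable_geometric) simp_all
  \<comment> \<open>Arithmetic-geometric mean with weight \<open>2 ^ j\<close>: the square is traded
    for a first power at the price of a geometric series.\<close>
  moreover have "norm (s (Suc j) - s j) \<le> ((1 / 2) ^ j + 2 ^ j * (cmod (s (Suc j) - s j))\<^sup>2) / 2" for j
  proof -
    define d where "d = cmod (s (Suc j) - s j)"
    have "2 ^ j * d \<le> (1\<^sup>2 + (2 ^ j * d)\<^sup>2) / 2"
      using product_le_mean_squares[of 1 "2 ^ j * d"] by simp
    then have "2 ^ j * d \<le> 2 ^ j * (((1 / 2) ^ j + 2 ^ j * d\<^sup>2) / 2)"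
      by (simp add: power_mult_distrib power2_eq_square distrib_left power_one_over mult_ac)
    then show ?thesis unfolding d_def by simp
  qed
  ultimately have "summable (\<lambda>j. s (Suc j) - s j)"
    by (rule summable_comparison_test'[where N = 0])
  then have "convergent (\<lambda>n. \<Sum>j<n. s (Suc j) - s j)"
    by (simp add: summable_iff_convergent)
  then have "convergent (\<lambda>n. s n - s 0)"
    by (simp add: sum_lessThan_telescope)
  then show ?thesis
    using convergent_add[of "\<lambda>n. s n - s 0" "\<lambda>_. s 0"] convergent_const[of "s 0"] by simp
qed

text \<open>The partial sums are Cauchy in L2, and a subsequence with geometrically small tails
  converges almost everywhere. Fatou's lemma transfers the norm bound and the L2 distances to the
  pointwise limit.\<close>

lemma riesz_fischer:
  fixes e :: "nat \<Rightarrow> 'a::euclidean_space \<Rightarrow> complex"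
  assumes e: "\<And>k. square_integrable (e k)" and o: "\<And>k l. L2_inner (e k) (e l) = (if k = l then 1 else 0)"
    and c: "summable (\<lambda>k. (cmod (c k))\<^sup>2)"
  shows "\<exists>b. square_integrable b \<and> (\<forall>k. L2_inner (e k) b = c k) \<and>
    (\<integral>\<^sup>+x. ennreal ((cmod (b x))\<^sup>2) \<partial>lborel) \<le> ennreal (\<Sum>k. (cmod (c k))\<^sup>2)"
proof -
  define T where "T = (\<Sum>k. (cmod (c k))\<^sup>2)"
  define t where "t n = T - (\<Sum>k<n. (cmod (c k))\<^sup>2)" for n
  have t0: "t n \<ge> 0" for n
    unfolding t_def T_def using sum_le_suminf[OF c, of "{..<n}"] by simp
  have tanti: "t n \<le> t m" if "m \<le> n" for m n
    unfolding t_def using that by (simp add: sum_mono2)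
  have "t \<longlonglongrightarrow> T - T"
    unfolding t_def[abs_def] T_def by (intro tendsto_diff tendsto_const summable_LIMSEQ c)
  then have tlim: "t \<longlonglongrightarrow> 0" by simp
  \<comment> \<open>The rate \<open>(1 / 4) ^ j\<close> still leaves \<open>(1 / 2) ^ j\<close>
    after multiplication by the weight \<open>2 ^ j\<close> of
    \<open>fast_subsequence_converges\<close>.\<close>
  have "\<exists>N. t N < (1 / 4) ^ j" for j :: nat
    using LIMSEQ_D[OF tlim, of "(1 / 4) ^ j"] t0 by fastforce
  then obtain N where N: "\<And>j. t (N j) < (1 / 4) ^ j" by metis
  \<comment> \<open>Summation makes the indices monotone and at least \<open>N j\<close>; the extra
    \<open>j\<close> makes them unbounded.\<close>
  define r where "r j = (\<Sum>i\<le>j. N i) + j" for j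
  have rmono: "r i \<le> r j" if "i \<le> j" for i j
    unfolding r_def using that by (intro add_mono sum_mono2) auto
  have rj: "j \<le> r j" for j by (simp add: r_def)
  have tr: "t (r j) \<le> (1 / 4) ^ j" for j
  proof -
    have "N j \<le> (\<Sum>i\<le>j. N i)" by (rule member_le_sum) auto
    then have "N j \<le> r j" by (simp add: r_def)
    from tanti[OF this] N[of j] show ?thesis by simp
  qed
  define S where "S n x = (\<Sum>k<n. c k * e k x)" for n x
  have Ssq: "square_integrable (S n)" for n
    unfolding S_def[abs_def] using e by (intro square_integrable_lincomb)
  have mS[measurable]: "S n \<in> borel_measurable borel" for n
    using Ssq by (simp add: square_integrable_def)
  have Sn: "(\<integral>\<^sup>+x. ennreal ((cmod (S n x))\<^sup>2) \<partial>lborel) \<le> ennreal T" for n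
    unfolding nn_integral_square_integrable[OF Ssq] unfolding S_def T_def
    using norm_orthonormal_sum[OF e o, of "{..<n}" c] sum_le_suminf[OF c, of "{..<n}"] by (simp add: ennreal_leI)
  have Sd: "(\<integral>\<^sup>+x. ennreal ((cmod (S n x - S m x))\<^sup>2) \<partial>lborel) \<le> ennreal (t m)" if "m \<le> n" for m n
  proof -
    have eq: "S n x - S m x = (\<Sum>k\<in>{m..<n}. c k * e k x)" for x
      unfolding S_def using that by (simp add: atLeast0LessThan[symmetric] sum_diff_nat_ivl)
    have "(\<integral>\<^sup>+x. ennreal ((cmod (S n x - S m x))\<^sup>2) \<partial>lborel) = ennreal (LINT x|lborel. (cmod (S n x - S m x))\<^sup>2)"
      by (rule nn_integral_square_integrable[OF square_integrable_diff[OF Ssq Ssq]])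
    also have "(LINT x|lborel. (cmod (S n x - S m x))\<^sup>2) = (\<Sum>k\<in>{m..<n}. (cmod (c k))\<^sup>2)"
      unfolding eq by (rule norm_orthonormal_sum[OF e o]) simp
    also have "\<dots> = (\<Sum>k<n. (cmod (c k))\<^sup>2) - (\<Sum>k<m. (cmod (c k))\<^sup>2)"
      using that by (simp add: atLeast0LessThan[symmetric] sum_diff_nat_ivl)
    also have "\<dots> \<le> t m"
      unfolding t_def T_def using sum_le_suminf[OF c, of "{..<n}"] by simp
    finally show ?thesis by (simp add: ennreal_leI)
  qed
  have conv: "AE x in lborel. convergent (\<lambda>j. S (r j) x)"
  proof -
    have "(\<integral>\<^sup>+x. (\<Sum>j. ennreal (2 ^ j * (cmod (S (r (Suc j)) x - S (r j) x))\<^sup>2)) \<partial>lborel)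
        = (\<Sum>j. \<integral>\<^sup>+x. ennreal (2 ^ j * (cmod (S (r (Suc j)) x - S (r j) x))\<^sup>2) \<partial>lborel)"
      by (rule nn_integral_suminf) simp
    also have "\<dots> \<le> (\<Sum>j. ennreal ((1 / 2) ^ j))"
    proof (intro suminf_le)
      fix j
      have "(\<integral>\<^sup>+x. ennreal (2 ^ j * (cmod (S (r (Suc j)) x - S (r j) x))\<^sup>2) \<partial>lborel)
          = ennreal (2 ^ j) * (\<integral>\<^sup>+x. ennreal ((cmod (S (r (Suc j)) x - S (r j) x))\<^sup>2) \<partial>lborel)"
        by (subst nn_integral_cmult[symmetric]) (simp_all add: ennreal_mult)
      also have "\<dots> \<le> ennreal (2 ^ j) * ennreal (t (r j))"
        by (intro mult_left_mono Sd rmono) auto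
      also have "\<dots> \<le> ennreal (2 ^ j) * ennreal ((1 / 4) ^ j)"
        by (intro mult_left_mono ennreal_leI tr) auto
      also have "\<dots> = ennreal ((1 / 2) ^ j)"
        by (simp add: ennreal_mult[symmetric] power_mult_distrib[symmetric])
      finally show "(\<integral>\<^sup>+x. ennreal (2 ^ j * (cmod (S (r (Suc j)) x - S (r j) x))\<^sup>2) \<partial>lborel) \<le> ennreal ((1 / 2) ^ j)" .
    qed simp_all
    also have "\<dots> < top"
      by (subst suminf_ennreal2) (simp_all add: summable_geometric)
    finally have fin: "(\<integral>\<^sup>+x. (\<Sum>j. ennreal (2 ^ j * (cmod (S (r (Suc j)) x - S (r j) x))\<^sup>2)) \<partial>lborel) \<noteq> \<infinity>"
      unfolding infinity_ennreal_def by (rule less_imp_neq)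
    have m: "(\<lambda>x. \<Sum>j. ennreal (2 ^ j * (cmod (S (r (Suc j)) x - S (r j) x))\<^sup>2)) \<in> borel_measurable lborel"
      by measurable
    from nn_integral_PInf_AE[OF m fin] show ?thesis
      by eventually_elim (rule fast_subsequence_converges, simp only: infinity_ennreal_def not_False_eq_True)
  qed
  \<comment> \<open>Where the subsequence diverges the value of \<open>lim\<close> is arbitrary;
    this happens only on a null set.\<close>
  define b where "b x = lim (\<lambda>j. S (r j) x)" for x
  have mb[measurable]: "b \<in> borel_measurable borel" unfolding b_def[abs_def] by simp
  have lim: "AE x in lborel. (\<lambda>j. S (r j) x) \<longlonglongrightarrow> b x"
    using conv by eventually_elim (simp add: b_def convergent_LIMSEQ_iff)
  \<comment> \<open>Used with \<open>u = 0\<close> for the norm of \<open>b\<close>, and with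
    \<open>u = S (r i)\<close> for the distance to the partial sums.\<close>
  have fatou: "(\<integral>\<^sup>+x. ennreal ((cmod (b x - u x))\<^sup>2) \<partial>lborel) \<le> C"
    if "u \<in> borel_measurable borel" "\<And>j. j \<ge> J \<Longrightarrow> (\<integral>\<^sup>+x. ennreal ((cmod (S (r j) x - u x))\<^sup>2) \<partial>lborel) \<le> C" for u C J
  proof -
    note that(1)[measurable]
    have "(\<integral>\<^sup>+x. ennreal ((cmod (b x - u x))\<^sup>2) \<partial>lborel)
        = (\<integral>\<^sup>+x. liminf (\<lambda>j. ennreal ((cmod (S (r j) x - u x))\<^sup>2)) \<partial>lborel)"
    proof (rule nn_integral_cong_AE)
      show "AE x in lborel. ennreal ((cmod (b x - u x))\<^sup>2) = liminf (\<lambda>j. ennreal ((cmod (S (r j) x - u x))\<^sup>2))"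
        using lim
      proof eventually_elim
        case (elim x)
        have "(\<lambda>j. (cmod (S (r j) x - u x))\<^sup>2) \<longlonglongrightarrow> (cmod (b x - u x))\<^sup>2"
          by (intro tendsto_power tendsto_norm tendsto_diff tendsto_const elim)
        then have "(\<lambda>j. ennreal ((cmod (S (r j) x - u x))\<^sup>2)) \<longlonglongrightarrow> ennreal ((cmod (b x - u x))\<^sup>2)"
          by (rule tendsto_ennrealI)
        from lim_imp_Liminf[OF sequentially_bot this] show ?case by simp
      qed
    qed
    also have "\<dots> \<le> liminf (\<lambda>j. \<integral>\<^sup>+x. ennreal ((cmod (S (r j) x - u x))\<^sup>2) \<partial>lborel)"
      by (rule nn_integral_liminf) simp
    also have "\<dots> \<le> liminf (\<lambda>j. C)"
      by (intro Liminf_mono eventually_sequentiallyI[of J] that(2))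
    also have "\<dots> = C" by (simp add: Liminf_const)
    finally show ?thesis .
  qed
  have bT: "(\<integral>\<^sup>+x. ennreal ((cmod (b x))\<^sup>2) \<partial>lborel) \<le> ennreal T"
    using fatou[of "\<lambda>_. 0" 0] Sn by simp
  have bsq: "square_integrable b"
    unfolding square_integrable_iff_nn_integral using bT mb by (auto intro: order_le_less_trans)
  have bd: "(\<integral>\<^sup>+x. ennreal ((cmod (b x - S (r i) x))\<^sup>2) \<partial>lborel) \<le> ennreal (t (r i))" for i
    by (rule fatou[where J = i]) (use Sd rmono in auto)
  \<comment> \<open>Coefficient \<open>k\<close> of \<open>S (r i)\<close> equals \<open>c k\<close>
    once \<open>r i > k\<close>, while by Cauchy-Schwarz it tends to that of
    \<open>b\<close>.\<close>
  have "L2_inner (e k) b = c k" for k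
  proof -
    have "(\<lambda>i. L2_inner (e k) b - L2_inner (e k) (S (r i))) \<longlonglongrightarrow> 0"
    proof (rule tendsto_norm_zero_cancel, rule tendsto_sandwich[OF always_eventually always_eventually tendsto_const])
      show "\<forall>i. norm (L2_inner (e k) b - L2_inner (e k) (S (r i))) \<le> sqrt (t (r i))"
      proof
        fix i
        have dsq: "square_integrable (\<lambda>x. b x - S (r i) x)" by (rule square_integrable_diff[OF bsq Ssq])
        have "L2_inner (e k) b - L2_inner (e k) (S (r i)) = L2_inner (e k) (\<lambda>x. b x - S (r i) x)"
          unfolding L2_inner_def right_diff_distrib
          by (rule Bochner_Integration.integral_diff[symmetric]) (intro integrable_cnj_mult_square_integrable e bsq Ssq)+
        moreover have "(LINT x|lborel. (cmod (e k x))\<^sup>2) = 1"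
          using L2_inner_self[of "e k"] o[of k k] by simp
        moreover have "(LINT x|lborel. (cmod (b x - S (r i) x))\<^sup>2) \<le> t (r i)"
          using bd[of i] t0 unfolding nn_integral_square_integrable[OF dsq] by (simp add: ennreal_le_iff)
        ultimately show "norm (L2_inner (e k) b - L2_inner (e k) (S (r i))) \<le> sqrt (t (r i))"
          using L2_inner_Cauchy_Schwarz[OF e[of k] dsq] by (intro real_le_rsqrt) simp
      qed
      have "(\<lambda>i. sqrt (t (r i))) \<longlonglongrightarrow> sqrt 0"
      proof (intro tendsto_intros)
        show "(\<lambda>i. t (r i)) \<longlonglongrightarrow> 0"
          by (rule filterlim_compose[OF tlim]) (rule filterlim_at_top_mono[OF filterlim_ident], simp add: rj)
      qed
      then show "(\<lambda>i. sqrt (t (r i))) \<longlonglongrightarrow> 0" by simp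
    qed auto
    moreover have "\<forall>\<^sub>F i in sequentially. L2_inner (e k) b - L2_inner (e k) (S (r i)) = L2_inner (e k) b - c k"
    proof (rule eventually_sequentiallyI[of "Suc k"])
      fix i assume "Suc k \<le> i"
      then have "k < r i" using rj[of i] by simp
      then show "L2_inner (e k) b - L2_inner (e k) (S (r i)) = L2_inner (e k) b - c k"
        unfolding S_def using L2_inner_sum_right[where A = "{..<r i}" and f = "e k" and g = e and c = c] e
        by (simp add: o if_distrib cong: if_cong)
    qed
    ultimately have "(\<lambda>i. L2_inner (e k) b - c k) \<longlonglongrightarrow> 0"
      by (rule Lim_transform_eventually)
    then show ?thesis by (simp add: LIMSEQ_const_iff)
  qed
  with bsq bT show ?thesis unfolding T_def by blast
qed

section \<open>The matrix of a density matrix and its factorization\<close>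

lemma operator_sum:
  fixes e :: "nat \<Rightarrow> 'a::euclidean_space \<Rightarrow> complex"
  assumes T: "bounded_L2_operator T" and e: "\<And>k. square_integrable (e k)"
  shows "AE x in lborel. T (\<lambda>x. \<Sum>k<n. c k * e k x) x = (\<Sum>k<n. c k * T (e k) x)"
proof -
  have lin: "AE x in lborel. T (\<lambda>y. a * f y + b * g y) x = a * T f x + b * T g x"
    if "square_integrable f" "square_integrable g" for f g a b
    using T that unfolding bounded_L2_operator_def by blast
  show ?thesis
  proof (induction n)
    case 0
    \<comment> \<open>Linearity with zero coefficients: the image of the zero function vanishes
      almost everywhere.\<close>
    from lin[OF square_integrable_zero square_integrable_zero, of 0 0] show ?case by simp
  next
    case (Suc n)
    have eq: "(\<lambda>y. 1 * (\<Sum>k<n. c k * e k y) + c n * e n y) = (\<lambda>y. \<Sum>k<Suc n. c k * e k y)"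
      by (simp only: sum.lessThan_Suc mult_1_left)
    have "AE x in lborel. T (\<lambda>y. 1 * (\<Sum>k<n. c k * e k y) + c n * e n y) x
        = 1 * T (\<lambda>y. \<Sum>k<n. c k * e k y) x + c n * T (e n) x"
      by (rule lin[OF square_integrable_lincomb[OF e] e])
    then show ?case
      using Suc
    proof eventually_elim
      case (elim x)
      show ?case
        unfolding elim(1)[unfolded eq elim(2)] by simp
    qed
  qed
qed

lemma L2_inner_cong_AE:
  assumes "AE x in lborel. f x = g x" "square_integrable f" "square_integrable g" "square_integrable u"
  shows "L2_inner u f = L2_inner u g"
  unfolding L2_inner_def
proof (rule integral_cong_AE)
  show "(\<lambda>x. cnj (u x) * f x) \<in> borel_measurable lborel" "(\<lambda>x. cnj (u x) * g x) \<in> borel_measurable lborel"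
    by (rule borel_measurable_integrable[OF integrable_cnj_mult_square_integrable[OF assms(4) assms(2)]],
        rule borel_measurable_integrable[OF integrable_cnj_mult_square_integrable[OF assms(4) assms(3)]])
  show "AE x in lborel. cnj (u x) * f x = cnj (u x) * g x"
    using assms(1) by eventually_elim simp
qed

text \<open>The quadratic form at \<open>c\<close> is the inner product of \<open>f\<close> with
  \<open>T f\<close>, where \<open>f\<close> is the combination of the \<open>e k\<close> with
  coefficients \<open>c\<close>.\<close>

lemma positive_matrix_of_operator:
  assumes T: "bounded_L2_operator T" "L2_positive T" and e: "\<And>k. square_integrable (e k)"
  shows "positive_matrix (\<lambda>k l. L2_inner (e k) (T (e l)))"
  unfolding positive_matrix_def
proof (intro allI)
  fix n and c :: "nat \<Rightarrow> complex"
  have Tsq: "square_integrable (T f)" if "square_integrable f" for f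
    using T that by (simp add: bounded_L2_operator_def)
  define f where "f x = (\<Sum>k<n. c k * e k x)" for x
  have f: "square_integrable f" unfolding f_def[abs_def] using e by (intro square_integrable_lincomb)
  have "L2_inner f (T f) = L2_inner f (\<lambda>x. \<Sum>l<n. c l * T (e l) x)"
    using operator_sum[OF T(1) e, where n = n and c = c] f e
    by (intro L2_inner_cong_AE Tsq square_integrable_lincomb) (simp_all add: f_def[abs_def])
  also have "\<dots> = (\<Sum>k<n. cnj (c k) * L2_inner (e k) (\<lambda>x. \<Sum>l<n. c l * T (e l) x))"
    unfolding f_def[abs_def] using e by (intro L2_inner_sum_left square_integrable_lincomb Tsq) simp_all
  also have "\<dots> = (\<Sum>k<n. cnj (c k) * (\<Sum>l<n. c l * L2_inner (e k) (T (e l))))"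
    using e Tsq by (intro sum.cong refl arg_cong2[where f = "(*)"] L2_inner_sum_right) simp_all
  also have "\<dots> = (\<Sum>k<n. \<Sum>l<n. cnj (c k) * c l * L2_inner (e k) (T (e l)))"
    by (simp add: sum_distrib_left mult.assoc)
  finally show "(\<Sum>k<n. \<Sum>l<n. cnj (c k) * c l * L2_inner (e k) (T (e l))) \<in> \<real>\<^sub>\<ge>\<^sub>0"
    using T(2) f unfolding L2_positive_def by metis
qed

lemma suminf_rows_le:
  fixes B :: "nat \<Rightarrow> nat \<Rightarrow> ennreal"
  assumes "\<And>k M. (\<Sum>m<M. B m k) \<le> a k"
  shows "(\<Sum>m. \<Sum>k. B m k) \<le> (\<Sum>k. a k)"
proof (rule suminf_le_const)
  fix M
  have "(\<Sum>m<M. \<Sum>k. B m k) = (\<Sum>k. \<Sum>m<M. B m k)"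
    by (rule suminf_sum[symmetric]) simp
  also have "\<dots> \<le> (\<Sum>k. a k)"
    by (rule suminf_le) (use assms in auto)
  finally show "(\<Sum>m<M. \<Sum>k. B m k) \<le> (\<Sum>k. a k)" .
qed simp

text \<open>\<open>B\<close> is the Cholesky factor of the matrix of \<open>T\<close>, and
  \<open>b m\<close> has the row \<open>B m\<close> as its coefficients. The squares in column
  \<open>k\<close> sum to the diagonal entry at \<open>k\<close>, so the trace bounds the sum of all
  squared entries; every row is therefore square summable and Riesz-Fischer applies. Triangularity
  is part of the conclusion because it keeps the expansion of \<open>T (e l)\<close> finite.\<close>

lemma positive_trace_class_factorization:
  fixes T :: "'a::euclidean_space L2_operator"
  assumes "density_matrix T"
  obtains b :: "nat \<Rightarrow> 'a \<Rightarrow> complex" and e B where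
    "L2_orthonormal_basis e"
    "\<And>m. square_integrable (b m)"
    "(\<Sum>m. \<integral>\<^sup>+x. ennreal ((cmod (b m x))\<^sup>2) \<partial>lborel) < \<infinity>"
    "\<And>m k. L2_inner (e k) (b m) = B m k"
    "\<And>m l. l < m \<Longrightarrow> B m l = 0"
    "\<And>k l n. l < n \<Longrightarrow> L2_inner (e k) (T (e l)) = (\<Sum>m<n. B m k * cnj (B m l))"
proof -
  obtain e where T: "bounded_L2_operator T" "L2_positive T" and E: "L2_orthonormal_basis e"
    and tr: "(\<lambda>k. L2_inner (e k) (T (e k))) sums 1"
    using assms unfolding density_matrix_def by blast
  have e: "square_integrable (e k)" and o: "L2_inner (e k) (e l) = (if k = l then 1 else 0)" for k l
    using E by (simp_all add: L2_orthonormal_basis_def)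
  define A where "A k l = L2_inner (e k) (T (e l))" for k l
  have A: "positive_matrix A"
    unfolding A_def[abs_def] by (rule positive_matrix_of_operator[OF T e])
  obtain B where B0: "\<And>m l. l < m \<Longrightarrow> B m l = 0"
    and B: "\<And>k l n. l < n \<Longrightarrow> A k l = (\<Sum>m<n. B m k * cnj (B m l))"
    using cholesky[OF A] by metis
  have "(\<Sum>m<M. ennreal ((cmod (B m k))\<^sup>2)) \<le> ennreal (Re (A k k))" for k M
  proof -
    \<comment> \<open>The factorization at \<open>(k, k)\<close> is available only for sums reaching
      beyond \<open>k\<close>, so \<open>M\<close> is enlarged if necessary.\<close>
    define n where "n = max M (Suc k)"
    have "(\<Sum>m<M. (cmod (B m k))\<^sup>2) \<le> (\<Sum>m<n. (cmod (B m k))\<^sup>2)"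
      by (intro sum_mono2) (auto simp: n_def)
    also have "complex_of_real (\<Sum>m<n. (cmod (B m k))\<^sup>2) = A k k"
      unfolding of_real_sum complex_norm_square by (rule B[symmetric]) (simp add: n_def)
    then have "(\<Sum>m<n. (cmod (B m k))\<^sup>2) = Re (A k k)" by (metis Re_complex_of_real)
    finally show ?thesis by (simp add: sum_ennreal ennreal_leI)
  qed
  then have le: "(\<Sum>m. \<Sum>k. ennreal ((cmod (B m k))\<^sup>2)) \<le> (\<Sum>k. ennreal (Re (A k k)))"
    by (rule suminf_rows_le)
  have "(\<lambda>k. Re (A k k)) sums Re 1"
    unfolding A_def by (rule sums_Re[OF tr])
  then have one: "(\<Sum>k. ennreal (Re (A k k))) = ennreal (Re 1)"
    by (rule suminf_ennreal_eq[rotated]) (rule positive_matrix_diag_real(2)[OF A])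
  have le1: "(\<Sum>m. \<Sum>k. ennreal ((cmod (B m k))\<^sup>2)) \<le> ennreal (Re 1)"
    using le unfolding one .
  have "(\<Sum>k. ennreal ((cmod (B m k))\<^sup>2)) \<noteq> top" for m
  proof -
    define F where "F m = (\<Sum>k. ennreal ((cmod (B m k))\<^sup>2))" for m
    have "sum F {m} \<le> suminf F"
      by (intro sum_le_suminf summableI) simp_all
    then have "(\<Sum>k. ennreal ((cmod (B m k))\<^sup>2)) \<le> (\<Sum>m. \<Sum>k. ennreal ((cmod (B m k))\<^sup>2))"
      by (simp only: F_def[abs_def] sum.insert finite.emptyI empty_iff not_False_eq_True sum.empty add_0_right)
    from order_le_less_trans[OF order_trans[OF this le1] ennreal_less_top] show ?thesis
      by (rule less_imp_neq)
  qed
  then have summ: "summable (\<lambda>k. (cmod (B m k))\<^sup>2)" for m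
    by (intro summable_suminf_not_top) simp_all
  have "\<forall>m. \<exists>b. square_integrable b \<and> (\<forall>k. L2_inner (e k) b = B m k) \<and>
      (\<integral>\<^sup>+x. ennreal ((cmod (b x))\<^sup>2) \<partial>lborel) \<le> ennreal (\<Sum>k. (cmod (B m k))\<^sup>2)"
    using riesz_fischer[OF e o summ] by (rule allI)
  from choice[OF this] obtain b where b: "\<And>m. square_integrable (b m)"
    "\<And>m k. L2_inner (e k) (b m) = B m k"
    "\<And>m. (\<integral>\<^sup>+x. ennreal ((cmod (b m x))\<^sup>2) \<partial>lborel) \<le> ennreal (\<Sum>k. (cmod (B m k))\<^sup>2)"
    by auto
  have "(\<Sum>m. \<integral>\<^sup>+x. ennreal ((cmod (b m x))\<^sup>2) \<partial>lborel) \<le> (\<Sum>m. \<Sum>k. ennreal ((cmod (B m k))\<^sup>2))"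
    using b(3) summ by (intro suminf_le) (simp_all add: suminf_ennreal2)
  also have "\<dots> \<le> ennreal (Re 1)" by (rule le1)
  also have "\<dots> < \<infinity>" by simp
  finally show ?thesis
    using that[OF E b(1) _ b(2) B0 B[unfolded A_def]] by blast
qed

section \<open>The kernel as a series and its product bound\<close>

lemma pointwise_Cauchy_Schwarz:
  fixes u v :: "nat \<Rightarrow> complex"
  assumes u: "(\<Sum>m. ennreal ((cmod (u m))\<^sup>2)) < top" and v: "(\<Sum>m. ennreal ((cmod (v m))\<^sup>2)) < top"
  defines "C \<equiv> sqrt (enn2real (\<Sum>m. ennreal ((cmod (u m))\<^sup>2))) * sqrt (enn2real (\<Sum>m. ennreal ((cmod (v m))\<^sup>2)))"
  shows "summable (\<lambda>m. u m * cnj (v m))" "\<And>n. cmod (\<Sum>m<n. u m * cnj (v m)) \<le> C"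
    "cmod (\<Sum>m. u m * cnj (v m)) \<le> C"
proof -
  have aux: "L2_set (\<lambda>m. cmod (w m)) {..<n} \<le> sqrt (enn2real (\<Sum>m. ennreal ((cmod (w m))\<^sup>2)))"
    if "(\<Sum>m. ennreal ((cmod (w m))\<^sup>2)) < top" for w :: "nat \<Rightarrow> complex" and n
  proof -
    have s: "summable (\<lambda>m. (cmod (w m))\<^sup>2)"
      using that by (intro summable_suminf_not_top) auto
    then have "(\<Sum>m. ennreal ((cmod (w m))\<^sup>2)) = ennreal (\<Sum>m. (cmod (w m))\<^sup>2)"
      by (intro suminf_ennreal2) auto
    then have "enn2real (\<Sum>m. ennreal ((cmod (w m))\<^sup>2)) = (\<Sum>m. (cmod (w m))\<^sup>2)"
      using s by (simp add: suminf_nonneg)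
    then show ?thesis
      using sum_le_suminf[OF s, of "{..<n}"] by (simp add: L2_set_def)
  qed
  have part: "(\<Sum>m<n. cmod (u m * cnj (v m))) \<le> C" for n
  proof -
    have "(\<Sum>m<n. cmod (u m * cnj (v m))) = (\<Sum>m<n. \<bar>cmod (u m)\<bar> * \<bar>cmod (v m)\<bar>)"
      by (simp add: norm_mult)
    also have "\<dots> \<le> L2_set (\<lambda>m. cmod (u m)) {..<n} * L2_set (\<lambda>m. cmod (v m)) {..<n}"
      by (rule L2_set_mult_ineq)
    also have "\<dots> \<le> C"
      unfolding C_def by (intro mult_mono aux u v) simp_all
    finally show ?thesis .
  qed
  have s: "summable (\<lambda>m. cmod (u m * cnj (v m)))"
    by (rule bounded_imp_summable[where B = C]) (use part[of "Suc _"] in \<open>simp_all only: lessThan_Suc_atMost norm_ge_zero\<close>)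
  then show "summable (\<lambda>m. u m * cnj (v m))" by (rule summable_norm_cancel)
  show "cmod (\<Sum>m<n. u m * cnj (v m)) \<le> C" for n
  proof (rule order_trans[OF norm_sum])
    show "(\<Sum>m<n. cmod (u m * cnj (v m))) \<le> C" by (rule part)
  qed
  show "cmod (\<Sum>m. u m * cnj (v m)) \<le> C"
  proof (rule order_trans[OF summable_norm[OF s]])
    show "(\<Sum>m. cmod (u m * cnj (v m))) \<le> C" by (rule suminf_le_const[OF s part])
  qed
qed

text \<open>By triangularity \<open>T (e l)\<close> is almost everywhere a finite combination of the
  \<open>b m\<close>. For almost every \<open>x\<close> the function \<open>K x\<close> and the
  series with terms \<open>b m x * cnj (b m y)\<close> therefore have equal integrals against every
  \<open>e l\<close>, and completeness identifies them. Cauchy-Schwarz for the series then gives the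
  bound.\<close>

theorem density_matrix_kernel_bound:
  fixes T :: "'a::euclidean_space L2_operator"
  assumes T: "density_matrix T" and K: "integral_kernel T K"
  obtains B :: "'a \<Rightarrow> real" where "B \<in> borel_measurable borel" "\<And>x. B x \<ge> 0"
    "(\<integral>\<^sup>+x. ennreal ((B x)\<^sup>2) \<partial>lborel) < \<infinity>"
    "AE z in lborel. cmod (K (fst z) (snd z)) \<le> B (fst z) * B (snd z)"
proof (rule positive_trace_class_factorization[OF T])
  fix b :: "nat \<Rightarrow> 'a \<Rightarrow> complex" and e :: "nat \<Rightarrow> 'a \<Rightarrow> complex" and c :: "nat \<Rightarrow> nat \<Rightarrow> complex"
  assume E: "L2_orthonormal_basis e" and b: "\<And>m. square_integrable (b m)"
    and bfin: "(\<Sum>m. \<integral>\<^sup>+x. ennreal ((cmod (b m x))\<^sup>2) \<partial>lborel) < \<infinity>"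
    and be: "\<And>m k. L2_inner (e k) (b m) = c m k"
    and c0: "\<And>m l. l < m \<Longrightarrow> c m l = 0"
    and Tc: "\<And>k l n. l < n \<Longrightarrow> L2_inner (e k) (T (e l)) = (\<Sum>m<n. c m k * cnj (c m l))"
  have Tb: "bounded_L2_operator T" using T by (simp add: density_matrix_def)
  have Tsq: "square_integrable (T f)" if "square_integrable f" for f
    using Tb that by (simp add: bounded_L2_operator_def)
  have e: "square_integrable (e k)"
    and complete: "square_integrable f \<Longrightarrow> (\<And>k. L2_inner (e k) f = 0) \<Longrightarrow> AE x in lborel. f x = 0" for k f
    using E by (simp_all add: L2_orthonormal_basis_def)
  have mb[measurable]: "b m \<in> borel_measurable borel" and me[measurable]: "e m \<in> borel_measurable borel" for m
    using b e by (simp_all add: square_integrable_def)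
  have Ksq: "square_integrable (\<lambda>z. K (fst z) (snd z))"
    using K by (simp add: integral_kernel_def case_prod_unfold)
  have mK: "(\<lambda>z. K (fst z) (snd z)) \<in> borel_measurable borel"
    using Ksq by (simp add: square_integrable_def)
  define W where "W x = (\<Sum>m. ennreal ((cmod (b m x))\<^sup>2))" for x
  have mW[measurable]: "W \<in> borel_measurable borel" unfolding W_def by measurable
  have Wfin: "(\<integral>\<^sup>+x. W x \<partial>lborel) < \<infinity>"
    unfolding W_def using bfin by (subst nn_integral_suminf) auto
  have WAE: "AE x in lborel. W x < top"
  proof -
    have "(\<integral>\<^sup>+x. W x \<partial>lborel) \<noteq> \<infinity>" using Wfin by simp
    from nn_integral_PInf_AE[OF _ this] have "AE x in lborel. W x \<noteq> \<infinity>" by simp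
    then show ?thesis by eventually_elim (simp add: less_top)
  qed
  \<comment> \<open>\<open>B\<close> is 0 where the series \<open>W\<close> diverges, which is a
    null set.\<close>
  define B where "B x = sqrt (enn2real (W x))" for x
  have mB[measurable]: "B \<in> borel_measurable borel" unfolding B_def by measurable
  have B0: "B x \<ge> 0" for x by (simp add: B_def)
  have BW: "(\<integral>\<^sup>+x. ennreal ((B x)\<^sup>2) \<partial>lborel) < \<infinity>"
  proof -
    have "(\<integral>\<^sup>+x. ennreal ((B x)\<^sup>2) \<partial>lborel) = (\<integral>\<^sup>+x. W x \<partial>lborel)"
      using WAE by (intro nn_integral_cong_AE, eventually_elim) (simp add: B_def)
    then show ?thesis using Wfin by simp
  qed
  have row: "AE x in lborel. T (e l) x = (\<Sum>m<Suc l. cnj (c m l) * b m x)" for l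
  proof -
    define g where "g x = T (e l) x - (\<Sum>m<Suc l. cnj (c m l) * b m x)" for x
    have s: "square_integrable (\<lambda>x. \<Sum>m<Suc l. cnj (c m l) * b m x)"
      using b by (intro square_integrable_lincomb)
    have gsq: "square_integrable g"
      unfolding g_def[abs_def] by (rule square_integrable_diff[OF Tsq[OF e] s])
    have "L2_inner (e k) g = 0" for k
    proof -
      have "L2_inner (e k) g = L2_inner (e k) (T (e l)) - L2_inner (e k) (\<lambda>x. \<Sum>m<Suc l. cnj (c m l) * b m x)"
        unfolding L2_inner_def g_def right_diff_distrib
        by (rule Bochner_Integration.integral_diff) (intro integrable_cnj_mult_square_integrable e Tsq s)+
      also have "L2_inner (e k) (\<lambda>x. \<Sum>m<Suc l. cnj (c m l) * b m x) = (\<Sum>m<Suc l. cnj (c m l) * L2_inner (e k) (b m))"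
        using b e by (intro L2_inner_sum_right) simp_all
      also have "\<dots> = L2_inner (e k) (T (e l))"
        unfolding Tc[OF lessI] be by (simp only: mult.commute)
      finally show ?thesis by simp
    qed
    from complete[OF gsq this] show ?thesis
      by eventually_elim (simp add: g_def)
  qed
  have "AE x in lborel. AE y in lborel. cmod (K x y) \<le> B x * B y"
  proof -
    \<comment> \<open>Countably many \<open>l\<close> share one exceptional null set in
      \<open>x\<close>.\<close>
    have "AE x in lborel. \<forall>l. T (e l) x = (LINT y|lborel. K x y * e l y)"
      unfolding AE_all_countable using K e by (simp add: integral_kernel_def)
    moreover have "AE x in lborel. \<forall>l. T (e l) x = (\<Sum>m<Suc l. cnj (c m l) * b m x)"
      unfolding AE_all_countable using row by blast
    moreover have "AE x in lborel. square_integrable (K x)"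
      using square_integrable_AE_section[OF Ksq] by simp
    ultimately show ?thesis
      using WAE
    proof eventually_elim
      case (elim x)
      define K' where "K' y = (\<Sum>m. b m x * cnj (b m y))" for y
      have mcb[measurable]: "(\<lambda>y. cnj (b m y)) \<in> borel_measurable borel" for m
        using square_integrable_cnj[OF b] by (simp add: square_integrable_def)
      have mK'[measurable]: "K' \<in> borel_measurable borel" unfolding K'_def by measurable
      have bound: "AE y in lborel. summable (\<lambda>m. b m x * cnj (b m y)) \<and>
          (\<forall>n. cmod (\<Sum>m<n. b m x * cnj (b m y)) \<le> B x * B y) \<and> cmod (K' y) \<le> B x * B y"
        using WAE
      proof eventually_elim
        case (elim y)
        show ?case
          using pointwise_Cauchy_Schwarz[of "\<lambda>m. b m x" "\<lambda>m. b m y"] elim \<open>W x < top\<close>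
          unfolding W_def B_def K'_def by blast
      qed
      have Bsqi: "integrable lborel (\<lambda>y. (B y)\<^sup>2)"
        using BW by (simp add: integrable_iff_bounded)
      have K'sq: "square_integrable K'"
        unfolding square_integrable_def
      proof
        show "integrable lborel (\<lambda>y. (cmod (K' y))\<^sup>2)"
        proof (rule Bochner_Integration.integrable_bound)
          show "integrable lborel (\<lambda>y. (B x)\<^sup>2 * (B y)\<^sup>2)" using Bsqi by simp
          show "AE y in lborel. norm ((cmod (K' y))\<^sup>2) \<le> norm ((B x)\<^sup>2 * (B y)\<^sup>2)"
            using bound
          proof eventually_elim
            case (elim y)
            then have "(cmod (K' y))\<^sup>2 \<le> (B x * B y)\<^sup>2" by (intro power_mono) auto
            then show ?case by (simp add: power_mult_distrib)
          qed
        qed simp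
      qed simp
      have testK': "(LINT y|lborel. K' y * e l y) = (\<Sum>m<Suc l. cnj (c m l) * b m x)" for l
      proof -
        \<comment> \<open>The partial sums are bounded by \<open>B x * B y\<close>, and
          \<open>B\<close> and \<open>e l\<close> are square integrable, so the series may be
          integrated term by term.\<close>
        have "(\<lambda>n. LINT y|lborel. (\<Sum>m<n. b m x * cnj (b m y)) * e l y) \<longlonglongrightarrow> (LINT y|lborel. K' y * e l y)"
        proof (rule integral_dominated_convergence[where w = "\<lambda>y. B x * ((B y)\<^sup>2 + (cmod (e l y))\<^sup>2) / 2"])
          show "integrable lborel (\<lambda>y. B x * ((B y)\<^sup>2 + (cmod (e l y))\<^sup>2) / 2)"
            using Bsqi e[of l] by (simp add: square_integrable_def)
          show "AE y in lborel. (\<lambda>n. (\<Sum>m<n. b m x * cnj (b m y)) * e l y) \<longlonglongrightarrow> K' y * e l y"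
            using bound
          proof eventually_elim
            case (elim y)
            then show ?case
              unfolding K'_def by (intro tendsto_mult tendsto_const summable_LIMSEQ) blast
          qed
          show "AE y in lborel. norm ((\<Sum>m<n. b m x * cnj (b m y)) * e l y) \<le> B x * ((B y)\<^sup>2 + (cmod (e l y))\<^sup>2) / 2" for n
            using bound
          proof eventually_elim
            case (elim y)
            then have "norm ((\<Sum>m<n. b m x * cnj (b m y)) * e l y) \<le> (B x * B y) * cmod (e l y)"
              unfolding norm_mult by (intro mult_right_mono) auto
            also have "\<dots> = B x * (B y * cmod (e l y))" by simp
            also have "\<dots> \<le> B x * (((B y)\<^sup>2 + (cmod (e l y))\<^sup>2) / 2)"
              by (intro mult_left_mono product_le_mean_squares B0)
            finally show ?case by simp
          qed
        qed simp_all
        moreover have "(LINT y|lborel. (\<Sum>m<n. b m x * cnj (b m y)) * e l y) = (\<Sum>m<n. cnj (c m l) * b m x)" for n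
        proof -
          have "(LINT y|lborel. (\<Sum>m<n. b m x * cnj (b m y)) * e l y) = (LINT y|lborel. (\<Sum>m<n. b m x * (cnj (b m y) * e l y)))"
            by (simp add: sum_distrib_right mult.assoc)
          also have "\<dots> = (\<Sum>m<n. LINT y|lborel. b m x * (cnj (b m y) * e l y))"
            using b e by (intro Bochner_Integration.integral_sum integrable_mult_right integrable_cnj_mult_square_integrable)
          also have "\<dots> = (\<Sum>m<n. b m x * L2_inner (b m) (e l))" by (simp add: L2_inner_def)
          also have "\<dots> = (\<Sum>m<n. cnj (c m l) * b m x)"
            unfolding L2_inner_cnj[of "e l" "b _", symmetric] be by (simp only: mult.commute)
          finally show ?thesis .
        qed
        \<comment> \<open>The limit is attained at \<open>Suc l\<close>: \<open>c m l\<close>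
          vanishes for \<open>m > l\<close>.\<close>
        moreover have "(\<lambda>n. \<Sum>m<n. cnj (c m l) * b m x) \<longlonglongrightarrow> (\<Sum>m<Suc l. cnj (c m l) * b m x)"
        proof (rule tendsto_eventually, rule eventually_sequentiallyI[of "Suc l"])
          fix n assume "Suc l \<le> n"
          then show "(\<Sum>m<n. cnj (c m l) * b m x) = (\<Sum>m<Suc l. cnj (c m l) * b m x)"
            by (intro sum.mono_neutral_right) (auto simp: c0)
        qed
        ultimately show ?thesis using LIMSEQ_unique by fastforce
      qed
      \<comment> \<open>The kernel acts on \<open>e l\<close> without conjugation whereas
        \<open>L2_inner\<close> conjugates its first argument; hence the conjugate of the
        difference.\<close>
      define D where "D y = cnj (K x y - K' y)" for y
      have Dsq: "square_integrable D"
        unfolding D_def[abs_def] using elim K'sq by (intro square_integrable_cnj square_integrable_diff)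
      have "L2_inner (e l) D = 0" for l
      proof -
        have "L2_inner (e l) D = cnj (LINT y|lborel. K x y * e l y - K' y * e l y)"
          unfolding L2_inner_def D_def by (subst Bochner_Integration.integral_cnj[symmetric]) (simp add: algebra_simps)
        also have "(LINT y|lborel. K x y * e l y - K' y * e l y) = (LINT y|lborel. K x y * e l y) - (LINT y|lborel. K' y * e l y)"
          using elim K'sq e by (intro Bochner_Integration.integral_diff integrable_mult_square_integrable)
        also have "\<dots> = 0" using elim by (simp add: testK')
        finally show ?thesis by simp
      qed
      from complete[OF Dsq this] bound show "AE y in lborel. cmod (K x y) \<le> B x * B y"
        by eventually_elim (simp add: D_def)
    qed
  qed
  \<comment> \<open>Measurability of this set allows the passage from an iterated to a joint
    statement almost everywhere.\<close>
  moreover have "{z \<in> space (lborel \<Otimes>\<^sub>M lborel). cmod (K (fst z) (snd z)) \<le> B (fst z) * B (snd z)} \<in> sets (lborel \<Otimes>\<^sub>M lborel)"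
  proof -
    have "(\<lambda>z. B (fst z) * B (snd z)) \<in> borel_measurable (borel :: ('a \<times> 'a) measure)"
      by (intro borel_measurable_times borel_measurable_comp_continuous[OF mB] continuous_intros)
    from borel_measurable_le[OF borel_measurable_norm[THEN measurable_compose[OF mK]] this]
    show ?thesis unfolding lborel_prod by simp
  qed
  ultimately have "AE z in lborel \<Otimes>\<^sub>M lborel. cmod (K (fst z) (snd z)) \<le> B (fst z) * B (snd z)"
    by (intro lborel_pair.AE_pair_measure) simp_all
  then have "AE z in lborel. cmod (K (fst z) (snd z)) \<le> B (fst z) * B (snd z)"
    unfolding lborel_prod .
  with mB B0 BW show thesis by (rule that)
qed

section \<open>Plus and minus coordinates\<close>

text \<open>For \<open>i \<noteq> j\<close> the isometric embedding of the relative coordinate,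
  adjoint to \<open>minus_part\<close>; all entries other than \<open>i\<close> and \<open>j\<close>
  are 0.\<close>

definition minus_embed :: "'n \<Rightarrow> 'n \<Rightarrow> real ^ 'd \<Rightarrow> ('d::finite, 'n::finite) config" where
  "minus_embed i j v = from_parts i j 0 v 0"

text \<open>For \<open>i \<noteq> j\<close> the orthogonal projection onto the configurations fixed
  by the exchange, that is, onto the complement of the range of \<open>minus_embed\<close>.\<close>

definition plus_proj :: "'n \<Rightarrow> 'n \<Rightarrow> ('d::finite, 'n::finite) config \<Rightarrow> ('d, 'n) config" where
  "plus_proj i j A = from_parts i j (plus_part i j A) 0 A"

lemma from_parts_nth:
  "from_parts i j a b A $ l = (if l = i then (a + b) /\<^sub>R sqrt 2 else if l = j then (a - b) /\<^sub>R sqrt 2 else A $ l)"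
  by (simp add: from_parts_def set_pair_def)

lemma exchange_nth: "exchange i j A $ l = (if l = i then A $ j else if l = j then A $ i else A $ l)"
  by (simp add: exchange_def set_pair_def)

lemma exchange_exchange [simp]: "exchange i j (exchange i j A) = A"
  by (simp add: vec_eq_iff[of "exchange i j (exchange i j A)"] exchange_nth)

lemma exchange_add: "exchange i j (A + B) = exchange i j A + exchange i j B"
  by (simp add: vec_eq_iff[of "exchange i j (A + B)"] exchange_nth)

lemma exchange_diff: "exchange i j (A - B) = exchange i j A - exchange i j B"
  by (simp add: vec_eq_iff[of "exchange i j (A - B)"] exchange_nth)

lemma exchange_scaleR: "exchange i j (c *\<^sub>R A) = c *\<^sub>R exchange i j A"
  by (simp add: vec_eq_iff[of "exchange i j (c *\<^sub>R A)"] exchange_nth)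

lemma continuous_on_from_parts [continuous_intros]:
  assumes "continuous_on S f" "continuous_on S g" "continuous_on S k"
  shows "continuous_on S (\<lambda>z. from_parts i j (f z) (g z) (k z))"
  unfolding from_parts_def set_pair_def
proof (intro continuous_on_vec_lambda)
  fix l
  show "continuous_on S (\<lambda>z. if l = i then (f z + g z) /\<^sub>R sqrt 2 else if l = j then (f z - g z) /\<^sub>R sqrt 2 else k z $ l)"
    using assms by (cases "l = i"; cases "l = j") (auto intro!: continuous_intros)
qed

lemma continuous_on_exchange [continuous_intros]:
  assumes "continuous_on S k"
  shows "continuous_on S (\<lambda>z. exchange i j (k z))"
  unfolding exchange_def set_pair_def
proof (intro continuous_on_vec_lambda)
  fix l
  show "continuous_on S (\<lambda>z. if l = i then k z $ j else if l = j then k z $ i else k z $ l)"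
    using assms by (cases "l = i"; cases "l = j") (auto intro!: continuous_intros)
qed

lemma continuous_on_parts [continuous_intros]:
  assumes "continuous_on S k"
  shows "continuous_on S (\<lambda>z. plus_part i j (k z))" "continuous_on S (\<lambda>z. minus_part i j (k z))"
  unfolding plus_part_def minus_part_def using assms by (auto intro!: continuous_intros)

lemma continuous_on_minus_embed [continuous_intros]:
  "continuous_on S f \<Longrightarrow> continuous_on S (\<lambda>z. minus_embed i j (f z))"
  unfolding minus_embed_def by (intro continuous_intros)

lemma continuous_on_plus_proj [continuous_intros]:
  "continuous_on S k \<Longrightarrow> continuous_on S (\<lambda>z. plus_proj i j (k z))"
  unfolding plus_proj_def by (intro continuous_intros)

lemma from_parts_split: "from_parts i j a b A = from_parts i j a 0 A + minus_embed i j b"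
  by (simp add: vec_eq_iff[of "from_parts i j a b A"] minus_embed_def from_parts_nth scaleR_add_right scaleR_diff_right)

lemma plus_proj_plus_minus_embed: "plus_proj i j A + minus_embed i j (minus_part i j A) = A"
  unfolding plus_proj_def from_parts_split[symmetric] by (rule from_parts_plus_minus)

lemma minus_embed_add: "minus_embed i j (u + v) = minus_embed i j u + minus_embed i j v"
  by (simp add: minus_embed_def vec_eq_iff[of "from_parts i j 0 (u + v) 0"] from_parts_nth scaleR_add_right scaleR_diff_right)

lemma minus_embed_diff: "minus_embed i j (u - v) = minus_embed i j u - minus_embed i j v"
  by (simp add: minus_embed_def vec_eq_iff[of "from_parts i j 0 (u - v) 0"] from_parts_nth scaleR_add_right scaleR_diff_right)

lemma minus_embed_scaleR: "minus_embed i j (c *\<^sub>R v) = c *\<^sub>R minus_embed i j v"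
  by (simp add: minus_embed_def vec_eq_iff[of "from_parts i j 0 (c *\<^sub>R v) 0"] from_parts_nth)

lemma minus_part_diff: "minus_part i j (A - B) = minus_part i j A - minus_part i j B"
  by (simp add: minus_part_def scaleR_diff_right algebra_simps)

context
  fixes i j :: "'n::finite"
  assumes ij: "i \<noteq> j"
begin

lemma minus_part_from_parts: "minus_part i j (from_parts i j a b A) = b"
proof -
  have half: "inverse (sqrt 2) * (inverse (sqrt 2) * t) = t / 2" for t
    by (simp add: field_simps)
  show ?thesis
    using ij by (simp add: vec_eq_iff minus_part_def from_parts_nth right_diff_distrib[symmetric] half)
qed

lemma minus_part_minus_embed: "minus_part i j (minus_embed i j v) = v"
  unfolding minus_embed_def by (rule minus_part_from_parts)

lemma minus_part_plus_proj: "minus_part i j (plus_proj i j A) = 0"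
  unfolding plus_proj_def by (rule minus_part_from_parts)

text \<open>The purpose of the rotated coordinates: in them the exchange is a reflection of the
  minus variable alone.\<close>

lemma exchange_from_parts: "exchange i j (from_parts i j a b A) = from_parts i j a (- b) A"
  using ij by (simp add: vec_eq_iff[of "exchange i j (from_parts i j a b A)"] exchange_nth from_parts_nth)

lemma exchange_minus_embed: "exchange i j (minus_embed i j v) = minus_embed i j (- v)"
  unfolding minus_embed_def by (rule exchange_from_parts)

lemma exchange_plus_proj: "exchange i j (plus_proj i j A) = plus_proj i j A"
  unfolding plus_proj_def exchange_from_parts by simp

text \<open>Adjointness of the two maps; it later splits the phase of the Wigner integral into a
  plus and a minus term.\<close>

lemma inner_minus_embed: "A \<bullet> minus_embed i j v = minus_part i j A \<bullet> v"
proof -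
  have "A \<bullet> minus_embed i j v = (\<Sum>l\<in>UNIV. A $ l \<bullet> minus_embed i j v $ l)"
    by (simp add: inner_vec_def)
  also have "\<dots> = (\<Sum>l\<in>{i, j}. A $ l \<bullet> minus_embed i j v $ l)"
    by (rule sum.mono_neutral_right) (auto simp: minus_embed_def from_parts_nth)
  also have "\<dots> = minus_part i j A \<bullet> v"
    using ij by (simp add: minus_embed_def from_parts_nth minus_part_def inner_diff_left algebra_simps)
  finally show ?thesis .
qed

lemma inner_exchange: "exchange i j A \<bullet> B = A \<bullet> exchange i j B"
proof -
  have s: "(\<Sum>l\<in>UNIV. F l) = F i + F j + (\<Sum>l\<in>UNIV - {i, j}. F l)" for F :: "'n \<Rightarrow> real"
    using sum.subset_diff[of "{i, j}" UNIV F] ij by simp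
  have "(\<Sum>l\<in>UNIV - {i, j}. exchange i j A $ l \<bullet> B $ l) = (\<Sum>l\<in>UNIV - {i, j}. A $ l \<bullet> exchange i j B $ l)"
    by (intro sum.cong refl) (auto simp: exchange_nth)
  then show ?thesis
    unfolding inner_vec_def s using ij by (simp add: exchange_nth)
qed

text \<open>The entries \<open>i\<close> and \<open>j\<close> of \<open>X\<close> are redundant on
  the left. Writing the configuration as a translate of \<open>X\<close> makes translation
  invariance available for null sets.\<close>

lemma from_parts_eq_translate:
  "from_parts i j q x X = X + from_parts i j (q - plus_part i j X) (x - minus_part i j X) 0"
proof -
  have half: "inverse (sqrt 2) * (inverse (sqrt 2) * t) = t / 2" for t
    by (simp add: field_simps)
  show ?thesis
    unfolding vec_eq_iff[of "from_parts i j q x X"]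
    using ij by (simp add: from_parts_nth plus_part_def minus_part_def vec_eq_iff half
        distrib_left right_diff_distrib) (simp add: field_simps)
qed

text \<open>No type of configurations is available for the variables other than the minus one. The integral
  over them is taken over all configurations whose minus part lies in the unit cube, of functions
  which do not depend on the minus part; the cube having measure one, no factor arises.\<close>

lemma nn_integral_slice:
  fixes F :: "('d::finite, 'n) config \<Rightarrow> ennreal"
  assumes F: "F \<in> borel_measurable borel"
  shows "(\<integral>\<^sup>+A. F A \<partial>lborel)
    = (\<integral>\<^sup>+A. \<integral>\<^sup>+v. indicator (cbox 0 One) (minus_part i j A) * F (plus_proj i j A + minus_embed i j v) \<partial>lborel \<partial>lborel)"
proof -
  define Q :: "(real ^ 'd) set" where "Q = cbox 0 One"
  have mQ: "(indicator Q :: real ^ 'd \<Rightarrow> ennreal) \<in> borel_measurable borel" by (simp add: Q_def)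
  have Q1: "emeasure lborel Q = 1"
    unfolding Q_def by (subst emeasure_lborel_cbox) simp_all
  have m1: "(\<lambda>z::('d, 'n) config \<times> (real ^ 'd). indicator Q (minus_part i j (fst z)) * F (fst z + minus_embed i j (snd z))) \<in> borel_measurable borel"
    by (intro borel_measurable_times_ennreal borel_measurable_comp_continuous[OF F] borel_measurable_comp_continuous[OF mQ] continuous_intros)
  have m2: "(\<lambda>z::('d, 'n) config \<times> (real ^ 'd). indicator Q (minus_part i j (fst z) - snd z) * F (fst z)) \<in> borel_measurable borel"
    by (intro borel_measurable_times_ennreal borel_measurable_comp_continuous[OF F] borel_measurable_comp_continuous[OF mQ] continuous_intros)
  have "(\<integral>\<^sup>+A. \<integral>\<^sup>+v. indicator Q (minus_part i j A) * F (plus_proj i j A + minus_embed i j v) \<partial>lborel \<partial>lborel)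
      = (\<integral>\<^sup>+A. \<integral>\<^sup>+v. indicator Q (minus_part i j A) * F (A + minus_embed i j v) \<partial>lborel \<partial>lborel)"
  proof (rule nn_integral_cong)
    fix A :: "('d, 'n) config"
    have m: "(\<lambda>v. indicator Q (minus_part i j A) * F (plus_proj i j A + minus_embed i j v)) \<in> borel_measurable borel"
      by (intro borel_measurable_times_ennreal borel_measurable_const borel_measurable_comp_continuous[OF F] continuous_intros)
    \<comment> \<open>Shifting \<open>v\<close> by the minus part of \<open>A\<close> absorbs the
      projection.\<close>
    have e: "plus_proj i j A + minus_embed i j (minus_part i j A + v) = A + minus_embed i j v" for v
      using plus_proj_plus_minus_embed[of i j A] by (simp add: minus_embed_add add.assoc[symmetric])
    show "(\<integral>\<^sup>+v. indicator Q (minus_part i j A) * F (plus_proj i j A + minus_embed i j v) \<partial>lborel)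
        = (\<integral>\<^sup>+v. indicator Q (minus_part i j A) * F (A + minus_embed i j v) \<partial>lborel)"
      using nn_integral_lborel_translate[OF m, of "minus_part i j A"] unfolding e by simp
  qed
  also have "\<dots> = (\<integral>\<^sup>+v. \<integral>\<^sup>+A. indicator Q (minus_part i j A) * F (A + minus_embed i j v) \<partial>lborel \<partial>lborel)"
    using nn_integral_lborel_pair[OF m1] by simp
  \<comment> \<open>Shifting \<open>A\<close> by the embedded \<open>v\<close> moves the dependence
    on \<open>v\<close> from \<open>F\<close> to the cube, where the \<open>v\<close> integral is
    just its volume.\<close>
  also have "\<dots> = (\<integral>\<^sup>+v. \<integral>\<^sup>+A. indicator Q (minus_part i j A - v) * F A \<partial>lborel \<partial>lborel)"
  proof (rule nn_integral_cong)
    fix v :: "real ^ 'd"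
    have m: "(\<lambda>A. indicator Q (minus_part i j A - v) * F A) \<in> borel_measurable borel"
      by (intro borel_measurable_times_ennreal F borel_measurable_comp_continuous[OF mQ] continuous_intros)
    have "minus_part i j (minus_embed i j v + A) - v = minus_part i j A" for A
      using minus_part_diff[of i j "minus_embed i j v + A" "minus_embed i j v"] by (simp add: minus_part_minus_embed)
    then show "(\<integral>\<^sup>+A. indicator Q (minus_part i j A) * F (A + minus_embed i j v) \<partial>lborel)
        = (\<integral>\<^sup>+A. indicator Q (minus_part i j A - v) * F A \<partial>lborel)"
      using nn_integral_lborel_translate[OF m, of "minus_embed i j v"] by (simp add: add.commute)
  qed
  also have "\<dots> = (\<integral>\<^sup>+A. \<integral>\<^sup>+v. indicator Q (minus_part i j A - v) * F A \<partial>lborel \<partial>lborel)"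
    using nn_integral_lborel_pair[OF m2] by simp
  also have "\<dots> = (\<integral>\<^sup>+A. F A \<partial>lborel)"
  proof (rule nn_integral_cong)
    fix A :: "('d, 'n) config"
    have m: "(\<lambda>v. indicator Q (minus_part i j A - v) :: ennreal) \<in> borel_measurable borel"
      by (intro borel_measurable_comp_continuous[OF mQ] continuous_intros)
    have "(\<integral>\<^sup>+v. indicator Q (minus_part i j A - v) \<partial>lborel) = 1"
      using nn_integral_lborel_affine[of "-1" "indicator Q" "minus_part i j A"] mQ Q1 by (simp add: Q_def)
    then show "(\<integral>\<^sup>+v. indicator Q (minus_part i j A - v) * F A \<partial>lborel) = F A"
      using m by (subst nn_integral_multc) simp_all
  qed
  finally show ?thesis by (simp add: Q_def)
qed

text \<open>The slicing formula as an identity of measures, so that it can be used for complex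
  integrands too.\<close>

lemma lborel_slice:
  "(lborel :: ('d::finite, 'n) config measure) = distr (density lborel (\<lambda>z::('d, 'n) config \<times> (real ^ 'd). indicator (cbox 0 One) (minus_part i j (fst z))))
     borel (\<lambda>z. plus_proj i j (fst z) + minus_embed i j (snd z))"
  (is "_ = distr (density lborel ?w) borel ?\<Phi>")
proof (rule measure_eqI)
  have m\<Phi>: "?\<Phi> \<in> borel_measurable borel"
    by (intro borel_measurable_continuous_onI continuous_intros)
  have mw: "?w \<in> borel_measurable borel"
    by (rule borel_measurable_comp_continuous[of "indicator (cbox 0 One)"]) (auto intro!: continuous_intros)
  fix S :: "('d, 'n) config set" assume "S \<in> sets lborel"
  then have S: "S \<in> sets borel" by simp
  have mS: "(indicator S :: _ \<Rightarrow> ennreal) \<in> borel_measurable borel" using S by simp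
  have mS': "(\<lambda>z::('d, 'n) config \<times> (real ^ 'd). ?w z * indicator S (?\<Phi> z)) \<in> borel_measurable borel"
    using measurable_compose[OF m\<Phi> mS] mw by (intro borel_measurable_times_ennreal) auto
  have "emeasure (distr (density lborel ?w) borel ?\<Phi>) S = (\<integral>\<^sup>+z. indicator S z \<partial>distr (density lborel ?w) borel ?\<Phi>)"
    using S by simp
  also have "\<dots> = (\<integral>\<^sup>+z. indicator S (?\<Phi> z) \<partial>density lborel ?w)"
    using m\<Phi> mS by (intro nn_integral_distr) simp_all
  also have "\<dots> = (\<integral>\<^sup>+z. ?w z * indicator S (?\<Phi> z) \<partial>lborel)"
    using mw measurable_compose[OF m\<Phi> mS] by (intro nn_integral_density) simp_all
  also have "\<dots> = (\<integral>\<^sup>+A. indicator S A \<partial>lborel)"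
    using nn_integral_lborel_pair(1)[OF mS'] nn_integral_slice[OF mS] by simp
  also have "\<dots> = emeasure lborel S" using S by simp
  finally show "emeasure lborel S = emeasure (distr (density lborel ?w) borel ?\<Phi>) S" ..
qed simp

lemma integral_slice:
  fixes F :: "('d::finite, 'n) config \<Rightarrow> complex"
  assumes F: "integrable lborel F"
  shows "(LINT A|lborel. F A)
    = (LINT v|lborel. LINT A|lborel. indicator (cbox 0 One) (minus_part i j A) * F (plus_proj i j A + minus_embed i j v))"
proof -
  let ?w = "\<lambda>z::('d, 'n) config \<times> (real ^ 'd). indicator (cbox 0 One) (minus_part i j (fst z)) :: real"
  let ?\<Phi> = "\<lambda>z::('d, 'n) config \<times> (real ^ 'd). plus_proj i j (fst z) + minus_embed i j (snd z) :: ('d, 'n) config"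
  have m\<Phi>: "?\<Phi> \<in> borel_measurable borel"
    by (intro borel_measurable_continuous_onI continuous_intros)
  have mw: "?w \<in> borel_measurable borel"
    by (rule borel_measurable_comp_continuous[of "indicator (cbox 0 One)"]) (auto intro!: continuous_intros)
  have mF: "F \<in> borel_measurable borel" using borel_measurable_integrable[OF F] by simp
  have mF\<Phi>: "(\<lambda>z. F (?\<Phi> z)) \<in> borel_measurable lborel" using measurable_compose[OF m\<Phi> mF] by simp
  have L: "lborel = distr (density lborel (\<lambda>z. ennreal (?w z))) borel ?\<Phi>"
    by (subst lborel_slice) (simp add: ennreal_indicator)
  have "integrable (distr (density lborel (\<lambda>z. ennreal (?w z))) borel ?\<Phi>) F"
    using F L by simp
  then have "integrable (density lborel (\<lambda>z. ennreal (?w z))) (\<lambda>z. F (?\<Phi> z))"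
    using m\<Phi> mF by (subst (asm) integrable_distr_eq) simp_all
  then have I: "integrable lborel (\<lambda>z. ?w z *\<^sub>R F (?\<Phi> z))"
    using mw mF\<Phi> by (subst (asm) integrable_density) simp_all
  have "(LINT A|lborel. F A) = (LINT A|distr (density lborel (\<lambda>z. ennreal (?w z))) borel ?\<Phi>. F A)"
    using L by simp
  also have "\<dots> = (LINT z|density lborel (\<lambda>z. ennreal (?w z)). F (?\<Phi> z))"
    using m\<Phi> mF by (intro integral_distr) simp_all
  also have "\<dots> = (LINT z|lborel. ?w z *\<^sub>R F (?\<Phi> z))"
    using mw mF\<Phi> by (intro integral_density) simp_all
  also have "\<dots> = (LINT v|lborel. LINT A|lborel. ?w (A, v) *\<^sub>R F (?\<Phi> (A, v)))"
    by (rule integral_lborel_pair'[OF I])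
  finally show ?thesis by (simp add: scaleR_conv_of_real of_real_indicator)
qed

end

section \<open>Wigner functions of dominated kernels\<close>

lemma borel_measurable_kernel_comp:
  assumes "(\<lambda>z. K (fst z) (snd z)) \<in> borel_measurable borel" "continuous_on UNIV f" "continuous_on UNIV g"
  shows "(\<lambda>p. K (f p) (g p)) \<in> borel_measurable borel"
  using borel_measurable_comp_continuous[OF assms(1) continuous_on_Pair[OF assms(2,3)]] by simp

text \<open>A non-integrable function has integral 0 by convention, so the bound can be applied
  before integrability is known.\<close>

lemma norm_integral_le_nn_integral:
  fixes f :: "'a \<Rightarrow> complex"
  shows "ennreal (cmod (LINT x|M. f x)) \<le> (\<integral>\<^sup>+x. ennreal (cmod (f x)) \<partial>M)"
proof (cases "integrable M f")
  case True
  then show ?thesis by (rule integral_norm_bound_ennreal)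
qed (simp add: not_integrable_integral_eq)

text \<open>The additive bound makes \<open>G\<close> integrable on every line in either direction,
  since \<open>S1\<close> and \<open>S2\<close> are evaluated at affine functions of the remaining
  variable. The multiplicative bound gives square integrability in the plane, where the two kernel
  arguments are independent coordinates.\<close>

lemma sections_of_dominated_kernel:
  fixes k :: "'a::euclidean_space \<Rightarrow> 'a \<Rightarrow> complex"
  assumes h: "h > 0" and mk: "(\<lambda>z. k (fst z) (snd z)) \<in> borel_measurable borel"
    and mS: "S1 \<in> borel_measurable borel" "S2 \<in> borel_measurable borel"
    and S1: "(\<integral>\<^sup>+a. S1 a \<partial>lborel) < \<infinity>" and S2: "(\<integral>\<^sup>+a. S2 a \<partial>lborel) < \<infinity>"
    and add: "\<And>a b. ennreal (cmod (k a b)) \<le> S1 a + S2 b"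
    and mult: "\<And>a b. ennreal ((cmod (k a b))\<^sup>2) \<le> S1 a * S2 b"
  defines "G \<equiv> \<lambda>z. k (fst z + (h / 2) *\<^sub>R snd z) (fst z - (h / 2) *\<^sub>R snd z)"
  shows "square_integrable G" "\<And>x. integrable lborel (\<lambda>v. G (x, v))" "\<And>v. integrable lborel (\<lambda>x. G (x, v))"
proof -
  have mG: "G \<in> borel_measurable borel"
    unfolding G_def by (intro borel_measurable_kernel_comp[OF mk] continuous_intros)
  have mGs: "(\<lambda>v. G (x, v)) \<in> borel_measurable borel" "(\<lambda>v. G (v, x)) \<in> borel_measurable borel" for x
    by (intro borel_measurable_comp_continuous[OF mG] continuous_intros)+
  have aff_fin: "(\<integral>\<^sup>+v. S (t + c *\<^sub>R v) \<partial>lborel) < \<infinity>"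
    if "S \<in> borel_measurable borel" "(\<integral>\<^sup>+a. S a \<partial>lborel) < \<infinity>" "c \<noteq> 0" for S :: "'a \<Rightarrow> ennreal" and t c
  proof -
    have "ennreal (\<bar>c\<bar> ^ DIM('a)) * (\<integral>\<^sup>+v. S (t + c *\<^sub>R v) \<partial>lborel) < \<infinity>"
      using nn_integral_lborel_affine[OF that(3,1), of t] that(2) by (simp only:)
    moreover have "0 < ennreal (\<bar>c\<bar> ^ DIM('a))" using that(3) by (simp only: ennreal_less_zero_iff) simp
    ultimately show ?thesis unfolding ennreal_mult_less_top infinity_ennreal_def by force
  qed
  have mS': "(\<lambda>v. S (t + c *\<^sub>R v)) \<in> borel_measurable borel" if "S \<in> borel_measurable borel" for S :: "'a \<Rightarrow> ennreal" and t c
    by (intro borel_measurable_comp_continuous[OF that] continuous_intros)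
  show "integrable lborel (\<lambda>v. G (x, v))" for x
  proof -
    have "(\<integral>\<^sup>+v. ennreal (cmod (G (x, v))) \<partial>lborel) \<le> (\<integral>\<^sup>+v. S1 (x + (h / 2) *\<^sub>R v) + S2 (x + (- (h / 2)) *\<^sub>R v) \<partial>lborel)"
      using add by (intro nn_integral_mono) (simp add: G_def)
    also have "\<dots> = (\<integral>\<^sup>+v. S1 (x + (h / 2) *\<^sub>R v) \<partial>lborel) + (\<integral>\<^sup>+v. S2 (x + (- (h / 2)) *\<^sub>R v) \<partial>lborel)"
      using mS'[OF mS(1)] mS'[OF mS(2)] by (intro nn_integral_add) (simp_all only: measurable_lborel2)
    also have "\<dots> < \<infinity>"
      using aff_fin[OF mS(1) S1, of "h / 2" x] aff_fin[OF mS(2) S2, of "- (h / 2)" x] h by simp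
    finally show ?thesis using mGs(1)[of x] by (simp add: integrable_iff_bounded)
  qed
  show "integrable lborel (\<lambda>x. G (x, v))" for v
  proof -
    have "(\<integral>\<^sup>+x. ennreal (cmod (G (x, v))) \<partial>lborel) \<le> (\<integral>\<^sup>+x. S1 ((h / 2) *\<^sub>R v + 1 *\<^sub>R x) + S2 (- ((h / 2) *\<^sub>R v) + 1 *\<^sub>R x) \<partial>lborel)"
      using add[of "_ + (h / 2) *\<^sub>R v" "_ - (h / 2) *\<^sub>R v"] by (intro nn_integral_mono) (simp add: G_def add.commute)
    also have "\<dots> = (\<integral>\<^sup>+x. S1 ((h / 2) *\<^sub>R v + 1 *\<^sub>R x) \<partial>lborel) + (\<integral>\<^sup>+x. S2 (- ((h / 2) *\<^sub>R v) + 1 *\<^sub>R x) \<partial>lborel)"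
      using mS'[OF mS(1)] mS'[OF mS(2)] by (intro nn_integral_add) (simp_all only: measurable_lborel2)
    also have "\<dots> < \<infinity>"
      using aff_fin[OF mS(1) S1, of 1 "(h / 2) *\<^sub>R v"] aff_fin[OF mS(2) S2, of 1 "- ((h / 2) *\<^sub>R v)"] by simp
    finally show ?thesis using mGs(2)[of v] by (simp add: integrable_iff_bounded)
  qed
  show "square_integrable G"
  proof -
    have mp: "(\<lambda>z::'a \<times> 'a. S1 (fst z + (h / 2) *\<^sub>R snd z) * S2 (fst z - (h / 2) *\<^sub>R snd z)) \<in> borel_measurable borel"
      by (intro borel_measurable_times_ennreal borel_measurable_comp_continuous[OF mS(1)]
          borel_measurable_comp_continuous[OF mS(2)] continuous_intros)
    have mp2: "(\<lambda>z::'a \<times> 'a. S1 (fst z) * S2 (fst z - h *\<^sub>R snd z)) \<in> borel_measurable borel"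
      by (intro borel_measurable_times_ennreal borel_measurable_comp_continuous[OF mS(1)]
          borel_measurable_comp_continuous[OF mS(2)] continuous_intros)
    have "(\<integral>\<^sup>+z. ennreal ((cmod (G z))\<^sup>2) \<partial>lborel)
        \<le> (\<integral>\<^sup>+z. S1 (fst z + (h / 2) *\<^sub>R snd z) * S2 (fst z - (h / 2) *\<^sub>R snd z) \<partial>lborel)"
      unfolding G_def by (intro nn_integral_mono mult)
    also have "\<dots> = (\<integral>\<^sup>+v. \<integral>\<^sup>+x. S1 (x + (h / 2) *\<^sub>R v) * S2 (x - (h / 2) *\<^sub>R v) \<partial>lborel \<partial>lborel)"
      using nn_integral_lborel_pair(2)[OF mp] by simp
    \<comment> \<open>Shifting \<open>x\<close> frees the argument of \<open>S1\<close>; after the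
      interchange the \<open>v\<close> integral of \<open>S2\<close> is a rescaling of its total
      mass.\<close>
    also have "\<dots> = (\<integral>\<^sup>+v. \<integral>\<^sup>+x. S1 x * S2 (x - h *\<^sub>R v) \<partial>lborel \<partial>lborel)"
    proof (rule nn_integral_cong)
      fix v :: 'a
      have m: "(\<lambda>x. S1 x * S2 (x - h *\<^sub>R v)) \<in> borel_measurable borel"
        by (intro borel_measurable_times_ennreal mS borel_measurable_comp_continuous[OF mS(2)] continuous_intros)
      have "(h / 2) *\<^sub>R v + x - h *\<^sub>R v = x - (h / 2) *\<^sub>R v" for x
        by (simp add: algebra_simps scaleR_left_distrib[symmetric])
      note e = this
      show "(\<integral>\<^sup>+x. S1 (x + (h / 2) *\<^sub>R v) * S2 (x - (h / 2) *\<^sub>R v) \<partial>lborel) = (\<integral>\<^sup>+x. S1 x * S2 (x - h *\<^sub>R v) \<partial>lborel)"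
        using nn_integral_lborel_translate[OF m, of "(h / 2) *\<^sub>R v"] unfolding e
        by (simp only: add.commute[of "(h / 2) *\<^sub>R v"])
    qed
    also have "\<dots> = (\<integral>\<^sup>+x. \<integral>\<^sup>+v. S1 x * S2 (x - h *\<^sub>R v) \<partial>lborel \<partial>lborel)"
      using nn_integral_lborel_pair[OF mp2] by simp
    also have "\<dots> = (\<integral>\<^sup>+x. S1 x * (ennreal (inverse (h ^ DIM('a))) * (\<integral>\<^sup>+a. S2 a \<partial>lborel)) \<partial>lborel)"
    proof (rule nn_integral_cong)
      fix x :: 'a
      have "(\<integral>\<^sup>+v. S1 x * S2 (x - h *\<^sub>R v) \<partial>lborel) = S1 x * (\<integral>\<^sup>+v. S2 (x + (- h) *\<^sub>R v) \<partial>lborel)"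
        using mS'[OF mS(2), of x "- h"] by (subst nn_integral_cmult[symmetric]) simp_all
      moreover have "(\<integral>\<^sup>+a. S2 a \<partial>lborel) = ennreal (h ^ DIM('a)) * (\<integral>\<^sup>+v. S2 (x + (- h) *\<^sub>R v) \<partial>lborel)"
        using nn_integral_lborel_affine[of "- h" S2 x] mS(2) h by simp
      moreover have "ennreal (inverse (h ^ DIM('a))) * ennreal (h ^ DIM('a)) = 1"
        using h by (subst ennreal_mult[symmetric]) simp_all
      ultimately show "(\<integral>\<^sup>+v. S1 x * S2 (x - h *\<^sub>R v) \<partial>lborel)
          = S1 x * (ennreal (inverse (h ^ DIM('a))) * (\<integral>\<^sup>+a. S2 a \<partial>lborel))"
        by (simp add: mult.assoc[symmetric])
    qed
    also have "\<dots> = (\<integral>\<^sup>+x. S1 x \<partial>lborel) * (ennreal (inverse (h ^ DIM('a))) * (\<integral>\<^sup>+a. S2 a \<partial>lborel))"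
      using mS(1) by (intro nn_integral_multc) simp
    also have "\<dots> < \<infinity>"
      using S1 S2 by (simp add: ennreal_mult_less_top)
    finally show ?thesis using mG by (simp add: square_integrable_iff_nn_integral)
  qed
qed

text \<open>The kernel in the minus variables, with the Wigner transform already performed in all other
  variables.\<close>

definition partial_kernel ::
    "real \<Rightarrow> 'n \<Rightarrow> 'n \<Rightarrow> ('d::finite, 'n::finite) kernel \<Rightarrow> ('d, 'n) config \<Rightarrow> ('d, 'n) config \<Rightarrow>
     real ^ 'd \<Rightarrow> real ^ 'd \<Rightarrow> complex" where
  "partial_kernel h i j K Y \<Xi> a b = (LINT A|lborel. indicator (cbox 0 One) (minus_part i j A) *
     (K (Y + (h / 2) *\<^sub>R plus_proj i j A + minus_embed i j a) (Y - (h / 2) *\<^sub>R plus_proj i j A + minus_embed i j b) *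
      exp (- \<i> * of_real (\<Xi> \<bullet> plus_proj i j A))))"

text \<open>The squared norm of \<open>B\<close> over the plus variables, at minus offset
  \<open>a\<close>. The scale \<open>c\<close> is \<open>h / 2\<close> for the first and
  \<open>- (h / 2)\<close> for the second argument of the kernel.\<close>

definition slice_mass ::
    "'n \<Rightarrow> 'n \<Rightarrow> (('d::finite, 'n::finite) config \<Rightarrow> real) \<Rightarrow> ('d, 'n) config \<Rightarrow> real \<Rightarrow> real ^ 'd \<Rightarrow> ennreal" where
  "slice_mass i j B Y c a = (\<integral>\<^sup>+A. indicator (cbox 0 One) (minus_part i j A) *
     ennreal ((B (Y + c *\<^sub>R plus_proj i j A + minus_embed i j a))\<^sup>2) \<partial>lborel)"

lemma borel_measurable_indicator_minus_part:
  "(\<lambda>z. indicator (cbox 0 One) (minus_part i j (f z)) :: 'b::{real_normed_algebra_1, second_countable_topology}) \<in> borel_measurable borel"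
  if "continuous_on UNIV f"
  by (rule borel_measurable_comp_continuous[of "indicator (cbox 0 One)"]) (use that in \<open>auto intro!: continuous_intros\<close>)

lemma borel_measurable_ennreal_indicator_minus_part:
  "(\<lambda>z. indicator (cbox 0 One) (minus_part i j (f z)) :: ennreal) \<in> borel_measurable borel"
  if "continuous_on UNIV f"
  by (rule borel_measurable_comp_continuous[of "indicator (cbox 0 One)"]) (use that in \<open>auto intro!: continuous_intros\<close>)

lemma borel_measurable_slice_mass_integrand:
  fixes B :: "('d::finite, 'n::finite) config \<Rightarrow> real"
  assumes B: "B \<in> borel_measurable borel"
  shows "(\<lambda>z. indicator (cbox 0 One) (minus_part i j (snd z)) *
     ennreal ((B (Y + c *\<^sub>R plus_proj i j (snd z) + minus_embed i j (fst z)))\<^sup>2)) \<in> borel_measurable borel"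
proof (intro borel_measurable_times_ennreal borel_measurable_ennreal_indicator_minus_part continuous_intros)
  have "(\<lambda>A. ennreal ((B A)\<^sup>2)) \<in> borel_measurable borel" using B by measurable
  then show "(\<lambda>z. ennreal ((B (Y + c *\<^sub>R plus_proj i j (snd z) + minus_embed i j (fst z)))\<^sup>2)) \<in> borel_measurable borel"
    by (rule borel_measurable_comp_continuous) (intro continuous_intros)
qed

lemma borel_measurable_slice_mass:
  assumes "B \<in> borel_measurable borel"
  shows "slice_mass i j B Y c \<in> borel_measurable borel"
  using borel_measurable_nn_integral_snd[OF borel_measurable_slice_mass_integrand[OF assms]]
  unfolding slice_mass_def[abs_def] by simp

text \<open>After rescaling \<open>a\<close> by \<open>c\<close> the plus and minus parts carry the
  same factor, and the slicing formula reassembles them into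
  \<open>B (Y + c *\<^sub>R A)\<close>.\<close>

lemma nn_integral_slice_mass:
  fixes B :: "('d::finite, 'n::finite) config \<Rightarrow> real"
  assumes ij: "i \<noteq> j" and B: "B \<in> borel_measurable borel" and fin: "(\<integral>\<^sup>+A. ennreal ((B A)\<^sup>2) \<partial>lborel) < \<infinity>" and c: "c \<noteq> 0"
  shows "(\<integral>\<^sup>+a. slice_mass i j B Y c a \<partial>lborel) < \<infinity>"
proof -
  have mB: "(\<lambda>A. ennreal ((B A)\<^sup>2)) \<in> borel_measurable borel" using B by measurable
  have m1: "(\<lambda>A. ennreal ((B (Y + c *\<^sub>R A))\<^sup>2)) \<in> borel_measurable borel"
    by (rule borel_measurable_comp_continuous[OF mB]) (intro continuous_intros)
  have m2: "(\<lambda>z::(real ^ 'd) \<times> ('d, 'n) config. indicator (cbox 0 One) (minus_part i j (snd z)) *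
     ennreal ((B (Y + c *\<^sub>R plus_proj i j (snd z) + minus_embed i j (c *\<^sub>R fst z)))\<^sup>2)) \<in> borel_measurable borel"
    using borel_measurable_comp_continuous[OF borel_measurable_slice_mass_integrand[OF B, of i j Y c], of "\<lambda>z. (c *\<^sub>R fst z, snd z)"]
    by (simp add: continuous_intros)
  have "(\<integral>\<^sup>+a. slice_mass i j B Y c a \<partial>lborel)
      = ennreal (\<bar>c\<bar> ^ DIM(real ^ 'd)) * (\<integral>\<^sup>+v. slice_mass i j B Y c (c *\<^sub>R v) \<partial>lborel)"
    using nn_integral_lborel_affine[OF c borel_measurable_slice_mass[OF B], where t = 0] by simp
  also have "(\<integral>\<^sup>+v. slice_mass i j B Y c (c *\<^sub>R v) \<partial>lborel)
      = (\<integral>\<^sup>+A. \<integral>\<^sup>+v. indicator (cbox 0 One) (minus_part i j A) *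
     ennreal ((B (Y + c *\<^sub>R plus_proj i j A + minus_embed i j (c *\<^sub>R v)))\<^sup>2) \<partial>lborel \<partial>lborel)"
    unfolding slice_mass_def using nn_integral_lborel_pair[OF m2] by simp
  also have "\<dots> = (\<integral>\<^sup>+A. ennreal ((B (Y + c *\<^sub>R A))\<^sup>2) \<partial>lborel)"
    unfolding nn_integral_slice[OF ij m1] by (simp add: minus_embed_scaleR scaleR_add_right add.assoc)
  finally have eq: "(\<integral>\<^sup>+a. slice_mass i j B Y c a \<partial>lborel)
      = ennreal (\<bar>c\<bar> ^ DIM(real ^ 'd)) * (\<integral>\<^sup>+A. ennreal ((B (Y + c *\<^sub>R A))\<^sup>2) \<partial>lborel)" .
  have "ennreal (\<bar>c\<bar> ^ DIM(('d, 'n) config)) * (\<integral>\<^sup>+A. ennreal ((B (Y + c *\<^sub>R A))\<^sup>2) \<partial>lborel) < \<infinity>"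
    using nn_integral_lborel_affine[OF c mB, of Y] fin by (simp only:)
  moreover have "0 < ennreal (\<bar>c\<bar> ^ DIM(('d, 'n) config))" using c by (simp only: ennreal_less_zero_iff) simp
  ultimately have "(\<integral>\<^sup>+A. ennreal ((B (Y + c *\<^sub>R A))\<^sup>2) \<partial>lborel) < top"
    unfolding ennreal_mult_less_top infinity_ennreal_def by force
  then show ?thesis
    unfolding eq infinity_ennreal_def ennreal_mult_less_top by (simp only: ennreal_less_top simp_thms)
qed

text \<open>The integrand is at most a product of one factor depending on \<open>a\<close> and one
  depending on \<open>b\<close>. The mean inequality gives the additive bound, Cauchy-Schwarz over
  the plus variables the multiplicative one.\<close>

lemma partial_kernel_bounds:
  fixes K :: "('d::finite, 'n::finite) kernel"
  assumes mB1[measurable]: "B1 \<in> borel_measurable borel" and mB2[measurable]: "B2 \<in> borel_measurable borel"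
    and K: "\<And>X Y. cmod (K X Y) \<le> B1 X * B2 Y"
    and B0: "\<And>X. B1 X \<ge> 0" "\<And>X. B2 X \<ge> 0"
  shows "ennreal (cmod (partial_kernel h i j K Y \<Xi> a b)) \<le> slice_mass i j B1 Y (h / 2) a + slice_mass i j B2 Y (- (h / 2)) b"
    and "ennreal ((cmod (partial_kernel h i j K Y \<Xi> a b))\<^sup>2) \<le> slice_mass i j B1 Y (h / 2) a * slice_mass i j B2 Y (- (h / 2)) b"
proof -
  \<comment> \<open>The indicator of the cube equals its square, so a copy of it goes into each
    factor.\<close>
  define q :: "('d, 'n) config \<Rightarrow> real" where "q A = indicator (cbox 0 One) (minus_part i j A)" for A
  have mq: "q \<in> borel_measurable borel"
    unfolding q_def[abs_def] by (rule borel_measurable_indicator_minus_part) (intro continuous_intros)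
  have q01: "q A = 0 \<or> q A = 1" for A by (simp add: q_def indicator_def)
  define b1 where "b1 A = q A * B1 (Y + (h / 2) *\<^sub>R plus_proj i j A + minus_embed i j a)" for A
  define b2 where "b2 A = q A * B2 (Y + (- (h / 2)) *\<^sub>R plus_proj i j A + minus_embed i j b)" for A
  have b0: "b1 A \<ge> 0" "b2 A \<ge> 0" for A
    using B0 q01[of A] by (auto simp: b1_def b2_def)
  have mb[measurable]: "b1 \<in> borel_measurable borel" "b2 \<in> borel_measurable borel"
    unfolding b1_def[abs_def] b2_def[abs_def]
    by (intro borel_measurable_times mq borel_measurable_comp_continuous[OF mB1] borel_measurable_comp_continuous[OF mB2] continuous_intros)+
  have s1: "slice_mass i j B1 Y (h / 2) a = (\<integral>\<^sup>+A. (ennreal (b1 A))\<^sup>2 \<partial>lborel)"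
    unfolding slice_mass_def using b0
    by (intro nn_integral_cong) (auto simp: b1_def q_def indicator_def ennreal_power B0)
  have s2: "slice_mass i j B2 Y (- (h / 2)) b = (\<integral>\<^sup>+A. (ennreal (b2 A))\<^sup>2 \<partial>lborel)"
    unfolding slice_mass_def using b0
    by (intro nn_integral_cong) (auto simp: b2_def q_def indicator_def ennreal_power B0)
  have le: "ennreal (cmod (partial_kernel h i j K Y \<Xi> a b)) \<le> (\<integral>\<^sup>+A. ennreal (b1 A) * ennreal (b2 A) \<partial>lborel)"
  proof -
    have "ennreal (cmod (partial_kernel h i j K Y \<Xi> a b)) \<le> (\<integral>\<^sup>+A. ennreal (cmod (indicator (cbox 0 One) (minus_part i j A) *
     (K (Y + (h / 2) *\<^sub>R plus_proj i j A + minus_embed i j a) (Y - (h / 2) *\<^sub>R plus_proj i j A + minus_embed i j b) *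
      exp (- \<i> * of_real (\<Xi> \<bullet> plus_proj i j A))))) \<partial>lborel)"
      unfolding partial_kernel_def by (rule norm_integral_le_nn_integral)
    also have "\<dots> \<le> (\<integral>\<^sup>+A. ennreal (b1 A * b2 A) \<partial>lborel)"
    proof (intro nn_integral_mono ennreal_leI)
      fix A
      show "cmod (indicator (cbox 0 One) (minus_part i j A) *
     (K (Y + (h / 2) *\<^sub>R plus_proj i j A + minus_embed i j a) (Y - (h / 2) *\<^sub>R plus_proj i j A + minus_embed i j b) *
      exp (- \<i> * of_real (\<Xi> \<bullet> plus_proj i j A)))) \<le> b1 A * b2 A"
        using K[of "Y + (h / 2) *\<^sub>R plus_proj i j A + minus_embed i j a" "Y - (h / 2) *\<^sub>R plus_proj i j A + minus_embed i j b"]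
        by (auto simp: norm_mult b1_def b2_def q_def indicator_def)
    qed
    finally show ?thesis using b0 by (simp add: ennreal_mult)
  qed
  show "ennreal (cmod (partial_kernel h i j K Y \<Xi> a b)) \<le> slice_mass i j B1 Y (h / 2) a + slice_mass i j B2 Y (- (h / 2)) b"
  proof -
    have "(\<integral>\<^sup>+A. ennreal (b1 A) * ennreal (b2 A) \<partial>lborel) \<le> (\<integral>\<^sup>+A. (ennreal (b1 A))\<^sup>2 + (ennreal (b2 A))\<^sup>2 \<partial>lborel)"
    proof (rule nn_integral_mono)
      fix A
      have "b1 A * b2 A \<le> (b1 A)\<^sup>2 + (b2 A)\<^sup>2"
        by (rule order_trans[OF product_le_mean_squares]) simp
      then show "ennreal (b1 A) * ennreal (b2 A) \<le> (ennreal (b1 A))\<^sup>2 + (ennreal (b2 A))\<^sup>2"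
        using b0[of A] by (simp add: ennreal_mult[symmetric] ennreal_power ennreal_plus[symmetric] ennreal_leI del: ennreal_plus)
    qed
    also have "\<dots> = slice_mass i j B1 Y (h / 2) a + slice_mass i j B2 Y (- (h / 2)) b"
      unfolding s1 s2 by (intro nn_integral_add) simp_all
    finally show ?thesis using le by (rule order_trans[rotated])
  qed
  have "ennreal ((cmod (partial_kernel h i j K Y \<Xi> a b))\<^sup>2) = (ennreal (cmod (partial_kernel h i j K Y \<Xi> a b)))\<^sup>2"
    by (simp add: ennreal_power)
  also have "\<dots> \<le> (\<integral>\<^sup>+A. ennreal (b1 A) * ennreal (b2 A) \<partial>lborel)\<^sup>2"
    by (intro power_mono le) simp
  also have "\<dots> \<le> slice_mass i j B1 Y (h / 2) a * slice_mass i j B2 Y (- (h / 2)) b"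
    unfolding s1 s2 by (rule Cauchy_Schwarz_nn_integral) simp_all
  finally show "ennreal ((cmod (partial_kernel h i j K Y \<Xi> a b))\<^sup>2) \<le> slice_mass i j B1 Y (h / 2) a * slice_mass i j B2 Y (- (h / 2)) b" .
qed

lemma borel_measurable_partial_kernel:
  fixes K :: "('d::finite, 'n::finite) kernel"
  assumes mK: "(\<lambda>z. K (fst z) (snd z)) \<in> borel_measurable borel"
  shows "(\<lambda>z. partial_kernel h i j K Y \<Xi> (fst z) (snd z)) \<in> borel_measurable borel"
proof -
  have "(\<lambda>p::((real ^ 'd) \<times> (real ^ 'd)) \<times> ('d, 'n) config. indicator (cbox 0 One) (minus_part i j (snd p)) *
     (K (Y + (h / 2) *\<^sub>R plus_proj i j (snd p) + minus_embed i j (fst (fst p))) (Y - (h / 2) *\<^sub>R plus_proj i j (snd p) + minus_embed i j (snd (fst p))) *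
      exp (- \<i> * complex_of_real (\<Xi> \<bullet> plus_proj i j (snd p))))) \<in> borel_measurable borel"
  proof (intro borel_measurable_times)
    show "(\<lambda>p::((real ^ 'd) \<times> (real ^ 'd)) \<times> ('d, 'n) config. indicator (cbox 0 One) (minus_part i j (snd p)) :: complex) \<in> borel_measurable borel"
      by (rule borel_measurable_indicator_minus_part) (intro continuous_intros)
    show "(\<lambda>p::((real ^ 'd) \<times> (real ^ 'd)) \<times> ('d, 'n) config. K (Y + (h / 2) *\<^sub>R plus_proj i j (snd p) + minus_embed i j (fst (fst p))) (Y - (h / 2) *\<^sub>R plus_proj i j (snd p) + minus_embed i j (snd (fst p)))) \<in> borel_measurable borel"
      by (intro borel_measurable_kernel_comp[OF mK] continuous_intros)
    show "(\<lambda>p::((real ^ 'd) \<times> (real ^ 'd)) \<times> ('d, 'n) config. exp (- \<i> * complex_of_real (\<Xi> \<bullet> plus_proj i j (snd p)))) \<in> borel_measurable borel"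
      by (intro borel_measurable_continuous_onI continuous_intros)
  qed
  from borel_measurable_integral_snd[OF this] show ?thesis by (simp add: partial_kernel_def)
qed

text \<open>The product bound is below a mean of squares. It holds everywhere, so the line through
  every \<open>Y\<close> is covered and the Wigner integral exists at each point. The two weights
  differ for an exchanged kernel.\<close>

lemma integrable_dominated_kernel_line:
  fixes K :: "('d::finite, 'n::finite) kernel"
  assumes mK: "(\<lambda>z. K (fst z) (snd z)) \<in> borel_measurable borel"
    and mB: "B1 \<in> borel_measurable borel" "B2 \<in> borel_measurable borel"
    and K: "\<And>X Y. cmod (K X Y) \<le> B1 X * B2 Y"
    and B0: "\<And>X. B1 X \<ge> 0" "\<And>X. B2 X \<ge> 0"
    and fin: "(\<integral>\<^sup>+A. ennreal ((B1 A)\<^sup>2) \<partial>lborel) < \<infinity>" "(\<integral>\<^sup>+A. ennreal ((B2 A)\<^sup>2) \<partial>lborel) < \<infinity>"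
    and c: "c \<noteq> 0"
  shows "integrable lborel (\<lambda>\<delta>. K (Y + c *\<^sub>R \<delta>) (Y - c *\<^sub>R \<delta>))"
proof -
  have "integrable lborel (\<lambda>A. (B1 A)\<^sup>2)" "integrable lborel (\<lambda>A. (B2 A)\<^sup>2)"
    using mB fin by (simp_all add: integrable_iff_bounded)
  from integrable_lborel_affine[OF c this(1), of Y] integrable_lborel_affine[OF _ this(2), of "- c" Y] c
  have "integrable lborel (\<lambda>\<delta>. ((B1 (Y + c *\<^sub>R \<delta>))\<^sup>2 + (B2 (Y - c *\<^sub>R \<delta>))\<^sup>2) / 2)" by simp
  then show ?thesis
  proof (rule Bochner_Integration.integrable_bound)
    have "(\<lambda>\<delta>. K (Y + c *\<^sub>R \<delta>) (Y - c *\<^sub>R \<delta>)) \<in> borel_measurable borel"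
      by (intro borel_measurable_kernel_comp[OF mK] continuous_intros)
    then show "(\<lambda>\<delta>. K (Y + c *\<^sub>R \<delta>) (Y - c *\<^sub>R \<delta>)) \<in> borel_measurable lborel" by simp
    show "AE \<delta> in lborel. norm (K (Y + c *\<^sub>R \<delta>) (Y - c *\<^sub>R \<delta>)) \<le> norm (((B1 (Y + c *\<^sub>R \<delta>))\<^sup>2 + (B2 (Y - c *\<^sub>R \<delta>))\<^sup>2) / 2)"
    proof (rule AE_I2)
      fix \<delta>
      show "norm (K (Y + c *\<^sub>R \<delta>) (Y - c *\<^sub>R \<delta>)) \<le> norm (((B1 (Y + c *\<^sub>R \<delta>))\<^sup>2 + (B2 (Y - c *\<^sub>R \<delta>))\<^sup>2) / 2)"
        using order_trans[OF K product_le_mean_squares, of "Y + c *\<^sub>R \<delta>" "Y - c *\<^sub>R \<delta>"] by simp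
    qed
  qed
qed

text \<open>Splitting \<open>\<delta>\<close> into plus and minus parts separates the kernel
  arguments, and orthogonality separates the phase. The inner integral is the partial kernel, the
  outer one its Fourier transform in \<open>v\<close>.\<close>

lemma wigner_eq_fourier_partial_kernel:
  fixes K :: "('d::finite, 'n::finite) kernel"
  assumes ij: "i \<noteq> j" and int: "\<And>Y. integrable lborel (\<lambda>\<delta>. K (Y + (h / 2) *\<^sub>R \<delta>) (Y - (h / 2) *\<^sub>R \<delta>))"
    and \<Xi>: "minus_part i j \<Xi> = 0"
  shows "wigner h K (Y + minus_embed i j x) (\<Xi> + minus_embed i j \<xi>)
    = 1 / of_real ((2 * pi) ^ (CARD('d) * CARD('n))) *
      fourier (\<lambda>v. partial_kernel h i j K Y \<Xi> (x + (h / 2) *\<^sub>R v) (x - (h / 2) *\<^sub>R v)) \<xi>"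
proof -
  define Z where "Z = Y + minus_embed i j x"
  define F where "F \<delta> = K (Z + (h / 2) *\<^sub>R \<delta>) (Z - (h / 2) *\<^sub>R \<delta>) *
      exp (- \<i> * of_real ((\<Xi> + minus_embed i j \<xi>) \<bullet> \<delta>))" for \<delta>
  have Fi: "integrable lborel F"
    unfolding F_def[abs_def] by (rule integrable_mult_exp_inner(1)[OF int])
  have arg1: "Z + (h / 2) *\<^sub>R (plus_proj i j A + minus_embed i j v) = Y + (h / 2) *\<^sub>R plus_proj i j A + minus_embed i j (x + (h / 2) *\<^sub>R v)" for A v
    by (simp add: Z_def minus_embed_add minus_embed_scaleR scaleR_add_right algebra_simps)
  have arg2: "Z - (h / 2) *\<^sub>R (plus_proj i j A + minus_embed i j v) = Y - (h / 2) *\<^sub>R plus_proj i j A + minus_embed i j (x - (h / 2) *\<^sub>R v)" for A v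
    by (simp add: Z_def minus_embed_diff minus_embed_scaleR scaleR_add_right algebra_simps)
  have inn: "(\<Xi> + minus_embed i j \<xi>) \<bullet> (plus_proj i j A + minus_embed i j v) = \<Xi> \<bullet> plus_proj i j A + \<xi> \<bullet> v" for A v
    using inner_minus_embed[OF ij, of "plus_proj i j A" \<xi>] inner_minus_embed[OF ij, of \<Xi> v] inner_minus_embed[OF ij, of "minus_embed i j \<xi>" v]
    by (simp add: inner_add_left inner_add_right inner_commute[of "minus_embed i j \<xi>" "plus_proj i j A"]
        minus_part_plus_proj[OF ij] minus_part_minus_embed[OF ij] \<Xi>)
  have ex: "exp (- \<i> * complex_of_real (s + t)) = exp (- \<i> * of_real s) * exp (- \<i> * of_real t)" for s t
    by (simp add: exp_add[symmetric] algebra_simps)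
  have "(LINT \<delta>|lborel. F \<delta>) = (LINT v|lborel. LINT A|lborel. indicator (cbox 0 One) (minus_part i j A) * F (plus_proj i j A + minus_embed i j v))"
    by (rule integral_slice[OF ij Fi])
  also have "\<dots> = (LINT v|lborel. LINT A|lborel. (indicator (cbox 0 One) (minus_part i j A) *
     (K (Y + (h / 2) *\<^sub>R plus_proj i j A + minus_embed i j (x + (h / 2) *\<^sub>R v)) (Y - (h / 2) *\<^sub>R plus_proj i j A + minus_embed i j (x - (h / 2) *\<^sub>R v)) *
      exp (- \<i> * of_real (\<Xi> \<bullet> plus_proj i j A)))) * exp (- \<i> * of_real (\<xi> \<bullet> v)))"
    unfolding F_def arg1 arg2 inn ex by (simp only: mult.assoc)
  also have "\<dots> = fourier (\<lambda>v. partial_kernel h i j K Y \<Xi> (x + (h / 2) *\<^sub>R v) (x - (h / 2) *\<^sub>R v)) \<xi>"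
    unfolding fourier_def partial_kernel_def by (simp only: integral_mult_left_zero)
  finally show ?thesis
    unfolding wigner_def F_def Z_def by simp
qed

text \<open>Sliced along the minus variable, the exchange is \<open>v \<mapsto> - v\<close>, which
  preserves Lebesgue measure.\<close>

lemma nn_integral_exchange:
  fixes F :: "('d::finite, 'n::finite) config \<Rightarrow> ennreal"
  assumes ij: "i \<noteq> j" and F: "F \<in> borel_measurable borel"
  shows "(\<integral>\<^sup>+A. F (exchange i j A) \<partial>lborel) = (\<integral>\<^sup>+A. F A \<partial>lborel)"
proof -
  have FE: "(\<lambda>A. F (exchange i j A)) \<in> borel_measurable borel"
    by (rule borel_measurable_comp_continuous[OF F]) (intro continuous_intros)
  have "(\<integral>\<^sup>+v. indicator (cbox 0 One) (minus_part i j A) * F (plus_proj i j A + minus_embed i j (- v)) \<partial>lborel)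
      = (\<integral>\<^sup>+v. indicator (cbox 0 One) (minus_part i j A) * F (plus_proj i j A + minus_embed i j v) \<partial>lborel)" for A
  proof -
    have "(\<lambda>v. indicator (cbox 0 One) (minus_part i j A) * F (plus_proj i j A + minus_embed i j v)) \<in> borel_measurable borel"
      by (intro borel_measurable_times_ennreal borel_measurable_const borel_measurable_comp_continuous[OF F] continuous_intros)
    from nn_integral_lborel_affine[OF _ this, of "-1" 0] show ?thesis by simp
  qed
  then show ?thesis
    unfolding nn_integral_slice[OF ij FE] nn_integral_slice[OF ij F]
    by (simp add: exchange_add exchange_plus_proj[OF ij] exchange_minus_embed[OF ij])
qed

lemma lborel_exchange:
  assumes ij: "i \<noteq> j"
  shows "distr lborel borel (exchange i j) = (lborel :: ('d::finite, 'n::finite) config measure)"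
proof (rule measure_eqI)
  have mE: "exchange i j \<in> borel_measurable (borel :: ('d, 'n) config measure)"
    by (intro borel_measurable_continuous_onI continuous_intros)
  fix S :: "('d, 'n) config set" assume "S \<in> sets (distr lborel borel (exchange i j))"
  then have S: "S \<in> sets borel" by simp
  then have mS: "(indicator S :: _ \<Rightarrow> ennreal) \<in> borel_measurable borel" by simp
  have "emeasure (distr lborel borel (exchange i j)) S = (\<integral>\<^sup>+A. indicator S A \<partial>distr lborel borel (exchange i j))"
    using S by simp
  also have "\<dots> = (\<integral>\<^sup>+A. indicator S (exchange i j A) \<partial>lborel)"
    using mE mS by (intro nn_integral_distr) simp_all
  also have "\<dots> = emeasure lborel S" using nn_integral_exchange[OF ij mS] S by simp
  finally show "emeasure (distr lborel borel (exchange i j)) S = emeasure lborel S" .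
qed simp

lemma integral_exchange:
  fixes F :: "('d::finite, 'n::finite) config \<Rightarrow> complex"
  assumes ij: "i \<noteq> j" and F: "F \<in> borel_measurable borel"
  shows "(LINT A|lborel. F (exchange i j A)) = (LINT A|lborel. F A)"
proof -
  have mE: "exchange i j \<in> borel_measurable (borel :: ('d, 'n) config measure)"
    by (intro borel_measurable_continuous_onI continuous_intros)
  have "(LINT A|lborel. F A) = (LINT A|distr lborel borel (exchange i j). F A)"
    unfolding lborel_exchange[OF ij] ..
  also have "\<dots> = (LINT A|lborel. F (exchange i j A))"
    using mE F by (intro integral_distr) simp_all
  finally show ?thesis ..
qed

text \<open>The exchange is an orthogonal involution that preserves Lebesgue measure: substituting
  it in \<open>\<delta>\<close> moves it from the left argument to the right one. The claim on
  \<open>V\<close> thus follows from the one on \<open>U\<close> at the exchanged point, where both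
  minus parts change sign.\<close>

lemma wigner_V_exchange:
  fixes K :: "('d::finite, 'n::finite) kernel"
  assumes ij: "i \<noteq> j" and mK: "(\<lambda>z. K (fst z) (snd z)) \<in> borel_measurable borel"
  shows "wigner h (V_exchange i j K) Y \<Xi> = wigner h (U_exchange i j K) (exchange i j Y) (exchange i j \<Xi>)"
proof -
  define F where "F \<delta> = K (exchange i j (Y + (h / 2) *\<^sub>R \<delta>)) (Y - (h / 2) *\<^sub>R \<delta>) * exp (- \<i> * of_real (\<Xi> \<bullet> \<delta>))" for \<delta>
  have "F \<in> borel_measurable borel"
    unfolding F_def[abs_def]
    by (intro borel_measurable_times borel_measurable_exp_inner borel_measurable_kernel_comp[OF mK] continuous_intros)
  from integral_exchange[OF ij this]
  have "(LINT \<delta>|lborel. F \<delta>) = (LINT \<delta>|lborel. F (exchange i j \<delta>))" ..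
  also have "\<dots> = (LINT \<delta>|lborel. K (exchange i j Y + (h / 2) *\<^sub>R \<delta>) (exchange i j (exchange i j Y - (h / 2) *\<^sub>R \<delta>)) *
      exp (- \<i> * of_real (exchange i j \<Xi> \<bullet> \<delta>)))"
    unfolding F_def by (simp only: exchange_add exchange_diff exchange_scaleR exchange_exchange inner_exchange[OF ij])
  finally show ?thesis
    unfolding wigner_def V_exchange_def U_exchange_def F_def by simp
qed

lemma borel_measurable_U_exchange:
  fixes K :: "('d::finite, 'n::finite) kernel"
  assumes mK: "(\<lambda>z. K (fst z) (snd z)) \<in> borel_measurable borel"
  shows "(\<lambda>z. U_exchange i j K (fst z) (snd z)) \<in> borel_measurable borel"
  unfolding U_exchange_def by (intro borel_measurable_kernel_comp[OF mK] continuous_intros)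

text \<open>The base point has minus part 0 and is fixed by the exchange, as is
  \<open>plus_proj i j A\<close>; only the sign of \<open>b\<close> changes.\<close>

lemma partial_kernel_U_exchange:
  assumes ij: "i \<noteq> j"
  shows "partial_kernel h i j (U_exchange i j K) (from_parts i j q 0 X) \<Xi> a b = partial_kernel h i j K (from_parts i j q 0 X) \<Xi> a (- b)"
  unfolding partial_kernel_def U_exchange_def
  by (simp add: exchange_add exchange_diff exchange_scaleR exchange_plus_proj[OF ij] exchange_minus_embed[OF ij] exchange_from_parts[OF ij])

text \<open>The core of the result, free of null sets in the parameters: with domination everywhere,
  both Wigner functions are at each point Fourier transforms of sections of the same
  \<open>G\<close>.\<close>

theorem wigner_exchange_dominated:
  fixes K :: "('d::finite, 'n::finite) kernel"
  assumes h: "h > 0" and ij: "i \<noteq> j" and mK: "(\<lambda>z. K (fst z) (snd z)) \<in> borel_measurable borel"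
    and mB: "B \<in> borel_measurable borel" and K: "\<And>X Y. cmod (K X Y) \<le> B X * B Y" and B0: "\<And>X. B X \<ge> 0"
    and fin: "(\<integral>\<^sup>+A. ennreal ((B A)\<^sup>2) \<partial>lborel) < \<infinity>"
  shows "has_symplectic_fourier (h / 2) (\<lambda>(x, \<xi>). wigner_rotated h i j K X \<Xi> qp pp x \<xi>)
    (\<lambda>(q, p). wigner_rotated h i j (U_exchange i j K) X \<Xi> qp pp q p)"
proof -
  define Y0 where "Y0 = from_parts i j qp 0 X"
  define \<Xi>0 where "\<Xi>0 = from_parts i j pp 0 \<Xi>"
  define c where "c = 1 / complex_of_real ((2 * pi) ^ (CARD('d) * CARD('n)))"
  define k where "k = partial_kernel h i j K Y0 \<Xi>0"
  define G where "G z = k (fst z + (h / 2) *\<^sub>R snd z) (fst z - (h / 2) *\<^sub>R snd z)" for z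
  have mk: "(\<lambda>z. k (fst z) (snd z)) \<in> borel_measurable borel"
    unfolding k_def by (rule borel_measurable_partial_kernel[OF mK])
  have h2: "h / 2 \<noteq> 0" "- (h / 2) \<noteq> 0" using h by simp_all
  have b1: "ennreal (cmod (k a b)) \<le> slice_mass i j B Y0 (h / 2) a + slice_mass i j B Y0 (- (h / 2)) b" for a b
    unfolding k_def by (rule partial_kernel_bounds(1)[OF mB mB K B0 B0])
  have b2: "ennreal ((cmod (k a b))\<^sup>2) \<le> slice_mass i j B Y0 (h / 2) a * slice_mass i j B Y0 (- (h / 2)) b" for a b
    unfolding k_def by (rule partial_kernel_bounds(2)[OF mB mB K B0 B0])
  note secs = sections_of_dominated_kernel[OF h mk borel_measurable_slice_mass[OF mB] borel_measurable_slice_mass[OF mB]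
      nn_integral_slice_mass[OF ij mB fin h2(1)] nn_integral_slice_mass[OF ij mB fin h2(2)] b1 b2]
  have G: "square_integrable G" "integrable lborel (\<lambda>v. G (x, v))" "integrable lborel (\<lambda>x. G (x, v))" for x v
    unfolding G_def by (rule secs(1), rule secs(2), rule secs(3))
  have \<Xi>0: "minus_part i j \<Xi>0 = 0" unfolding \<Xi>0_def by (rule minus_part_from_parts[OF ij])
  \<comment> \<open>The exchanged kernel is dominated by \<open>B X * BE Y\<close>, and this weight
    has the same norm as \<open>B\<close>.\<close>
  define BE where "BE A = B (exchange i j A)" for A
  have mBE: "BE \<in> borel_measurable borel"
    unfolding BE_def[abs_def] by (rule borel_measurable_comp_continuous[OF mB]) (intro continuous_intros)
  have finE: "(\<integral>\<^sup>+A. ennreal ((BE A)\<^sup>2) \<partial>lborel) < \<infinity>"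
  proof -
    have "(\<lambda>A. ennreal ((B A)\<^sup>2)) \<in> borel_measurable borel" using mB by measurable
    from nn_integral_exchange[OF ij this] fin show ?thesis by (simp add: BE_def)
  qed
  have intK: "integrable lborel (\<lambda>\<delta>. K (Y + (h / 2) *\<^sub>R \<delta>) (Y - (h / 2) *\<^sub>R \<delta>))" for Y
    by (rule integrable_dominated_kernel_line[OF mK mB mB K B0 B0 fin fin h2(1)])
  have intU: "integrable lborel (\<lambda>\<delta>. U_exchange i j K (Y + (h / 2) *\<^sub>R \<delta>) (Y - (h / 2) *\<^sub>R \<delta>))" for Y
    by (rule integrable_dominated_kernel_line[OF borel_measurable_U_exchange[OF mK] mB mBE _ B0 _ fin finE h2(1)])
       (simp_all add: U_exchange_def BE_def K B0)
  have "wigner_rotated h i j K X \<Xi> qp pp x \<xi> = c * fourier (\<lambda>v. G (x, v)) \<xi>" for x \<xi>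
    unfolding wigner_rotated_def from_parts_split[of i j qp x] from_parts_split[of i j pp \<xi>] Y0_def[symmetric] \<Xi>0_def[symmetric]
      wigner_eq_fourier_partial_kernel[OF ij intK \<Xi>0] c_def G_def k_def fst_conv snd_conv ..
  moreover have "wigner_rotated h i j (U_exchange i j K) X \<Xi> qp pp q p
      = c * fourier (\<lambda>v. G ((h / 2) *\<^sub>R v, (2 / h) *\<^sub>R q)) p" for q p
  proof -
    \<comment> \<open>With \<open>a = q + h v / 2\<close> and \<open>b = q - h v / 2\<close> the
      pair \<open>(a, - b)\<close> has midpoint \<open>h v / 2\<close> and half difference
      \<open>q\<close>: position and difference change roles.\<close>
    have "- (q - (h / 2) *\<^sub>R v) = (h / 2) *\<^sub>R v - q" "q + (h / 2) *\<^sub>R v = (h / 2) *\<^sub>R v + q" for v by simp_all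
    then have "partial_kernel h i j (U_exchange i j K) Y0 \<Xi>0 (q + (h / 2) *\<^sub>R v) (q - (h / 2) *\<^sub>R v)
        = G ((h / 2) *\<^sub>R v, (2 / h) *\<^sub>R q)" for v
      unfolding Y0_def partial_kernel_U_exchange[OF ij] using h by (simp add: G_def k_def Y0_def add.commute)
    then show ?thesis
      unfolding wigner_rotated_def from_parts_split[of i j qp q] from_parts_split[of i j pp p] Y0_def[symmetric] \<Xi>0_def[symmetric]
        wigner_eq_fourier_partial_kernel[OF ij intU \<Xi>0] c_def by simp
  qed
  ultimately show ?thesis
    using has_symplectic_fourier_of_sections[OF h G, of c] by simp
qed

text \<open>The map from \<open>(Y, \<delta>)\<close> to the two kernel arguments is linear and
  invertible, so it respects null sets. It is taken apart into a shift of \<open>Y\<close> for fixed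
  \<open>\<delta>\<close> and a scaling of \<open>\<delta>\<close> for fixed
  \<open>Y\<close>.\<close>

lemma AE_kernel_line:
  fixes N :: "('a::euclidean_space \<times> 'a) set"
  assumes N: "N \<in> null_sets lborel" and h: "h > 0"
  shows "AE Y in lborel. AE \<delta> in lborel. (Y + (h / 2) *\<^sub>R \<delta>, Y - (h / 2) *\<^sub>R \<delta>) \<notin> N"
proof -
  have mN: "(indicator N :: _ \<Rightarrow> ennreal) \<in> borel_measurable borel" and N': "N \<in> sets borel"
    using N by (auto simp: null_sets_def)
  have m1: "(\<lambda>z::'a \<times> 'a. indicator N (fst z + (h / 2) *\<^sub>R snd z, fst z - (h / 2) *\<^sub>R snd z) :: ennreal) \<in> borel_measurable borel"
    by (intro borel_measurable_comp_continuous[OF mN] continuous_intros)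
  have m2: "(\<lambda>z::'a \<times> 'a. indicator N (fst z, fst z - h *\<^sub>R snd z) :: ennreal) \<in> borel_measurable borel"
    by (intro borel_measurable_comp_continuous[OF mN] continuous_intros)
  have "(\<integral>\<^sup>+Y. \<integral>\<^sup>+\<delta>. indicator N (Y + (h / 2) *\<^sub>R \<delta>, Y - (h / 2) *\<^sub>R \<delta>) \<partial>lborel \<partial>lborel)
      = (\<integral>\<^sup>+\<delta>. \<integral>\<^sup>+Y. indicator N (Y + (h / 2) *\<^sub>R \<delta>, Y - (h / 2) *\<^sub>R \<delta>) \<partial>lborel \<partial>lborel)"
    using nn_integral_lborel_pair[OF m1] by simp
  also have "\<dots> = (\<integral>\<^sup>+\<delta>. \<integral>\<^sup>+Y. indicator N (Y, Y - h *\<^sub>R \<delta>) \<partial>lborel \<partial>lborel)"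
  proof (rule nn_integral_cong)
    fix \<delta> :: 'a
    have m: "(\<lambda>Y. indicator N (Y, Y - h *\<^sub>R \<delta>) :: ennreal) \<in> borel_measurable borel"
      by (intro borel_measurable_comp_continuous[OF mN] continuous_intros)
    have e: "(h / 2) *\<^sub>R \<delta> + Y - h *\<^sub>R \<delta> = Y - (h / 2) *\<^sub>R \<delta>" for Y
      by (simp add: algebra_simps scaleR_left_distrib[symmetric])
    show "(\<integral>\<^sup>+Y. indicator N (Y + (h / 2) *\<^sub>R \<delta>, Y - (h / 2) *\<^sub>R \<delta>) \<partial>lborel) = (\<integral>\<^sup>+Y. indicator N (Y, Y - h *\<^sub>R \<delta>) \<partial>lborel)"
      using nn_integral_lborel_translate[OF m, of "(h / 2) *\<^sub>R \<delta>"] unfolding e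
      by (simp only: add.commute[of "(h / 2) *\<^sub>R \<delta>"])
  qed
  also have "\<dots> = (\<integral>\<^sup>+Y. \<integral>\<^sup>+\<delta>. indicator N (Y, Y + (- h) *\<^sub>R \<delta>) \<partial>lborel \<partial>lborel)"
    using nn_integral_lborel_pair[OF m2] by simp
  also have "\<dots> = 0"
  proof -
    have "(\<integral>\<^sup>+Y. \<integral>\<^sup>+\<delta>. indicator N (Y, \<delta>) \<partial>lborel \<partial>lborel) = (0::ennreal)"
      using nn_integral_lborel_pair(1)[OF mN] N N' by (simp add: null_sets_def)
    then have "AE Y in lborel. (\<integral>\<^sup>+\<delta>. indicator N (Y, \<delta>) \<partial>lborel) = (0::ennreal)"
      using borel_measurable_nn_integral_snd[OF mN] by (subst (asm) nn_integral_0_iff_AE) simp_all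
    then have "AE Y in lborel. (\<integral>\<^sup>+\<delta>. indicator N (Y, Y + (- h) *\<^sub>R \<delta>) \<partial>lborel) = (0::ennreal)"
    proof eventually_elim
      case (elim Y)
      have "(\<lambda>\<delta>. indicator N (Y, \<delta>) :: ennreal) \<in> borel_measurable borel"
        by (intro borel_measurable_comp_continuous[OF mN] continuous_intros)
      from nn_integral_lborel_affine[OF _ this, of "- h" Y] h elim
      have "ennreal (h ^ DIM('a)) * (\<integral>\<^sup>+\<delta>. indicator N (Y, Y + (- h) *\<^sub>R \<delta>) \<partial>lborel) = 0" by simp
      moreover have "ennreal (h ^ DIM('a)) > 0" using h by (simp only: ennreal_less_zero_iff) simp
      ultimately show ?case by (metis mult_eq_0_iff less_irrefl)
    qed
    then show ?thesis by (simp add: nn_integral_cong_AE[where v = "\<lambda>_. 0"])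
  qed
  finally have "AE Y in lborel. (\<integral>\<^sup>+\<delta>. indicator N (Y + (h / 2) *\<^sub>R \<delta>, Y - (h / 2) *\<^sub>R \<delta>) \<partial>lborel) = (0::ennreal)"
    using borel_measurable_nn_integral_snd[OF m1] by (subst (asm) nn_integral_0_iff_AE) simp_all
  then show ?thesis
  proof eventually_elim
    case (elim Y)
    have "(\<lambda>\<delta>. indicator N (Y + (h / 2) *\<^sub>R \<delta>, Y - (h / 2) *\<^sub>R \<delta>) :: ennreal) \<in> borel_measurable borel"
      by (intro borel_measurable_comp_continuous[OF mN] continuous_intros)
    then have "AE \<delta> in lborel. indicator N (Y + (h / 2) *\<^sub>R \<delta>, Y - (h / 2) *\<^sub>R \<delta>) = (0::ennreal)"
      using elim by (subst (asm) nn_integral_0_iff_AE) simp_all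
    then show ?case by eventually_elim (simp add: indicator_eq_0_iff)
  qed
qed

text \<open>The coordinates \<open>(X, q, x)\<close> are redundant. After shifts of \<open>q\<close>
  and \<open>x\<close> the configuration is \<open>X\<close> plus a vector depending on
  \<open>q\<close> and \<open>x\<close> only; for fixed \<open>q\<close> and \<open>x\<close> this
  is a translation of \<open>X\<close>, which preserves null sets.\<close>

lemma AE_from_parts:
  fixes P :: "('d::finite, 'n::finite) config \<Rightarrow> bool"
  assumes ij: "i \<noteq> j" and P: "AE Y in lborel. P Y"
  shows "AE (X, q) in lborel. AE x in lborel. P (from_parts i j q x X)"
proof -
  obtain N where N: "N \<in> null_sets lborel" "\<And>Y. Y \<notin> N \<Longrightarrow> P Y"
    using P by (auto simp: eventually_ae_filter)
  have mN: "(indicator N :: _ \<Rightarrow> ennreal) \<in> borel_measurable borel" and N': "N \<in> sets borel"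
    using N by (auto simp: null_sets_def)
  have m1: "(\<lambda>p. indicator N (from_parts i j (snd (fst p)) (snd p) (fst (fst p))) :: ennreal) \<in> borel_measurable borel"
    by (intro borel_measurable_comp_continuous[OF mN] continuous_intros)
  have m1': "(\<lambda>z. \<integral>\<^sup>+x. indicator N (from_parts i j (snd z) x (fst z)) \<partial>lborel :: ennreal) \<in> borel_measurable borel"
    using borel_measurable_nn_integral_snd[OF m1] by simp
  define E where "E q x = (from_parts i j q x 0 :: ('d, 'n) config)" for q x
  have contE[continuous_intros]: "continuous_on S (\<lambda>z. E (f z) (g z))" if "continuous_on S f" "continuous_on S g" for S :: "'z::topological_space set" and f g
    unfolding E_def using that by (intro continuous_intros)
  have "(\<integral>\<^sup>+z. \<integral>\<^sup>+x. indicator N (from_parts i j (snd z) x (fst z)) \<partial>lborel \<partial>lborel)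
      = (\<integral>\<^sup>+X. \<integral>\<^sup>+q. \<integral>\<^sup>+x. indicator N (from_parts i j q x X) \<partial>lborel \<partial>lborel \<partial>lborel)"
    using nn_integral_lborel_pair(1)[OF m1'] by simp
  also have "\<dots> = (\<integral>\<^sup>+X. \<integral>\<^sup>+q. \<integral>\<^sup>+x. indicator N (X + E q x) \<partial>lborel \<partial>lborel \<partial>lborel)"
  proof (rule nn_integral_cong)
    fix X :: "('d, 'n) config"
    have e: "from_parts i j q x X = X + E (- plus_part i j X + q) (- minus_part i j X + x)" for q x
      unfolding E_def by (subst from_parts_eq_translate[OF ij]) simp
    have inner: "(\<integral>\<^sup>+x. indicator N (from_parts i j q x X) \<partial>lborel) = (\<integral>\<^sup>+x. indicator N (X + E (- plus_part i j X + q) x) \<partial>lborel)" for q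
    proof -
      have "(\<lambda>x. indicator N (X + E (- plus_part i j X + q) x) :: ennreal) \<in> borel_measurable borel"
        by (intro borel_measurable_comp_continuous[OF mN] continuous_intros)
      from nn_integral_lborel_translate[OF this, of "- minus_part i j X"] show ?thesis
        unfolding e .
    qed
    have "(\<lambda>z. indicator N (X + E (fst z) (snd z)) :: ennreal) \<in> borel_measurable borel"
      by (intro borel_measurable_comp_continuous[OF mN] continuous_intros)
    from nn_integral_lborel_translate[OF borel_measurable_nn_integral_snd[OF this], of "- plus_part i j X"]
    show "(\<integral>\<^sup>+q. \<integral>\<^sup>+x. indicator N (from_parts i j q x X) \<partial>lborel \<partial>lborel)
        = (\<integral>\<^sup>+q. \<integral>\<^sup>+x. indicator N (X + E q x) \<partial>lborel \<partial>lborel)"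
      unfolding inner by (simp only: fst_conv snd_conv)
  qed
  also have "\<dots> = (\<integral>\<^sup>+X. \<integral>\<^sup>+z. indicator N (X + E (fst z) (snd z)) \<partial>lborel \<partial>lborel)"
  proof (rule nn_integral_cong)
    fix X :: "('d, 'n) config"
    have "(\<lambda>z. indicator N (X + E (fst z) (snd z)) :: ennreal) \<in> borel_measurable borel"
      by (intro borel_measurable_comp_continuous[OF mN] continuous_intros)
    from nn_integral_lborel_pair(1)[OF this]
    show "(\<integral>\<^sup>+q. \<integral>\<^sup>+x. indicator N (X + E q x) \<partial>lborel \<partial>lborel) = (\<integral>\<^sup>+z. indicator N (X + E (fst z) (snd z)) \<partial>lborel)" by simp
  qed
  also have "\<dots> = (\<integral>\<^sup>+z. \<integral>\<^sup>+X. indicator N (X + E (fst z) (snd z)) \<partial>lborel \<partial>lborel)"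
  proof -
    have "(\<lambda>p. indicator N (fst p + E (fst (snd p)) (snd (snd p))) :: ennreal) \<in> borel_measurable borel"
      by (intro borel_measurable_comp_continuous[OF mN] continuous_intros)
    from nn_integral_lborel_pair[OF this] show ?thesis by simp
  qed
  also have "\<dots> = 0"
  proof -
    have "(\<integral>\<^sup>+X. indicator N (X + u) \<partial>lborel) = (0::ennreal)" for u
      using nn_integral_lborel_translate[OF mN, of u] N N' by (simp add: add.commute null_sets_def)
    then show ?thesis by simp
  qed
  finally have "AE z in lborel. (\<integral>\<^sup>+x. indicator N (from_parts i j (snd z) x (fst z)) \<partial>lborel) = (0::ennreal)"
    using m1' by (subst (asm) nn_integral_0_iff_AE) simp_all
  then have "AE z in lborel. AE x in lborel. P (from_parts i j (snd z) x (fst z))"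
  proof eventually_elim
    case (elim z)
    have "(\<lambda>x. indicator N (from_parts i j (snd z) x (fst z)) :: ennreal) \<in> borel_measurable borel"
      by (intro borel_measurable_comp_continuous[OF mN] continuous_intros)
    then have "AE x in lborel. indicator N (from_parts i j (snd z) x (fst z)) = (0::ennreal)"
      using elim by (subst (asm) nn_integral_0_iff_AE) simp_all
    then show ?case by eventually_elim (simp add: indicator_eq_0_iff N(2))
  qed
  then show ?thesis by (simp add: case_prod_unfold)
qed

section \<open>Wigner functions of density matrices\<close>

lemma AE_lborel_pair_fst:
  assumes "AE x in (lborel :: 'a::euclidean_space measure). P x"
  shows "AE z in (lborel :: ('a \<times> 'b::euclidean_space) measure). P (fst z)"
proof -
  obtain N where N: "N \<in> null_sets lborel" "\<And>x. x \<notin> N \<Longrightarrow> P x"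
    using assms by (auto simp: eventually_ae_filter)
  have "N \<times> (UNIV :: 'b set) \<in> null_sets (lborel \<Otimes>\<^sub>M lborel)"
    using N(1) by (auto simp: null_sets_def lborel.emeasure_pair_measure_Times)
  then have "N \<times> (UNIV :: 'b set) \<in> null_sets lborel" by (simp only: lborel_prod)
  from AE_not_in[OF this] show ?thesis
    by eventually_elim (rule N(2), simp add: mem_Times_iff)
qed

lemma AE_lborel_uminus:
  assumes "AE x in (lborel :: 'a::euclidean_space measure). P x"
  shows "AE x in lborel. P (- x)"
proof -
  obtain N where N: "N \<in> null_sets lborel" "\<And>x. x \<notin> N \<Longrightarrow> P x"
    using assms by (auto simp: eventually_ae_filter)
  have mN: "(indicator N :: 'a \<Rightarrow> ennreal) \<in> borel_measurable borel" and N': "N \<in> sets borel"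
    using N by (auto simp: null_sets_def)
  have m: "(\<lambda>x. indicator N (- x) :: ennreal) \<in> borel_measurable borel"
    by (intro borel_measurable_comp_continuous[OF mN] continuous_intros)
  have "(\<integral>\<^sup>+x. indicator N (- x) \<partial>lborel) = (0::ennreal)"
    using nn_integral_lborel_affine[of "-1" "indicator N" 0] mN N N' by (simp add: null_sets_def)
  then have "AE x in lborel. indicator N (- x) = (0::ennreal)"
    using m by (subst (asm) nn_integral_0_iff_AE) simp_all
  then show ?thesis by eventually_elim (simp add: indicator_eq_0_iff N(2))
qed

lemma symplectic_fourier_integral_cong_AE:
  assumes "AE z in lborel. f z = g z" and f: "f \<in> borel_measurable borel" and g: "g \<in> borel_measurable borel"
  shows "symplectic_fourier_integral h f = symplectic_fourier_integral h g"
proof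
  fix z :: "(real ^ 'a) \<times> (real ^ 'a)"
  obtain q p where z: "z = (q, p)" by (cases z)
  have me: "(\<lambda>w. exp (\<i> * complex_of_real ((q \<bullet> snd w - p \<bullet> fst w) / h))) \<in> borel_measurable borel"
    unfolding divide_inverse by (intro borel_measurable_continuous_onI continuous_intros)
  have "(LINT w|lborel. f w * exp (\<i> * of_real ((q \<bullet> snd w - p \<bullet> fst w) / h)))
      = (LINT w|lborel. g w * exp (\<i> * of_real ((q \<bullet> snd w - p \<bullet> fst w) / h)))"
  proof (rule integral_cong_AE)
    show "AE w in lborel. f w * exp (\<i> * of_real ((q \<bullet> snd w - p \<bullet> fst w) / h)) = g w * exp (\<i> * of_real ((q \<bullet> snd w - p \<bullet> fst w) / h))"
      using assms(1) by eventually_elim simp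
  qed (use borel_measurable_times[OF f me] borel_measurable_times[OF g me] in \<open>simp_all only: measurable_lborel2\<close>)
  then show "symplectic_fourier_integral h f z = symplectic_fourier_integral h g z"
    by (simp only: symplectic_fourier_integral_def z case_prod_unfold fst_conv snd_conv prod.collapse)
qed

lemma has_symplectic_fourier_cong_AE:
  assumes F: "has_symplectic_fourier h g F" and eq: "AE z in lborel. f z = g z" and f: "f \<in> borel_measurable borel"
  shows "has_symplectic_fourier h f F"
proof -
  have g: "square_integrable g" "g \<in> borel_measurable borel"
    using F by (simp_all add: has_symplectic_fourier_def square_integrable_def)
  have "(\<integral>\<^sup>+z. ennreal ((cmod (f z))\<^sup>2) \<partial>lborel) = (\<integral>\<^sup>+z. ennreal ((cmod (g z))\<^sup>2) \<partial>lborel)"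
    using eq by (intro nn_integral_cong_AE, eventually_elim) simp
  then have "square_integrable f"
    using g f by (simp add: square_integrable_iff_nn_integral)
  moreover have "symplectic_fourier_integral h (\<lambda>w. indicator (cball 0 R) w * f w)
      = symplectic_fourier_integral h (\<lambda>w. indicator (cball 0 R) w * g w)" for R
  proof (rule symplectic_fourier_integral_cong_AE)
    show "AE z in lborel. indicator (cball 0 R) z * f z = indicator (cball 0 R) z * g z"
      using eq by eventually_elim simp
    show "(\<lambda>w. indicator (cball 0 R) w * f w) \<in> borel_measurable borel"
      using f by (intro borel_measurable_times borel_measurable_indicator) auto
    show "(\<lambda>w. indicator (cball 0 R) w * g w) \<in> borel_measurable borel"
      using g(2) by (intro borel_measurable_times borel_measurable_indicator) auto
  qed
  ultimately show ?thesis using F by (simp add: has_symplectic_fourier_def)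
qed

lemma borel_measurable_wigner_rotated:
  fixes K :: "('d::finite, 'n::finite) kernel"
  assumes mK: "(\<lambda>z. K (fst z) (snd z)) \<in> borel_measurable borel"
  shows "(\<lambda>(x, \<xi>). wigner_rotated h i j K X \<Xi> qp pp x \<xi>) \<in> borel_measurable borel"
proof -
  have "(\<lambda>p::((real ^ 'd) \<times> (real ^ 'd)) \<times> ('d, 'n) config.
      K (from_parts i j qp (fst (fst p)) X + (h / 2) *\<^sub>R snd p) (from_parts i j qp (fst (fst p)) X - (h / 2) *\<^sub>R snd p)
        * exp (- \<i> * complex_of_real (from_parts i j pp (snd (fst p)) \<Xi> \<bullet> snd p))) \<in> borel_measurable borel"
  proof (rule borel_measurable_times)
    show "(\<lambda>p::((real ^ 'd) \<times> (real ^ 'd)) \<times> ('d, 'n) config.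
      K (from_parts i j qp (fst (fst p)) X + (h / 2) *\<^sub>R snd p) (from_parts i j qp (fst (fst p)) X - (h / 2) *\<^sub>R snd p)) \<in> borel_measurable borel"
      by (intro borel_measurable_kernel_comp[OF mK] continuous_intros)
    show "(\<lambda>p::((real ^ 'd) \<times> (real ^ 'd)) \<times> ('d, 'n) config.
      exp (- \<i> * complex_of_real (from_parts i j pp (snd (fst p)) \<Xi> \<bullet> snd p))) \<in> borel_measurable borel"
      by (intro borel_measurable_continuous_onI continuous_intros)
  qed
  from borel_measurable_times[OF borel_measurable_const borel_measurable_integral_snd[OF this]]
  show ?thesis unfolding wigner_rotated_def wigner_def case_prod_unfold by (simp only: fst_conv snd_conv)
qed

text \<open>For almost every \<open>Y\<close> the kernels agree almost everywhere on the line
  through \<open>Y\<close>. The momentum enters only through the phase, so one null set of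
  \<open>Y\<close> serves all \<open>\<Xi>\<close>.\<close>

lemma wigner_cong_AE:
  fixes K L :: "('d::finite, 'n::finite) kernel"
  assumes mK: "(\<lambda>z. K (fst z) (snd z)) \<in> borel_measurable borel" and mL: "(\<lambda>z. L (fst z) (snd z)) \<in> borel_measurable borel"
    and eq: "AE z in lborel. K (fst z) (snd z) = L (fst z) (snd z)" and h: "h > 0"
  shows "AE Y in lborel. \<forall>\<Xi>. wigner h K Y \<Xi> = wigner h L Y \<Xi>"
proof -
  obtain N where N: "N \<in> null_sets lborel" "\<And>z. z \<notin> N \<Longrightarrow> K (fst z) (snd z) = L (fst z) (snd z)"
    using eq by (auto simp: eventually_ae_filter)
  show ?thesis
    using AE_kernel_line[OF N(1) h]
  proof eventually_elim
    case (elim Y)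
    show ?case
    proof
      fix \<Xi>
      have "(LINT \<delta>|lborel. K (Y + (h / 2) *\<^sub>R \<delta>) (Y - (h / 2) *\<^sub>R \<delta>) * exp (- \<i> * of_real (\<Xi> \<bullet> \<delta>)))
          = (LINT \<delta>|lborel. L (Y + (h / 2) *\<^sub>R \<delta>) (Y - (h / 2) *\<^sub>R \<delta>) * exp (- \<i> * of_real (\<Xi> \<bullet> \<delta>)))"
      proof (rule integral_cong_AE)
        have "(\<lambda>\<delta>. K (Y + (h / 2) *\<^sub>R \<delta>) (Y - (h / 2) *\<^sub>R \<delta>) * exp (- \<i> * of_real (\<Xi> \<bullet> \<delta>))) \<in> borel_measurable borel"
          "(\<lambda>\<delta>. L (Y + (h / 2) *\<^sub>R \<delta>) (Y - (h / 2) *\<^sub>R \<delta>) * exp (- \<i> * of_real (\<Xi> \<bullet> \<delta>))) \<in> borel_measurable borel"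
          by (intro borel_measurable_times borel_measurable_exp_inner borel_measurable_kernel_comp[OF mK]
              borel_measurable_kernel_comp[OF mL] continuous_intros)+
        then show "(\<lambda>\<delta>. K (Y + (h / 2) *\<^sub>R \<delta>) (Y - (h / 2) *\<^sub>R \<delta>) * exp (- \<i> * of_real (\<Xi> \<bullet> \<delta>))) \<in> borel_measurable lborel"
          "(\<lambda>\<delta>. L (Y + (h / 2) *\<^sub>R \<delta>) (Y - (h / 2) *\<^sub>R \<delta>) * exp (- \<i> * of_real (\<Xi> \<bullet> \<delta>))) \<in> borel_measurable lborel"
          by simp_all
        show "AE \<delta> in lborel. K (Y + (h / 2) *\<^sub>R \<delta>) (Y - (h / 2) *\<^sub>R \<delta>) * exp (- \<i> * of_real (\<Xi> \<bullet> \<delta>))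
            = L (Y + (h / 2) *\<^sub>R \<delta>) (Y - (h / 2) *\<^sub>R \<delta>) * exp (- \<i> * of_real (\<Xi> \<bullet> \<delta>))"
          using elim by eventually_elim (use N(2) in force)
      qed
      then show "wigner h K Y \<Xi> = wigner h L Y \<Xi>" by (simp only: wigner_def)
    qed
  qed
qed

text \<open>The exchange preserves Lebesgue measure on each section with fixed first argument, hence
  null sets of pairs.\<close>

lemma AE_U_exchange:
  fixes K L :: "('d::finite, 'n::finite) kernel"
  assumes ij: "i \<noteq> j" and eq: "AE z in lborel. K (fst z) (snd z) = L (fst z) (snd z)"
  shows "AE z in lborel. U_exchange i j K (fst z) (snd z) = U_exchange i j L (fst z) (snd z)"
proof -
  obtain N where N: "N \<in> null_sets lborel" "\<And>z. z \<notin> N \<Longrightarrow> K (fst z) (snd z) = L (fst z) (snd z)"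
    using eq by (auto simp: eventually_ae_filter)
  have mN: "(indicator N :: _ \<Rightarrow> ennreal) \<in> borel_measurable borel" and N': "N \<in> sets borel"
    using N by (auto simp: null_sets_def)
  have m: "(\<lambda>z. indicator N (fst z, exchange i j (snd z)) :: ennreal) \<in> borel_measurable borel"
    by (intro borel_measurable_comp_continuous[OF mN] continuous_intros)
  have "(\<integral>\<^sup>+z. indicator N (fst z, exchange i j (snd z)) \<partial>lborel)
      = (\<integral>\<^sup>+x. \<integral>\<^sup>+y. indicator N (x, exchange i j y) \<partial>lborel \<partial>lborel)"
    using nn_integral_lborel_pair(1)[OF m] by simp
  also have "\<dots> = (\<integral>\<^sup>+x. \<integral>\<^sup>+y. indicator N (x, y) \<partial>lborel \<partial>lborel)"
  proof (rule nn_integral_cong)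
    fix x
    have "(\<lambda>y. indicator N (x, y) :: ennreal) \<in> borel_measurable borel"
      by (intro borel_measurable_comp_continuous[OF mN] continuous_intros)
    then show "(\<integral>\<^sup>+y. indicator N (x, exchange i j y) \<partial>lborel) = (\<integral>\<^sup>+y. indicator N (x, y) \<partial>lborel)"
      by (rule nn_integral_exchange[OF ij])
  qed
  also have "\<dots> = (0::ennreal)"
    using nn_integral_lborel_pair(1)[OF mN] N N' by (simp add: null_sets_def)
  finally have "AE z in lborel. indicator N (fst z, exchange i j (snd z)) = (0::ennreal)"
    using m by (subst (asm) nn_integral_0_iff_AE) simp_all
  then show ?thesis
    by eventually_elim (use N(2) in \<open>force simp: U_exchange_def indicator_eq_0_iff\<close>)
qed

text \<open>The quantifier over almost all \<open>(X, qp)\<close> reflects that the kernel is given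
  only up to a null set; for such a position all momenta are allowed. The existential
  \<open>F\<close> expresses a transform defined up to null sets, one and the same for both
  exchanges.\<close>

theorem lemma4p1:
  fixes h :: real
    and \<rho> :: "('d::finite, 'n::finite) config L2_operator"
    and K :: "('d, 'n) kernel"
    and i j :: 'n
  assumes "h > 0"
    and "density_matrix \<rho>"
    and "integral_kernel \<rho> K"
    and "i \<noteq> j"
  shows "AE (X, qp) in lborel. \<forall>\<Xi> pp. \<exists>F.
      has_symplectic_fourier (h / 2) (\<lambda>(x, \<xi>). wigner_rotated h i j K X \<Xi> qp pp x \<xi>) F \<and>
      (AE (qm, pm) in lborel.
         wigner_rotated h i j (U_exchange i j K) X \<Xi> qp pp qm pm = F (qm, pm)) \<and>
      (AE (qm, pm) in lborel.
         wigner_rotated h i j (V_exchange i j K) X \<Xi> qp pp qm pm = F (- qm, - pm))"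
proof -
  note h = assms(1) and ij = assms(4)
  obtain B :: "('d, 'n) config \<Rightarrow> real" where mB: "B \<in> borel_measurable borel" and B0: "\<And>x. B x \<ge> 0"
    and fin: "(\<integral>\<^sup>+x. ennreal ((B x)\<^sup>2) \<partial>lborel) < \<infinity>"
    and KB: "AE z in lborel. cmod (K (fst z) (snd z)) \<le> B (fst z) * B (snd z)"
    by (rule density_matrix_kernel_bound[OF assms(2,3)]) blast
  have mK: "(\<lambda>z. K (fst z) (snd z)) \<in> borel_measurable borel"
    using assms(3) by (simp add: integral_kernel_def square_integrable_def case_prod_unfold)
  \<comment> \<open>A version of \<open>K\<close> for which the bound holds everywhere; the
    estimates are made for \<open>L\<close> and transferred back to \<open>K\<close>.\<close>
  define L where "L X Y = (if cmod (K X Y) \<le> B X * B Y then K X Y else 0)" for X Y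
  have mL: "(\<lambda>z. L (fst z) (snd z)) \<in> borel_measurable borel"
  proof -
    have "(\<lambda>z. B (fst z) * B (snd z)) \<in> borel_measurable (borel :: (('d, 'n) config \<times> ('d, 'n) config) measure)"
      by (intro borel_measurable_times borel_measurable_comp_continuous[OF mB] continuous_intros)
    then show ?thesis
      unfolding L_def using mK by measurable
  qed
  have LB: "cmod (L X Y) \<le> B X * B Y" for X Y
    using B0 by (simp add: L_def)
  have KL: "AE z in lborel. K (fst z) (snd z) = L (fst z) (snd z)"
    using KB by eventually_elim (simp add: L_def)
  have "AE Y in lborel. \<forall>\<Xi>. wigner h K Y \<Xi> = wigner h L Y \<Xi>"
    by (rule wigner_cong_AE[OF mK mL KL h])
  moreover have "AE Y in lborel. \<forall>\<Xi>. wigner h (U_exchange i j K) Y \<Xi> = wigner h (U_exchange i j L) Y \<Xi>"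
    by (rule wigner_cong_AE[OF borel_measurable_U_exchange[OF mK] borel_measurable_U_exchange[OF mL] AE_U_exchange[OF ij KL] h])
  ultimately have "AE Y in lborel. (\<forall>\<Xi>. wigner h K Y \<Xi> = wigner h L Y \<Xi>) \<and>
      (\<forall>\<Xi>. wigner h (U_exchange i j K) Y \<Xi> = wigner h (U_exchange i j L) Y \<Xi>)"
    by eventually_elim simp
  from AE_from_parts[OF ij this] show ?thesis
    unfolding case_prod_unfold
  proof eventually_elim
    case (elim Z)
    define X qp where "X = fst Z" and "qp = snd Z"
    have ae: "AE x in lborel. (\<forall>\<xi> \<Xi> pp. wigner_rotated h i j K X \<Xi> qp pp x \<xi> = wigner_rotated h i j L X \<Xi> qp pp x \<xi>) \<and>
        (\<forall>\<xi> \<Xi> pp. wigner_rotated h i j (U_exchange i j K) X \<Xi> qp pp x \<xi> = wigner_rotated h i j (U_exchange i j L) X \<Xi> qp pp x \<xi>)"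
      using elim by eventually_elim (simp add: wigner_rotated_def X_def qp_def)
    show ?case
      unfolding X_def[symmetric] qp_def[symmetric]
    proof (intro allI)
      fix \<Xi> :: "('d, 'n) config" and pp :: "real ^ 'd"
      define F where "F z = wigner_rotated h i j (U_exchange i j L) X \<Xi> qp pp (fst z) (snd z)" for z
      have "has_symplectic_fourier (h / 2) (\<lambda>z. wigner_rotated h i j L X \<Xi> qp pp (fst z) (snd z)) F"
        using wigner_exchange_dominated[OF h ij mL mB LB B0 fin] unfolding F_def[abs_def] case_prod_unfold .
      moreover have "AE z in lborel. wigner_rotated h i j K X \<Xi> qp pp (fst z) (snd z) = wigner_rotated h i j L X \<Xi> qp pp (fst z) (snd z)"
        using AE_lborel_pair_fst[OF ae] by eventually_elim simp
      ultimately have 1: "has_symplectic_fourier (h / 2) (\<lambda>z. wigner_rotated h i j K X \<Xi> qp pp (fst z) (snd z)) F"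
        using borel_measurable_wigner_rotated[OF mK] unfolding case_prod_unfold
        by (rule has_symplectic_fourier_cong_AE)
      have 2: "AE z in lborel. wigner_rotated h i j (U_exchange i j K) X \<Xi> qp pp (fst z) (snd z) = F (fst z, snd z)"
        using AE_lborel_pair_fst[OF ae] by eventually_elim (simp add: F_def)
      have V: "wigner_rotated h i j (V_exchange i j K) X \<Xi> qp pp q p = wigner_rotated h i j (U_exchange i j K) X \<Xi> qp pp (- q) (- p)" for q p
        by (simp add: wigner_rotated_def wigner_V_exchange[OF ij mK] exchange_from_parts[OF ij])
      \<comment> \<open>By \<open>V\<close> the value at \<open>(q, p)\<close> is that of the
        \<open>U\<close> kernel at \<open>(- q, - p)\<close>, so the exceptional null set has to be
        reflected.\<close>
      have 3: "AE z in lborel. wigner_rotated h i j (V_exchange i j K) X \<Xi> qp pp (fst z) (snd z) = F (- fst z, - snd z)"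
        using AE_lborel_pair_fst[OF AE_lborel_uminus[OF ae]] by eventually_elim (simp add: F_def V)
      from 1 2 3 show "\<exists>F. has_symplectic_fourier (h / 2) (\<lambda>z. wigner_rotated h i j K X \<Xi> qp pp (fst z) (snd z)) F \<and>
          (AE z in lborel. wigner_rotated h i j (U_exchange i j K) X \<Xi> qp pp (fst z) (snd z) = F (fst z, snd z)) \<and>
          (AE z in lborel. wigner_rotated h i j (V_exchange i j K) X \<Xi> qp pp (fst z) (snd z) = F (- fst z, - snd z))"
        by blast
    qed
  qed
qed

end
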